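(* Let $C$ be a category with finite products and let $T$ be a Lawvere theory extending the theory of groups. Let $V\colon sT\textrm{-}Alg(C)\to s\mathbf{Grp}(C)$ be the induced forgetful functor, $U\colon s\mathbf{Grp}(C)\to sC$ the forgetful functor, $W\colon s\mathbf{Grp}(C)\to sC$ the universal bundle functor, and $W_{gr}\colon s\mathbf{Grp}(C)\to s\mathbf{Grp}(C)$ the endofunctor defined in the context. Then the formulas defining $W_{gr}$, with the componentwise $T$-algebra structure, define an endofunctor $W_T\colon sT\textrm{-}Alg(C)\to sT\textrm{-}Alg(C)$ which lifts $W_{gr}\circ V$ on the nose, i.e. $V\circ W_T=W_{gr}\circ V$, and hence lifts the composite $W\circ V\colon sT\textrm{-}Alg(C)\to sC$ up to natural isomorphism, i.e. $U\circ V\circ W_T\cong W\circ V$. Moreover, $W_T$ is a monad on $sT\textrm{-}Alg(C)$.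
   Context: $sC$ denotes the category of simplicial objects in $C$, and $s\mathbf{Grp}(C)$ the category of simplicial objects in the category $\mathbf{Grp}(C)$ of group objects in $C$. A Lawvere theory $T$ encodes an algebraic structure given by finitary (including nullary) operations and equations; a $T$-algebra in $C$ is an object of $C$ with the corresponding operations, and $T\textrm{-}Alg(C)$ is the category of these. $T$ extends the theory of groups if it comes with a morphism of theories from the theory of groups to $T$, so that every $T$-algebra has an underlying group, giving a forgetful functor $T\textrm{-}Alg(C)\to\mathbf{Grp}(C)$ that keeps the underlying object of $C$. $sT\textrm{-}Alg(C)$ is the category of simplicial objects in $T\textrm{-}Alg(C)$ (equivalently, $T$-algebras in $sC$), and $V$ is obtained by applying this forgetful functor levelwise. Formulas below are written with elements; in a general category $C$ with finite products they are interpreted using generalised elements. Juxtaposition is group multiplication, and $d_0 g\, h$ means $(d_0g)\cdot h$. Let $G$ be a simplicial group in $C$ with face maps $d_i$ and degeneracy maps $s_i$. The universal bundle $WG\in sC$ has $n$-simplices $(WG)_n=G_n\times\cdots\times G_0$, with face and degeneracy maps $$d_0(g_n,\ldots,g_0)=(d_0g_n\,g_{n-1},\,g_{n-2},\ldots,g_0),$$ $$d_i(g_n,\ldots,g_0)=(d_ig_n,\ldots,d_1g_{n-i+1},\,d_0g_{n-i}\,g_{n-i-1},\,g_{n-i-2},\ldots,g_0)\quad (0<i<n),$$ $$d_n(g_n,\ldots,g_0)=(d_ng_n,\ldots,d_1g_1),$$ $$s_i(g_n,\ldots,g_0)=(s_ig_n,\ldots,s_0g_{n-i},\,1_{G_{n-i}},\,g_{n-i-1},\ldots,g_0),$$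 where $1_{G_{n-i}}$ is the identity element of $G_{n-i}$. This is functorial in $G$, giving $W\colon s\mathbf{Grp}(C)\to sC$. The simplicial group $W_{gr}G$ has $n$-simplices $(W_{gr}G)_n=G_n\times\cdots\times G_0$ with componentwise group structure, and face and degeneracy maps $$d_0(g_n,\ldots,g_0)=(g_{n-1},g_{n-2},\ldots,g_0),$$ $$d_i(g_n,\ldots,g_0)=(d_ig_n,\ldots,d_1g_{n-i+1},\,g_{n-i-1},\ldots,g_0)\quad (i>0),$$ $$s_i(g_n,\ldots,g_0)=(s_ig_n,\ldots,s_0g_{n-i},\,g_{n-i},\,g_{n-i-1},\ldots,g_0)$$ (so $d_n(g_n,\ldots,g_0)=(d_ng_n,\ldots,d_1g_1)$ for $n\ge 1$). This is functorial in $G$, giving $W_{gr}\colon s\mathbf{Grp}(C)\to s\mathbf{Grp}(C)$. For a simplicial $T$-algebra $A$, $W_TA$ has $n$-simplices $A_n\times\cdots\times A_0$ with componentwise $T$-algebra structure, and the face and degeneracy maps given by the same formulas as for $W_{gr}$. *)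

theory Defs
  imports Main
begin

section \<open>Categories, functors, natural transformations, monads\<close>

text \<open>
  A category is given by a family of hom-sets. These need not be disjoint, so an arrow does not
  determine its domain and codomain; the arrow part of a functor takes them as arguments.
  The components are only meaningful on \<open>Ob\<close> and \<open>Hom\<close>.
\<close>

record ('o, 'm) cat =
  Ob :: "'o set"
  Hom :: "'o \<Rightarrow> 'o \<Rightarrow> 'm set"
  Idn :: "'o \<Rightarrow> 'm"
  Cmp :: "'m \<Rightarrow> 'm \<Rightarrow> 'm"  (infixr "\<odot>\<index>" 70)

locale category =
  fixes C :: "('o, 'm, 'z) cat_scheme" (structure)
  assumes idn_in: "A \<in> Ob C \<Longrightarrow> Idn C A \<in> Hom C A A"
    and cmp_in: "\<lbrakk>A \<in> Ob C; B \<in> Ob C; D \<in> Ob C; f \<in> Hom C A B; g \<in> Hom C B D\<rbrakk>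
      \<Longrightarrow> g \<odot> f \<in> Hom C A D"
    and cmp_idn: "\<lbrakk>A \<in> Ob C; B \<in> Ob C; f \<in> Hom C A B\<rbrakk> \<Longrightarrow> f \<odot> Idn C A = f"
    and idn_cmp: "\<lbrakk>A \<in> Ob C; B \<in> Ob C; f \<in> Hom C A B\<rbrakk> \<Longrightarrow> Idn C B \<odot> f = f"
    and cmp_assoc: "\<lbrakk>A \<in> Ob C; B \<in> Ob C; D \<in> Ob C; E \<in> Ob C;
        f \<in> Hom C A B; g \<in> Hom C B D; h \<in> Hom C D E\<rbrakk>
      \<Longrightarrow> (h \<odot> g) \<odot> f = h \<odot> (g \<odot> f)"

record ('o, 'm, 'p, 'q) funct =
  fob :: "'o \<Rightarrow> 'p"
  fmap :: "'o \<Rightarrow> 'o \<Rightarrow> 'm \<Rightarrow> 'q"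

definition is_functor ::
  "('o, 'm, 'y) cat_scheme \<Rightarrow> ('p, 'q, 'z) cat_scheme \<Rightarrow> ('o, 'm, 'p, 'q) funct \<Rightarrow> bool" where
  "is_functor C D F \<longleftrightarrow> category C \<and> category D
    \<and> (\<forall>A\<in>Ob C. fob F A \<in> Ob D)
    \<and> (\<forall>A\<in>Ob C. \<forall>B\<in>Ob C. \<forall>f\<in>Hom C A B. fmap F A B f \<in> Hom D (fob F A) (fob F B))
    \<and> (\<forall>A\<in>Ob C. fmap F A A (Idn C A) = Idn D (fob F A))
    \<and> (\<forall>A\<in>Ob C. \<forall>B\<in>Ob C. \<forall>E\<in>Ob C. \<forall>f\<in>Hom C A B. \<forall>g\<in>Hom C B E.
        fmap F A E (g \<odot>\<^bsub>C\<^esub> f) = fmap F B E g \<odot>\<^bsub>D\<^esub> fmap F A B f)"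

definition id_funct :: "('o, 'm, 'o, 'm) funct" where
  "id_funct = \<lparr>fob = (\<lambda>A. A), fmap = (\<lambda>A B f. f)\<rparr>"

definition comp_funct ::
  "('p, 'q, 'r, 's) funct \<Rightarrow> ('o, 'm, 'p, 'q) funct \<Rightarrow> ('o, 'm, 'r, 's) funct"
  (infixr "\<circ>\<^sub>F" 55) where
  "G \<circ>\<^sub>F F = \<lparr>fob = (\<lambda>A. fob G (fob F A)),
    fmap = (\<lambda>A B f. fmap G (fob F A) (fob F B) (fmap F A B f))\<rparr>"

text \<open>Equality of functors on the nose; it only refers to objects and arrows of the domain.\<close>

definition funct_eq ::
  "('o, 'm, 'y) cat_scheme \<Rightarrow> ('p, 'q, 'z) cat_scheme
    \<Rightarrow> ('o, 'm, 'p, 'q) funct \<Rightarrow> ('o, 'm, 'p, 'q) funct \<Rightarrow> bool" where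
  "funct_eq C D F G \<longleftrightarrow> is_functor C D F \<and> is_functor C D G
    \<and> (\<forall>A\<in>Ob C. fob F A = fob G A)
    \<and> (\<forall>A\<in>Ob C. \<forall>B\<in>Ob C. \<forall>f\<in>Hom C A B. fmap F A B f = fmap G A B f)"

definition nat_trans ::
  "('o, 'm, 'y) cat_scheme \<Rightarrow> ('p, 'q, 'z) cat_scheme
    \<Rightarrow> ('o, 'm, 'p, 'q) funct \<Rightarrow> ('o, 'm, 'p, 'q) funct \<Rightarrow> ('o \<Rightarrow> 'q) \<Rightarrow> bool" where
  "nat_trans C D F G \<alpha> \<longleftrightarrow> is_functor C D F \<and> is_functor C D G
    \<and> (\<forall>A\<in>Ob C. \<alpha> A \<in> Hom D (fob F A) (fob G A))
    \<and> (\<forall>A\<in>Ob C. \<forall>B\<in>Ob C. \<forall>f\<in>Hom C A B.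
        \<alpha> B \<odot>\<^bsub>D\<^esub> fmap F A B f = fmap G A B f \<odot>\<^bsub>D\<^esub> \<alpha> A)"

definition is_iso :: "('o, 'm, 'z) cat_scheme \<Rightarrow> 'o \<Rightarrow> 'o \<Rightarrow> 'm \<Rightarrow> bool" where
  "is_iso C A B f \<longleftrightarrow> f \<in> Hom C A B
    \<and> (\<exists>g\<in>Hom C B A. g \<odot>\<^bsub>C\<^esub> f = Idn C A \<and> f \<odot>\<^bsub>C\<^esub> g = Idn C B)"

definition naturally_isomorphic ::
  "('o, 'm, 'y) cat_scheme \<Rightarrow> ('p, 'q, 'z) cat_scheme
    \<Rightarrow> ('o, 'm, 'p, 'q) funct \<Rightarrow> ('o, 'm, 'p, 'q) funct \<Rightarrow> bool" where
  "naturally_isomorphic C D F G \<longleftrightarrow>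
    (\<exists>\<alpha>. nat_trans C D F G \<alpha> \<and> (\<forall>A\<in>Ob C. is_iso D (fob F A) (fob G A) (\<alpha> A)))"

definition monad ::
  "('o, 'm, 'z) cat_scheme \<Rightarrow> ('o, 'm, 'o, 'm) funct \<Rightarrow> ('o \<Rightarrow> 'm) \<Rightarrow> ('o \<Rightarrow> 'm) \<Rightarrow> bool" where
  "monad C F \<eta> \<mu> \<longleftrightarrow> is_functor C C F
    \<and> nat_trans C C id_funct F \<eta> \<and> nat_trans C C (F \<circ>\<^sub>F F) F \<mu>
    \<and> (\<forall>A\<in>Ob C.
        \<mu> A \<odot>\<^bsub>C\<^esub> \<eta> (fob F A) = Idn C (fob F A)
      \<and> \<mu> A \<odot>\<^bsub>C\<^esub> fmap F A (fob F A) (\<eta> A) = Idn C (fob F A)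
      \<and> \<mu> A \<odot>\<^bsub>C\<^esub> \<mu> (fob F A)
          = \<mu> A \<odot>\<^bsub>C\<^esub> fmap F (fob F (fob F A)) (fob F A) (\<mu> A))"


section \<open>Finite products\<close>

definition is_product ::
  "('o, 'm, 'z) cat_scheme \<Rightarrow> 'o list \<Rightarrow> 'o \<Rightarrow> (nat \<Rightarrow> 'm) \<Rightarrow> bool" where
  "is_product C As P \<pi> \<longleftrightarrow> P \<in> Ob C \<and> (\<forall>i<length As. \<pi> i \<in> Hom C P (As ! i))
    \<and> (\<forall>X\<in>Ob C. \<forall>fs. length fs = length As \<and> (\<forall>i<length As. fs ! i \<in> Hom C X (As ! i))
        \<longrightarrow> (\<exists>!h. h \<in> Hom C X P \<and> (\<forall>i<length As. \<pi> i \<odot>\<^bsub>C\<^esub> h = fs ! i)))"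

text \<open>
  A category with finite products comes with an arbitrary choice of a product cone for every
  finite list of objects. The chosen product of a one-element list \<open>[A]\<close> need not be \<open>A\<close> itself.
\<close>

record ('o, 'm) fpcat = "('o, 'm) cat" +
  prd :: "'o list \<Rightarrow> 'o"
  prj :: "'o list \<Rightarrow> nat \<Rightarrow> 'm"

locale fp_category = category C for C :: "('o, 'm, 'z) fpcat_scheme" (structure) +
  assumes product: "set As \<subseteq> Ob C \<Longrightarrow> is_product C As (prd C As) (prj C As)"

definition tuple :: "('o, 'm, 'z) fpcat_scheme \<Rightarrow> 'o \<Rightarrow> 'o list \<Rightarrow> 'm list \<Rightarrow> 'm" where
  "tuple C X As fs =
    (THE h. h \<in> Hom C X (prd C As) \<and> (\<forall>i<length As. prj C As i \<odot>\<^bsub>C\<^esub> h = fs ! i))"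

definition prod_map :: "('o, 'm, 'z) fpcat_scheme \<Rightarrow> 'o list \<Rightarrow> 'o list \<Rightarrow> 'm list \<Rightarrow> 'm" where
  "prod_map C As Bs fs =
    tuple C (prd C As) Bs (map (\<lambda>i. (fs ! i) \<odot>\<^bsub>C\<^esub> prj C As i) [0..<length As])"


section \<open>Group objects\<close>

record ('o, 'm) grp =
  gcarr :: 'o
  gmult :: 'm
  gunit :: 'm
  ginv :: 'm

text \<open>Multiplication and unit of generalised elements \<open>X \<rightarrow> G\<close>.\<close>

definition gtimes ::
  "('o, 'm, 'z) fpcat_scheme \<Rightarrow> ('o, 'm) grp \<Rightarrow> 'o \<Rightarrow> 'm \<Rightarrow> 'm \<Rightarrow> 'm" where
  "gtimes C G X a b = gmult G \<odot>\<^bsub>C\<^esub> tuple C X [gcarr G, gcarr G] [a, b]"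

definition gone :: "('o, 'm, 'z) fpcat_scheme \<Rightarrow> ('o, 'm) grp \<Rightarrow> 'o \<Rightarrow> 'm" where
  "gone C G X = gunit G \<odot>\<^bsub>C\<^esub> tuple C X [] []"

definition group_object :: "('o, 'm, 'z) fpcat_scheme \<Rightarrow> ('o, 'm) grp \<Rightarrow> bool" where
  "group_object C G \<longleftrightarrow> gcarr G \<in> Ob C
    \<and> gmult G \<in> Hom C (prd C [gcarr G, gcarr G]) (gcarr G)
    \<and> gunit G \<in> Hom C (prd C []) (gcarr G)
    \<and> ginv G \<in> Hom C (gcarr G) (gcarr G)
    \<and> (\<forall>X\<in>Ob C. \<forall>a\<in>Hom C X (gcarr G). \<forall>b\<in>Hom C X (gcarr G). \<forall>c\<in>Hom C X (gcarr G).
        gtimes C G X (gtimes C G X a b) c = gtimes C G X a (gtimes C G X b c))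
    \<and> (\<forall>X\<in>Ob C. \<forall>a\<in>Hom C X (gcarr G).
        gtimes C G X (gone C G X) a = a
      \<and> gtimes C G X a (gone C G X) = a
      \<and> gtimes C G X (ginv G \<odot>\<^bsub>C\<^esub> a) a = gone C G X
      \<and> gtimes C G X a (ginv G \<odot>\<^bsub>C\<^esub> a) = gone C G X)"

definition Grp :: "('o, 'm, 'z) fpcat_scheme \<Rightarrow> (('o, 'm) grp, 'm) cat" where
  "Grp C = \<lparr>Ob = {G. group_object C G},
    Hom = (\<lambda>G H. {h \<in> Hom C (gcarr G) (gcarr H).
      h \<odot>\<^bsub>C\<^esub> gmult G
        = gmult H \<odot>\<^bsub>C\<^esub> prod_map C [gcarr G, gcarr G] [gcarr H, gcarr H] [h, h]}),
    Idn = (\<lambda>G. Idn C (gcarr G)),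
    Cmp = Cmp C\<rparr>"

definition grp_forget :: "(('o, 'm) grp, 'm, 'o, 'm) funct" where
  "grp_forget = \<lparr>fob = gcarr, fmap = (\<lambda>G H h. h)\<rparr>"

definition prod_grp :: "('o, 'm, 'z) fpcat_scheme \<Rightarrow> ('o, 'm) grp list \<Rightarrow> ('o, 'm) grp" where
  "prod_grp C Gs = (let As = map gcarr Gs; P = prd C As in
    \<lparr>gcarr = P,
     gmult = tuple C (prd C [P, P]) As
       (map (\<lambda>j. gtimes C (Gs ! j) (prd C [P, P])
           (prj C As j \<odot>\<^bsub>C\<^esub> prj C [P, P] 0) (prj C As j \<odot>\<^bsub>C\<^esub> prj C [P, P] 1))
         [0..<length Gs]),
     gunit = tuple C (prd C []) As (map gunit Gs),
     ginv = tuple C P As (map (\<lambda>j. ginv (Gs ! j) \<odot>\<^bsub>C\<^esub> prj C As j) [0..<length Gs])\<rparr>)"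


section \<open>Lawvere theories and their algebras\<close>

text \<open>
  The object \<open>n\<close> of a Lawvere theory is the \<open>n\<close>-th power of \<open>1\<close>, with projections
  \<open>lproj T n i\<close> for \<open>i < n\<close>; the \<open>n\<close>-ary operations are the arrows \<open>n \<rightarrow> 1\<close>.
\<close>

record 't lawvere = "(nat, 't) cat" +
  lproj :: "nat \<Rightarrow> nat \<Rightarrow> 't"

locale lawvere_theory = category T for T :: "'t lawvere" (structure) +
  assumes objects: "Ob T = UNIV"
    and powers: "is_product T (replicate n 1) n (lproj T n)"
    and lproj_one: "lproj T 1 0 = Idn T 1"

definition theory_morphism :: "'s lawvere \<Rightarrow> 't lawvere \<Rightarrow> (nat, 's, nat, 't) funct \<Rightarrow> bool" where
  "theory_morphism S T F \<longleftrightarrow> is_functor S T F \<and> (\<forall>n. fob F n = n)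
    \<and> (\<forall>n. \<forall>i<n. fmap F n 1 (lproj S n i) = lproj T n i)"

text \<open>
  The operations \<open>talg_op A n \<omega>\<close> with \<open>\<omega> : n \<rightarrow> 1\<close> are arrows from the chosen power of the
  carrier. Values at other arguments are fixed to \<open>undefined\<close>, so that equality of records is
  equality of algebras.
\<close>

record ('o, 'm, 't) talg =
  tcarr :: 'o
  talg_op :: "nat \<Rightarrow> 't \<Rightarrow> 'm"

definition t_algebra ::
  "('o, 'm, 'z) fpcat_scheme \<Rightarrow> 't lawvere \<Rightarrow> ('o, 'm, 't) talg \<Rightarrow> bool" where
  "t_algebra C T A \<longleftrightarrow> tcarr A \<in> Ob C
    \<and> (\<forall>n. \<forall>\<omega>\<in>Hom T n 1. talg_op A n \<omega> \<in> Hom C (prd C (replicate n (tcarr A))) (tcarr A))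
    \<and> (\<forall>n \<omega>. \<omega> \<notin> Hom T n 1 \<longrightarrow> talg_op A n \<omega> = undefined)
    \<and> (\<forall>n. \<forall>i<n. talg_op A n (lproj T n i) = prj C (replicate n (tcarr A)) i)
    \<and> (\<forall>n m. \<forall>\<tau>\<in>Hom T n m. \<forall>\<omega>\<in>Hom T m 1.
        talg_op A n (\<omega> \<odot>\<^bsub>T\<^esub> \<tau>)
          = talg_op A m \<omega> \<odot>\<^bsub>C\<^esub>
            tuple C (prd C (replicate n (tcarr A))) (replicate m (tcarr A))
              (map (\<lambda>i. talg_op A n (lproj T m i \<odot>\<^bsub>T\<^esub> \<tau>)) [0..<m]))"

definition TAlg ::
  "('o, 'm, 'z) fpcat_scheme \<Rightarrow> 't lawvere \<Rightarrow> (('o, 'm, 't) talg, 'm) cat" where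
  "TAlg C T = \<lparr>Ob = {A. t_algebra C T A},
    Hom = (\<lambda>A B. {h \<in> Hom C (tcarr A) (tcarr B).
      \<forall>n. \<forall>\<omega>\<in>Hom T n 1. h \<odot>\<^bsub>C\<^esub> talg_op A n \<omega>
        = talg_op B n \<omega> \<odot>\<^bsub>C\<^esub>
          prod_map C (replicate n (tcarr A)) (replicate n (tcarr B)) (replicate n h)}),
    Idn = (\<lambda>A. Idn C (tcarr A)),
    Cmp = Cmp C\<rparr>"

definition prod_talg ::
  "('o, 'm, 'z) fpcat_scheme \<Rightarrow> 't lawvere \<Rightarrow> ('o, 'm, 't) talg list \<Rightarrow> ('o, 'm, 't) talg" where
  "prod_talg C T As = (let Bs = map tcarr As; P = prd C Bs in
    \<lparr>tcarr = P,
     talg_op = (\<lambda>n \<omega>. if \<omega> \<in> Hom T n 1 then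
       tuple C (prd C (replicate n P)) Bs
         (map (\<lambda>j. talg_op (As ! j) n \<omega> \<odot>\<^bsub>C\<^esub>
             prod_map C (replicate n P) (replicate n (Bs ! j)) (replicate n (prj C Bs j)))
           [0..<length As])
       else undefined)\<rparr>)"


section \<open>The theory of groups\<close>

datatype gterm = Var nat | One | Mul gterm gterm | Inv gterm

primrec gvars :: "gterm \<Rightarrow> nat set" where
  "gvars (Var i) = {i}"
| "gvars One = {}"
| "gvars (Mul s t) = gvars s \<union> gvars t"
| "gvars (Inv s) = gvars s"

primrec gterm_subst :: "(nat \<Rightarrow> gterm) \<Rightarrow> gterm \<Rightarrow> gterm" where
  "gterm_subst \<sigma> (Var i) = \<sigma> i"
| "gterm_subst \<sigma> One = One"
| "gterm_subst \<sigma> (Mul s t) = Mul (gterm_subst \<sigma> s) (gterm_subst \<sigma> t)"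
| "gterm_subst \<sigma> (Inv s) = Inv (gterm_subst \<sigma> s)"

text \<open>Equality of terms provable from the group axioms.\<close>

inductive geq :: "gterm \<Rightarrow> gterm \<Rightarrow> bool" where
  refl: "geq t t"
| sym: "geq s t \<Longrightarrow> geq t s"
| trans: "geq s t \<Longrightarrow> geq t u \<Longrightarrow> geq s u"
| mul: "geq s s' \<Longrightarrow> geq t t' \<Longrightarrow> geq (Mul s t) (Mul s' t')"
| inv: "geq s s' \<Longrightarrow> geq (Inv s) (Inv s')"
| assoc: "geq (Mul (Mul s t) u) (Mul s (Mul t u))"
| one_left: "geq (Mul One t) t"
| one_right: "geq (Mul t One) t"
| inv_left: "geq (Mul (Inv t) t) One"
| inv_right: "geq (Mul t (Inv t)) One"

quotient_type gword = gterm / geq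
  by (intro equivpI reflpI sympI transpI) (auto intro: geq.refl geq.sym geq.trans)

lemma geq_subst:
  assumes "geq s t" "\<And>i. geq (\<sigma> i) (\<tau> i)"
  shows "geq (gterm_subst \<sigma> s) (gterm_subst \<tau> t)"
proof -
  have "geq (gterm_subst \<tau> s) (gterm_subst \<tau> t)"
    using assms(1) by induction (auto intro: geq.intros)
  moreover have "geq (gterm_subst \<sigma> s) (gterm_subst \<tau> s)"
    by (induction s) (auto intro: geq.intros assms(2))
  ultimately show ?thesis by (blast intro: geq.trans)
qed

lift_definition gsubst :: "(nat \<Rightarrow> gword) \<Rightarrow> gword \<Rightarrow> gword" is gterm_subst
  by (rule geq_subst) auto

definition gword_in :: "nat \<Rightarrow> gword set" where
  "gword_in n = {abs_gword t | t. gvars t \<subseteq> {..<n}}"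

text \<open>
  An arrow \<open>n \<rightarrow> m\<close> of the theory of groups is an \<open>m\<close>-tuple of words in the variables
  \<open>Var 0, \<dots>, Var (n - 1)\<close> modulo provable equality; composition is substitution.
\<close>

definition group_theory :: "gword list lawvere" where
  "group_theory = \<lparr>Ob = UNIV,
    Hom = (\<lambda>n m. {ws. length ws = m \<and> set ws \<subseteq> gword_in n}),
    Idn = (\<lambda>n. map (\<lambda>i. abs_gword (Var i)) [0..<n]),
    Cmp = (\<lambda>vs ws. map (gsubst (\<lambda>i. ws ! i)) vs),
    lproj = (\<lambda>n i. [abs_gword (Var i)])\<rparr>"

text \<open>
  A theory extending the theory of groups is a Lawvere theory \<open>T\<close> with a morphism \<open>\<phi>\<close> from
  \<open>group_theory\<close>; it gives the underlying group of a \<open>T\<close>-algebra. The unary operation of inversion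
  is a map out of the chosen product of \<open>[A]\<close>, hence the composition with \<open>\<langle>id\<rangle>\<close>.
\<close>

definition underlying_grp ::
  "('o, 'm, 'z) fpcat_scheme \<Rightarrow> (nat, gword list, nat, 't) funct
    \<Rightarrow> ('o, 'm, 't) talg \<Rightarrow> ('o, 'm) grp" where
  "underlying_grp C \<phi> A =
    \<lparr>gcarr = tcarr A,
     gmult = talg_op A 2 (fmap \<phi> 2 1 [abs_gword (Mul (Var 0) (Var 1))]),
     gunit = talg_op A 0 (fmap \<phi> 0 1 [abs_gword One]),
     ginv = talg_op A 1 (fmap \<phi> 1 1 [abs_gword (Inv (Var 0))])
       \<odot>\<^bsub>C\<^esub> tuple C (tcarr A) [tcarr A] [Idn C (tcarr A)]\<rparr>"

definition talg_forget ::
  "('o, 'm, 'z) fpcat_scheme \<Rightarrow> (nat, gword list, nat, 't) funct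
    \<Rightarrow> (('o, 'm, 't) talg, 'm, ('o, 'm) grp, 'm) funct" where
  "talg_forget C \<phi> = \<lparr>fob = underlying_grp C \<phi>, fmap = (\<lambda>A B h. h)\<rparr>"


section \<open>Simplicial objects\<close>

text \<open>
  \<open>face X n i : X\<^sub>n \<rightarrow> X\<^sub>n\<^sub>-\<^sub>1\<close> for \<open>n \<ge> 1\<close>, \<open>i \<le> n\<close> and \<open>degen X n i : X\<^sub>n \<rightarrow> X\<^sub>n\<^sub>+\<^sub>1\<close> for \<open>i \<le> n\<close>.
  Values at other indices are fixed to \<open>undefined\<close>, so that equality of records is equality of
  simplicial objects.
\<close>

record ('o, 'm) sobj =
  lev :: "nat \<Rightarrow> 'o"
  face :: "nat \<Rightarrow> nat \<Rightarrow> 'm"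
  degen :: "nat \<Rightarrow> nat \<Rightarrow> 'm"

definition simplicial_object :: "('o, 'm, 'z) cat_scheme \<Rightarrow> ('o, 'm) sobj \<Rightarrow> bool" where
  "simplicial_object C X \<longleftrightarrow>
    (\<forall>n. lev X n \<in> Ob C)
    \<and> (\<forall>n i. 1 \<le> n \<and> i \<le> n \<longrightarrow> face X n i \<in> Hom C (lev X n) (lev X (n - 1)))
    \<and> (\<forall>n i. i \<le> n \<longrightarrow> degen X n i \<in> Hom C (lev X n) (lev X (n + 1)))
    \<and> (\<forall>n i. \<not> (1 \<le> n \<and> i \<le> n) \<longrightarrow> face X n i = undefined)
    \<and> (\<forall>n i. \<not> i \<le> n \<longrightarrow> degen X n i = undefined)
    \<and> (\<forall>n i j. 2 \<le> n \<and> i < j \<and> j \<le> n \<longrightarrow>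
        face X (n - 1) i \<odot>\<^bsub>C\<^esub> face X n j = face X (n - 1) (j - 1) \<odot>\<^bsub>C\<^esub> face X n i)
    \<and> (\<forall>n i j. i \<le> j \<and> j \<le> n \<longrightarrow>
        degen X (n + 1) i \<odot>\<^bsub>C\<^esub> degen X n j = degen X (n + 1) (j + 1) \<odot>\<^bsub>C\<^esub> degen X n i)
    \<and> (\<forall>n i j. i < j \<and> j \<le> n \<longrightarrow>
        face X (n + 1) i \<odot>\<^bsub>C\<^esub> degen X n j = degen X (n - 1) (j - 1) \<odot>\<^bsub>C\<^esub> face X n i)
    \<and> (\<forall>n i j. (i = j \<or> i = j + 1) \<and> j \<le> n \<longrightarrow>
        face X (n + 1) i \<odot>\<^bsub>C\<^esub> degen X n j = Idn C (lev X n))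
    \<and> (\<forall>n i j. j + 1 < i \<and> i \<le> n + 1 \<longrightarrow>
        face X (n + 1) i \<odot>\<^bsub>C\<^esub> degen X n j = degen X (n - 1) j \<odot>\<^bsub>C\<^esub> face X n (i - 1))"

definition simplicial :: "('o, 'm, 'z) cat_scheme \<Rightarrow> (('o, 'm) sobj, nat \<Rightarrow> 'm) cat" where
  "simplicial C = \<lparr>Ob = {X. simplicial_object C X},
    Hom = (\<lambda>X Y. {f. (\<forall>n. f n \<in> Hom C (lev X n) (lev Y n))
      \<and> (\<forall>n i. 1 \<le> n \<and> i \<le> n \<longrightarrow> f (n - 1) \<odot>\<^bsub>C\<^esub> face X n i = face Y n i \<odot>\<^bsub>C\<^esub> f n)
      \<and> (\<forall>n i. i \<le> n \<longrightarrow> f (n + 1) \<odot>\<^bsub>C\<^esub> degen X n i = degen Y n i \<odot>\<^bsub>C\<^esub> f n)}),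
    Idn = (\<lambda>X n. Idn C (lev X n)),
    Cmp = (\<lambda>g f n. g n \<odot>\<^bsub>C\<^esub> f n)\<rparr>"

text \<open>
  A simplicial object with the given levels, faces and degeneracies, discarding the values of the
  latter at indices that do not occur.
\<close>

definition mk_sobj ::
  "(nat \<Rightarrow> 'o) \<Rightarrow> (nat \<Rightarrow> nat \<Rightarrow> 'm) \<Rightarrow> (nat \<Rightarrow> nat \<Rightarrow> 'm) \<Rightarrow> ('o, 'm) sobj" where
  "mk_sobj X d s = \<lparr>lev = X,
    face = (\<lambda>n i. if 1 \<le> n \<and> i \<le> n then d n i else undefined),
    degen = (\<lambda>n i. if i \<le> n then s n i else undefined)\<rparr>"

definition levelwise ::
  "('o, 'm, 'p, 'q) funct \<Rightarrow> (('o, 'm) sobj, nat \<Rightarrow> 'm, ('p, 'q) sobj, nat \<Rightarrow> 'q) funct" where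
  "levelwise F = \<lparr>
    fob = (\<lambda>X. mk_sobj (\<lambda>n. fob F (lev X n))
      (\<lambda>n i. fmap F (lev X n) (lev X (n - 1)) (face X n i))
      (\<lambda>n i. fmap F (lev X n) (lev X (n + 1)) (degen X n i))),
    fmap = (\<lambda>X Y f n. fmap F (lev X n) (lev Y n) (f n))\<rparr>"

abbreviation sGrp :: "('o, 'm, 'z) fpcat_scheme \<Rightarrow> ((('o, 'm) grp, 'm) sobj, nat \<Rightarrow> 'm) cat" where
  "sGrp C \<equiv> simplicial (Grp C)"

abbreviation sTAlg ::
  "('o, 'm, 'z) fpcat_scheme \<Rightarrow> 't lawvere
    \<Rightarrow> ((('o, 'm, 't) talg, 'm) sobj, nat \<Rightarrow> 'm) cat" where
  "sTAlg C T \<equiv> simplicial (TAlg C T)"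

definition U_funct :: "((('o, 'm) grp, 'm) sobj, nat \<Rightarrow> 'm, ('o, 'm) sobj, nat \<Rightarrow> 'm) funct" where
  "U_funct = levelwise grp_forget"

definition V_funct ::
  "('o, 'm, 'z) fpcat_scheme \<Rightarrow> (nat, gword list, nat, 't) funct
    \<Rightarrow> ((('o, 'm, 't) talg, 'm) sobj, nat \<Rightarrow> 'm, (('o, 'm) grp, 'm) sobj, nat \<Rightarrow> 'm) funct" where
  "V_funct C \<phi> = levelwise (talg_forget C \<phi>)"


section \<open>The universal bundle and its group and algebra models\<close>

text \<open>
  For \<open>X\<close> with levels \<open>X\<^sub>n\<close>, \<open>tower X n\<close> is the list \<open>[X\<^sub>n, \<dots>, X\<^sub>0]\<close>. For \<open>X\<close> in \<open>sC\<close>,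
  \<open>entry C X n k\<close> is the projection of \<open>X\<^sub>n \<times> \<dots> \<times> X\<^sub>0\<close> to \<open>X\<^sub>k\<close>, that is, the entry \<open>g\<^sub>k\<close> of the
  generic element \<open>(g\<^sub>n, \<dots>, g\<^sub>0)\<close>.
\<close>

definition tower :: "(nat \<Rightarrow> 'o) \<Rightarrow> nat \<Rightarrow> 'o list" where
  "tower X n = map X (rev [0..<n + 1])"

definition entry :: "('o, 'm, 'z) fpcat_scheme \<Rightarrow> ('o, 'm) sobj \<Rightarrow> nat \<Rightarrow> nat \<Rightarrow> 'm" where
  "entry C X n k = prj C (tower (lev X) n) (n - k)"

definition tower_map ::
  "('o, 'm, 'z) fpcat_scheme \<Rightarrow> ('o, 'm) sobj \<Rightarrow> ('o, 'm) sobj \<Rightarrow> (nat \<Rightarrow> 'm) \<Rightarrow> nat \<Rightarrow> 'm" where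
  "tower_map C X Y f n = prod_map C (tower (lev X) n) (tower (lev Y) n) (tower f n)"

text \<open>
  Here \<open>d\<^sub>i(g\<^sub>n,\<dots>,g\<^sub>0) = (d\<^sub>i g\<^sub>n, \<dots>, d\<^sub>1 g\<^sub>n\<^sub>-\<^sub>i\<^sub>+\<^sub>1, d\<^sub>0 g\<^sub>n\<^sub>-\<^sub>i \<cdot> g\<^sub>n\<^sub>-\<^sub>i\<^sub>-\<^sub>1, g\<^sub>n\<^sub>-\<^sub>i\<^sub>-\<^sub>2, \<dots>, g\<^sub>0)\<close> covers both
  \<open>i = 0\<close> and \<open>0 < i < n\<close>.
\<close>

definition W_face ::
  "('o, 'm, 'z) fpcat_scheme \<Rightarrow> (('o, 'm) grp, 'm) sobj \<Rightarrow> nat \<Rightarrow> nat \<Rightarrow> 'm" where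
  "W_face C G n i = (let X = fob U_funct G; P = prd C (tower (lev X) n); g = entry C X n in
    tuple C P (tower (lev X) (n - 1))
      (if i < n then
         map (\<lambda>j. face X (n - j) (i - j) \<odot>\<^bsub>C\<^esub> g (n - j)) [0..<i]
         @ [gtimes C (lev G (n - i - 1)) P (face X (n - i) 0 \<odot>\<^bsub>C\<^esub> g (n - i)) (g (n - i - 1))]
         @ map g (rev [0..<n - i - 1])
       else map (\<lambda>j. face X (n - j) (n - j) \<odot>\<^bsub>C\<^esub> g (n - j)) [0..<n]))"

definition W_degen ::
  "('o, 'm, 'z) fpcat_scheme \<Rightarrow> (('o, 'm) grp, 'm) sobj \<Rightarrow> nat \<Rightarrow> nat \<Rightarrow> 'm" where
  "W_degen C G n i = (let X = fob U_funct G; P = prd C (tower (lev X) n); g = entry C X n in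
    tuple C P (tower (lev X) (n + 1))
      (map (\<lambda>j. degen X (n - j) (i - j) \<odot>\<^bsub>C\<^esub> g (n - j)) [0..<i + 1]
       @ [gone C (lev G (n - i)) P]
       @ map g (rev [0..<n - i])))"

definition W_funct ::
  "('o, 'm, 'z) fpcat_scheme
    \<Rightarrow> ((('o, 'm) grp, 'm) sobj, nat \<Rightarrow> 'm, ('o, 'm) sobj, nat \<Rightarrow> 'm) funct" where
  "W_funct C = \<lparr>
    fob = (\<lambda>G. mk_sobj (\<lambda>n. prd C (tower (lev (fob U_funct G)) n)) (W_face C G) (W_degen C G)),
    fmap = (\<lambda>G H f. tower_map C (fob U_funct G) (fob U_funct H) f)\<rparr>"

text \<open>
  The formulas for \<open>W\<^sub>g\<^sub>r\<close> and \<open>W\<^sub>T\<close> only involve the underlying simplicial object of \<open>C\<close>: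
  \<open>d\<^sub>i(g\<^sub>n,\<dots>,g\<^sub>0) = (d\<^sub>i g\<^sub>n, \<dots>, d\<^sub>1 g\<^sub>n\<^sub>-\<^sub>i\<^sub>+\<^sub>1, g\<^sub>n\<^sub>-\<^sub>i\<^sub>-\<^sub>1, \<dots>, g\<^sub>0)\<close>, including \<open>i = 0\<close>, and
  \<open>s\<^sub>i(g\<^sub>n,\<dots>,g\<^sub>0) = (s\<^sub>i g\<^sub>n, \<dots>, s\<^sub>0 g\<^sub>n\<^sub>-\<^sub>i, g\<^sub>n\<^sub>-\<^sub>i, \<dots>, g\<^sub>0)\<close>.
\<close>

definition shift_face :: "('o, 'm, 'z) fpcat_scheme \<Rightarrow> ('o, 'm) sobj \<Rightarrow> nat \<Rightarrow> nat \<Rightarrow> 'm" where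
  "shift_face C X n i = (let g = entry C X n in
    tuple C (prd C (tower (lev X) n)) (tower (lev X) (n - 1))
      (map (\<lambda>j. face X (n - j) (i - j) \<odot>\<^bsub>C\<^esub> g (n - j)) [0..<i]
       @ map g (rev [0..<n - i])))"

definition shift_degen :: "('o, 'm, 'z) fpcat_scheme \<Rightarrow> ('o, 'm) sobj \<Rightarrow> nat \<Rightarrow> nat \<Rightarrow> 'm" where
  "shift_degen C X n i = (let g = entry C X n in
    tuple C (prd C (tower (lev X) n)) (tower (lev X) (n + 1))
      (map (\<lambda>j. degen X (n - j) (i - j) \<odot>\<^bsub>C\<^esub> g (n - j)) [0..<i + 1]
       @ map g (rev [0..<n - i + 1])))"

definition Wgr_funct ::
  "('o, 'm, 'z) fpcat_scheme
    \<Rightarrow> ((('o, 'm) grp, 'm) sobj, nat \<Rightarrow> 'm, (('o, 'm) grp, 'm) sobj, nat \<Rightarrow> 'm) funct" where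
  "Wgr_funct C = \<lparr>
    fob = (\<lambda>G. mk_sobj (\<lambda>n. prod_grp C (tower (lev G) n))
      (shift_face C (fob U_funct G)) (shift_degen C (fob U_funct G))),
    fmap = (\<lambda>G H f. tower_map C (fob U_funct G) (fob U_funct H) f)\<rparr>"

definition talg_underlying :: "(('o, 'm, 't) talg, 'm) sobj \<Rightarrow> ('o, 'm) sobj" where
  "talg_underlying A = mk_sobj (\<lambda>n. tcarr (lev A n)) (face A) (degen A)"

definition WT_funct ::
  "('o, 'm, 'z) fpcat_scheme \<Rightarrow> 't lawvere
    \<Rightarrow> ((('o, 'm, 't) talg, 'm) sobj, nat \<Rightarrow> 'm, (('o, 'm, 't) talg, 'm) sobj, nat \<Rightarrow> 'm) funct" where
  "WT_funct C T = \<lparr>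
    fob = (\<lambda>A. mk_sobj (\<lambda>n. prod_talg C T (tower (lev A) n))
      (shift_face C (talg_underlying A)) (shift_degen C (talg_underlying A))),
    fmap = (\<lambda>A B f. tower_map C (talg_underlying A) (talg_underlying B) f)\<rparr>"

end

(*
  The formulas for W_gr use no group structure: they define an endofunctor of simplicial objects in
  any category with finite products. This endofunctor is a monad, with unit
  g |-> (g, d_0 g, d_0^2 g, ...) and multiplication taking a tower of towers to the tower of the
  leading entries of its members. T-algebras in C form a category with finite products computed as in
  C, and there the construction is W_T, so functoriality and the monad structure need no further work.

  For a simplicial group, (h_n, ..., h_0) |-> (h_n, (d_0 h_n)^-1 h_(n-1), ..., (d_0 h_1)^-1 h_0)
  is a bijection that turns the shift formulas into those of the universal bundle W; hence the
  simplicial identities for W are inherited, and the bijection is the natural isomorphism.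
*)
theory Submission
  imports Defs
begin

section \<open>Functors and natural isomorphisms\<close>

text \<open>The passage between (h_n, ..., h_0) and (g_n, ..., g_0) is the one between homogeneous
  and inhomogeneous coordinates of a bar construction: h_k is the product of d_0^(n-k) g_n, ..., d_0
  g_(k+1), g_k in this order. Multiplying two neighbouring entries g then amounts to forgetting an
  h, and inserting a unit to repeating an h through a degeneracy. Two obstacles shape the rest. The
  equality of V W_T and W_gr V is one of records: products of algebras and products of groups must
  be given by the same arrows, and \<open>tuple\<close> is a definite description whose value
  depends on the category in which it is formed, so tuples of homomorphisms have to be identified
  with tuples of arrows of \<open>C\<close>. Moreover the chosen product of a single object may
  differ from that object, which gives inversion, a unary operation, its own argument. The group
  laws of an algebra are obtained by evaluating provably equal words at elements with prescribed
  coordinates.\<close>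

lemma is_functorI:
  assumes "category C" "category D"
    and "\<And>A. A \<in> Ob C \<Longrightarrow> fob F A \<in> Ob D"
    and "\<And>A B f. \<lbrakk>A \<in> Ob C; B \<in> Ob C; f \<in> Hom C A B\<rbrakk> \<Longrightarrow> fmap F A B f \<in> Hom D (fob F A) (fob F B)"
    and "\<And>A. A \<in> Ob C \<Longrightarrow> fmap F A A (Idn C A) = Idn D (fob F A)"
    and "\<And>A B E f g. \<lbrakk>A \<in> Ob C; B \<in> Ob C; E \<in> Ob C; f \<in> Hom C A B; g \<in> Hom C B E\<rbrakk>
        \<Longrightarrow> fmap F A E (g \<odot>\<^bsub>C\<^esub> f) = fmap F B E g \<odot>\<^bsub>D\<^esub> fmap F A B f"
  shows "is_functor C D F"
  using assms unfolding is_functor_def by blast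

lemma is_functorD:
  assumes "is_functor C D F"
  shows "category C" "category D"
    and "A \<in> Ob C \<Longrightarrow> fob F A \<in> Ob D"
    and "\<lbrakk>A \<in> Ob C; B \<in> Ob C; f \<in> Hom C A B\<rbrakk> \<Longrightarrow> fmap F A B f \<in> Hom D (fob F A) (fob F B)"
    and "A \<in> Ob C \<Longrightarrow> fmap F A A (Idn C A) = Idn D (fob F A)"
    and "\<lbrakk>A \<in> Ob C; B \<in> Ob C; E \<in> Ob C; f \<in> Hom C A B; g \<in> Hom C B E\<rbrakk>
        \<Longrightarrow> fmap F A E (g \<odot>\<^bsub>C\<^esub> f) = fmap F B E g \<odot>\<^bsub>D\<^esub> fmap F A B f"
  using assms unfolding is_functor_def by blast+

lemma is_functor_id: "category C \<Longrightarrow> is_functor C C id_funct"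
  by (rule is_functorI) (auto simp: id_funct_def)

lemma is_functor_comp:
  assumes F: "is_functor C D F" and G: "is_functor D E G"
  shows "is_functor C E (G \<circ>\<^sub>F F)"
  unfolding comp_funct_def
  by (rule is_functorI) (simp_all add: is_functorD[OF F] is_functorD[OF G])

text \<open>Agreement is only assumed on arrows that lie in the hom-sets, so identities and
  composites must first be recognised as such arrows; the functor laws then transfer by
  rewriting.\<close>

lemma is_functor_cong:
  assumes "is_functor C D F"
    and "\<And>A. A \<in> Ob C \<Longrightarrow> fob G A = fob F A"
    and "\<And>A B f. \<lbrakk>A \<in> Ob C; B \<in> Ob C; f \<in> Hom C A B\<rbrakk> \<Longrightarrow> fmap G A B f = fmap F A B f"
  shows "is_functor C D G"
proof (rule is_functorI)
  fix A B E f g assume *: "A \<in> Ob C" "B \<in> Ob C" "E \<in> Ob C" "f \<in> Hom C A B" "g \<in> Hom C B E"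
  then have "g \<odot>\<^bsub>C\<^esub> f \<in> Hom C A E"
    using category.cmp_in[OF is_functorD(1)[OF assms(1)]] by blast
  with * show "fmap G A E (g \<odot>\<^bsub>C\<^esub> f) = fmap G B E g \<odot>\<^bsub>D\<^esub> fmap G A B f"
    by (simp add: assms(3) is_functorD(6)[OF assms(1)])
next
  fix A assume "A \<in> Ob C"
  then show "fmap G A A (Idn C A) = Idn D (fob G A)"
    using category.idn_in[OF is_functorD(1)[OF assms(1)]]
    by (simp add: assms(2,3) is_functorD(5)[OF assms(1)])
qed (simp_all add: assms(2,3) is_functorD(1-4)[OF assms(1)])

text \<open>Only \<open>F\<close> has to be known as a functor, and \<open>G\<close> inherits this.
  In this way \<open>WT_funct\<close> becomes a functor through the shift functor, and
  \<open>Wgr_funct C \<circ>\<^sub>F V_funct C \<phi>\<close> through the composite on the other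
  side of the lifting equation.\<close>

lemma funct_eqI:
  assumes "is_functor C D F"
    and "\<And>A. A \<in> Ob C \<Longrightarrow> fob G A = fob F A"
    and "\<And>A B f. \<lbrakk>A \<in> Ob C; B \<in> Ob C; f \<in> Hom C A B\<rbrakk> \<Longrightarrow> fmap G A B f = fmap F A B f"
  shows "funct_eq C D F G"
  using assms is_functor_cong[OF assms] by (simp add: funct_eq_def)

lemma funct_eqD:
  assumes "funct_eq C D F G"
  shows "is_functor C D F" "is_functor C D G"
    and "A \<in> Ob C \<Longrightarrow> fob F A = fob G A"
    and "\<lbrakk>A \<in> Ob C; B \<in> Ob C; f \<in> Hom C A B\<rbrakk> \<Longrightarrow> fmap F A B f = fmap G A B f"
  using assms by (simp_all add: funct_eq_def)

lemma naturally_isomorphic_cong: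
  assumes "naturally_isomorphic C D F G" "funct_eq C D F F'"
  shows "naturally_isomorphic C D F' G"
proof -
  obtain \<alpha> where "nat_trans C D F G \<alpha>" "\<forall>A\<in>Ob C. is_iso D (fob F A) (fob G A) (\<alpha> A)"
    using assms(1) unfolding naturally_isomorphic_def by blast
  then have "nat_trans C D F' G \<alpha>" "\<forall>A\<in>Ob C. is_iso D (fob F' A) (fob G A) (\<alpha> A)"
    using funct_eqD[OF assms(2)] unfolding nat_trans_def by simp_all
  then show ?thesis unfolding naturally_isomorphic_def by blast
qed

text \<open>Whiskering with \<open>H\<close>: the components are those of the given isomorphism at
  the objects \<open>fob H A\<close>.\<close>

lemma naturally_isomorphic_precomp:
  assumes H: "is_functor B C H" and "naturally_isomorphic C D F G"
  shows "naturally_isomorphic B D (F \<circ>\<^sub>F H) (G \<circ>\<^sub>F H)"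
proof -
  obtain \<alpha> where \<alpha>: "nat_trans C D F G \<alpha>" "\<forall>A\<in>Ob C. is_iso D (fob F A) (fob G A) (\<alpha> A)"
    using assms(2) unfolding naturally_isomorphic_def by blast
  then have "nat_trans B D (F \<circ>\<^sub>F H) (G \<circ>\<^sub>F H) (\<lambda>A. \<alpha> (fob H A))"
    unfolding nat_trans_def
    by (simp add: is_functor_comp[OF H]) (simp add: comp_funct_def is_functorD[OF H])
  moreover have "\<forall>A\<in>Ob B. is_iso D (fob (F \<circ>\<^sub>F H) A) (fob (G \<circ>\<^sub>F H) A) (\<alpha> (fob H A))"
    using \<alpha>(2) by (simp add: comp_funct_def is_functorD[OF H])
  ultimately show ?thesis unfolding naturally_isomorphic_def by blast
qed

text \<open>Equality on the nose leaves the sources and targets of \<eta> and \<mu> literally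
  unchanged, so the same families serve for \<open>G\<close>. The components must be typed before
  the arrow parts of \<open>F\<close> and \<open>G\<close> can be exchanged on them.\<close>

lemma monad_cong:
  assumes M: "monad C F \<eta> \<mu>" and FG: "funct_eq C C F G"
  shows "monad C G \<eta> \<mu>"
proof -
  note F = funct_eqD(1)[OF FG] and G = funct_eqD(2)[OF FG]
  note ob = funct_eqD(3)[OF FG] and mp = funct_eqD(4)[OF FG]
  have FO: "\<And>A. A \<in> Ob C \<Longrightarrow> fob G A \<in> Ob C" using is_functorD(3)[OF G] .
  have \<eta>: "nat_trans C C id_funct F \<eta>" and \<mu>: "nat_trans C C (F \<circ>\<^sub>F F) F \<mu>"
    using M unfolding monad_def by auto
  have \<eta>': "nat_trans C C id_funct G \<eta>"
    using \<eta> G unfolding nat_trans_def by (simp add: ob mp)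
  have "nat_trans C C (G \<circ>\<^sub>F G) G \<mu>"
    using \<mu> G is_functor_comp[OF G G] unfolding nat_trans_def
    by (simp add: comp_funct_def ob mp FO is_functorD(4)[OF G])
  moreover have "\<And>A. A \<in> Ob C \<Longrightarrow> \<eta> A \<in> Hom C A (fob G A)"
    using \<eta>' unfolding nat_trans_def by (simp add: id_funct_def)
  moreover have "\<And>A. A \<in> Ob C \<Longrightarrow> \<mu> A \<in> Hom C (fob G (fob G A)) (fob G A)"
    using calculation(1) unfolding nat_trans_def by (simp add: comp_funct_def)
  ultimately show ?thesis
    using M \<eta>' G unfolding monad_def by (simp add: ob mp FO)
qed

section \<open>Generalised elements and simplicial objects\<close>

text \<open>
  Arrows are handled through their action on generalised elements \<open>Y \<rightarrow> A\<close> with \<open>Y\<close> fixed, so that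
  typing conditions only involve codomains.
\<close>

locale stage = category +
  fixes Y
  assumes Y: "Y \<in> Ob C"
begin

abbreviation el where "el \<equiv> Hom C Y"

lemma el_cmp: "\<lbrakk>f \<in> Hom C A B; x \<in> el A; A \<in> Ob C; B \<in> Ob C\<rbrakk> \<Longrightarrow> f \<odot> x \<in> el B"
  using cmp_in Y by blast

lemma el_assoc:
  "\<lbrakk>x \<in> el A; f \<in> Hom C A B; g \<in> Hom C B D; A \<in> Ob C; B \<in> Ob C; D \<in> Ob C\<rbrakk>
    \<Longrightarrow> (g \<odot> f) \<odot> x = g \<odot> (f \<odot> x)"
  using cmp_assoc[OF Y] by blast

end

context category
begin

lemma stage: "Y \<in> Ob C \<Longrightarrow> stage C Y"
  by (simp add: stage_def stage_axioms_def category_axioms)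

text \<open>The faithful half of the Yoneda lemma: the generic element \<open>Idn C A\<close> at the
  stage \<open>Y = A\<close> already separates \<open>f\<close> from \<open>g\<close>.\<close>

lemma eq_by_elements:
  assumes "A \<in> Ob C" "B \<in> Ob C" "f \<in> Hom C A B" "g \<in> Hom C A B"
    and "\<And>Y x. \<lbrakk>Y \<in> Ob C; x \<in> Hom C Y A\<rbrakk> \<Longrightarrow> f \<odot> x = g \<odot> x"
  shows "f = g"
  using assms(5)[OF assms(1) idn_in[OF assms(1)]] cmp_idn[OF assms(1,2)] assms(3,4) by simp

text \<open>Stated with right-nested application, the normal form in which all rules about elements
  are used; this avoids associativity in the computations.\<close>

lemma cmp_eq_by_elements:
  assumes ob: "A \<in> Ob C" "B \<in> Ob C" "D \<in> Ob C" "B' \<in> Ob C"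
    and h: "f \<in> Hom C A B" "g \<in> Hom C B D" "f' \<in> Hom C A B'" "g' \<in> Hom C B' D"
    and "\<And>Y x. \<lbrakk>Y \<in> Ob C; x \<in> Hom C Y A\<rbrakk> \<Longrightarrow> g \<odot> (f \<odot> x) = g' \<odot> (f' \<odot> x)"
  shows "g \<odot> f = g' \<odot> f'"
  using assms(9)[OF ob(1) idn_in[OF ob(1)]] cmp_idn h ob by metis

lemma cmp_eq_idn_by_elements:
  assumes ob: "A \<in> Ob C" "B \<in> Ob C"
    and h: "f \<in> Hom C A B" "g \<in> Hom C B A"
    and "\<And>Y x. \<lbrakk>Y \<in> Ob C; x \<in> Hom C Y A\<rbrakk> \<Longrightarrow> g \<odot> (f \<odot> x) = x"
  shows "g \<odot> f = Idn C A"
  using assms(5)[OF ob(1) idn_in[OF ob(1)]] cmp_idn h ob by metis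

end

text \<open>In the defining form the terms \<open>n - 1\<close>, \<open>j - 1\<close> and
  \<open>i - 1\<close> hinder unification and hide that they are never truncated. With successors
  every face has the form \<open>face X (Suc n) i\<close>, and its typing can be matched
  directly.\<close>

lemma simplicial_object_Suc:
  "simplicial_object C X \<longleftrightarrow>
    (\<forall>n. lev X n \<in> Ob C)
    \<and> (\<forall>n i. i \<le> Suc n \<longrightarrow> face X (Suc n) i \<in> Hom C (lev X (Suc n)) (lev X n))
    \<and> (\<forall>n i. i \<le> n \<longrightarrow> degen X n i \<in> Hom C (lev X n) (lev X (Suc n)))
    \<and> (\<forall>n i. \<not> (1 \<le> n \<and> i \<le> n) \<longrightarrow> face X n i = undefined)
    \<and> (\<forall>n i. \<not> i \<le> n \<longrightarrow> degen X n i = undefined)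
    \<and> (\<forall>n i j. i \<le> j \<and> j \<le> Suc n \<longrightarrow>
        face X (Suc n) i \<odot>\<^bsub>C\<^esub> face X (Suc (Suc n)) (Suc j)
          = face X (Suc n) j \<odot>\<^bsub>C\<^esub> face X (Suc (Suc n)) i)
    \<and> (\<forall>n i j. i \<le> j \<and> j \<le> n \<longrightarrow>
        degen X (Suc n) i \<odot>\<^bsub>C\<^esub> degen X n j = degen X (Suc n) (Suc j) \<odot>\<^bsub>C\<^esub> degen X n i)
    \<and> (\<forall>n i j. i \<le> j \<and> j \<le> n \<longrightarrow>
        face X (Suc (Suc n)) i \<odot>\<^bsub>C\<^esub> degen X (Suc n) (Suc j)
          = degen X n j \<odot>\<^bsub>C\<^esub> face X (Suc n) i)
    \<and> (\<forall>n j. j \<le> n \<longrightarrow> face X (Suc n) j \<odot>\<^bsub>C\<^esub> degen X n j = Idn C (lev X n))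
    \<and> (\<forall>n j. j \<le> n \<longrightarrow> face X (Suc n) (Suc j) \<odot>\<^bsub>C\<^esub> degen X n j = Idn C (lev X n))
    \<and> (\<forall>n i j. j < i \<and> i \<le> Suc n \<longrightarrow>
        face X (Suc (Suc n)) (Suc i) \<odot>\<^bsub>C\<^esub> degen X (Suc n) j
          = degen X n j \<odot>\<^bsub>C\<^esub> face X (Suc n) i)"
  (is "_ \<longleftrightarrow> ?ob \<and> ?f \<and> ?d \<and> ?fu \<and> ?du \<and> ?ff \<and> ?dd \<and> ?fd1 \<and> ?fd2 \<and> ?fd3 \<and> ?fd4")
proof -
  \<comment> \<open>Both sides range over the same indices: the bounds on the left force
    \<open>n\<close>, and the index \<open>i\<close> or \<open>j\<close> that gets lowered, to be
    successors.\<close>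
  have reindex:
    "(\<forall>n i. 1 \<le> n \<and> i \<le> n \<longrightarrow> Q n i) \<longleftrightarrow> (\<forall>n i. i \<le> Suc n \<longrightarrow> Q (Suc n) i)"
    "(\<forall>n i j. 2 \<le> n \<and> i < j \<and> j \<le> n \<longrightarrow> R n i j)
      \<longleftrightarrow> (\<forall>n i j. i \<le> j \<and> j \<le> Suc n \<longrightarrow> R (Suc (Suc n)) i (Suc j))"
    "(\<forall>n i j. i < j \<and> j \<le> n \<longrightarrow> R n i j) \<longleftrightarrow> (\<forall>n i j. i \<le> j \<and> j \<le> n \<longrightarrow> R (Suc n) i (Suc j))"
    "(\<forall>n i j. j + 1 < i \<and> i \<le> n + 1 \<longrightarrow> R n i j)
      \<longleftrightarrow> (\<forall>n i j. j < i \<and> i \<le> Suc n \<longrightarrow> R (Suc n) (Suc i) j)"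
    for Q :: "nat \<Rightarrow> nat \<Rightarrow> bool" and R :: "nat \<Rightarrow> nat \<Rightarrow> nat \<Rightarrow> bool"
    subgoal by (auto dest: Suc_le_D)
    subgoal
      apply (intro iffI allI impI)
      subgoal by simp
      subgoal for n i j by (cases n; cases "n - 1"; cases j) simp_all
      done
    subgoal
      apply (intro iffI allI impI)
      subgoal by simp
      subgoal for n i j by (cases n; cases j) simp_all
      done
    subgoal
      apply (intro iffI allI impI)
      subgoal by simp
      subgoal for n i j by (cases n; cases i) simp_all
      done
    done
  have same: "(\<forall>n i j. (i = j \<or> i = j + 1) \<and> j \<le> n \<longrightarrow>
        face X (n + 1) i \<odot>\<^bsub>C\<^esub> degen X n j = Idn C (lev X n)) \<longleftrightarrow> ?fd2 \<and> ?fd3"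
    by auto
  show ?thesis
    unfolding simplicial_object_def reindex same by simp
qed

lemma sobj_sel_mk [simp]:
  "lev (mk_sobj L d s) = L"
  "i \<le> Suc n \<Longrightarrow> face (mk_sobj L d s) (Suc n) i = d (Suc n) i"
  "i \<le> n \<Longrightarrow> degen (mk_sobj L d s) n i = s n i"
  by (simp_all add: mk_sobj_def)

text \<open>Out of range \<open>mk_sobj\<close> overwrites everything with \<open>undefined\<close>,
  so agreement at the meaningful indices is enough for equality of records.\<close>

lemma mk_sobj_cong:
  assumes "\<And>n. L n = L' n" "\<And>n i. i \<le> Suc n \<Longrightarrow> d (Suc n) i = d' (Suc n) i"
    and "\<And>n i. i \<le> n \<Longrightarrow> s n i = s' n i"
  shows "mk_sobj L d s = mk_sobj L' d' s'"
  unfolding mk_sobj_def using assms by (fastforce dest: Suc_le_D)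

lemma simplicial_sel [simp]:
  "X \<in> Ob (simplicial C) \<longleftrightarrow> simplicial_object C X"
  "Idn (simplicial C) X = (\<lambda>n. Idn C (lev X n))"
  "g \<odot>\<^bsub>simplicial C\<^esub> f = (\<lambda>n. g n \<odot>\<^bsub>C\<^esub> f n)"
  by (simp_all add: simplicial_def)

lemma simplicial_hom_Suc:
  "f \<in> Hom (simplicial C) X Y \<longleftrightarrow>
    (\<forall>n. f n \<in> Hom C (lev X n) (lev Y n))
    \<and> (\<forall>n i. i \<le> Suc n \<longrightarrow> f n \<odot>\<^bsub>C\<^esub> face X (Suc n) i = face Y (Suc n) i \<odot>\<^bsub>C\<^esub> f (Suc n))
    \<and> (\<forall>n i. i \<le> n \<longrightarrow> f (Suc n) \<odot>\<^bsub>C\<^esub> degen X n i = degen Y n i \<odot>\<^bsub>C\<^esub> f n)"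
proof -
  have pos: "(\<forall>n i. 1 \<le> n \<and> i \<le> n \<longrightarrow> P n i) \<longleftrightarrow> (\<forall>n i. i \<le> Suc n \<longrightarrow> P (Suc n) i)"
    for P :: "nat \<Rightarrow> nat \<Rightarrow> bool"
    by (auto dest: Suc_le_D)
  show ?thesis by (simp add: simplicial_def pos del: One_nat_def, simp)
qed

lemma simplicial_objectD:
  assumes "simplicial_object C X"
  shows "lev X n \<in> Ob C"
    and "i \<le> Suc n \<Longrightarrow> face X (Suc n) i \<in> Hom C (lev X (Suc n)) (lev X n)"
    and "i \<le> n \<Longrightarrow> degen X n i \<in> Hom C (lev X n) (lev X (Suc n))"
    and "\<lbrakk>i \<le> j; j \<le> Suc n\<rbrakk> \<Longrightarrow> face X (Suc n) i \<odot>\<^bsub>C\<^esub> face X (Suc (Suc n)) (Suc j)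
          = face X (Suc n) j \<odot>\<^bsub>C\<^esub> face X (Suc (Suc n)) i"
    and "\<lbrakk>i \<le> j; j \<le> n\<rbrakk> \<Longrightarrow>
        degen X (Suc n) i \<odot>\<^bsub>C\<^esub> degen X n j = degen X (Suc n) (Suc j) \<odot>\<^bsub>C\<^esub> degen X n i"
    and "\<lbrakk>i \<le> j; j \<le> n\<rbrakk> \<Longrightarrow> face X (Suc (Suc n)) i \<odot>\<^bsub>C\<^esub> degen X (Suc n) (Suc j)
          = degen X n j \<odot>\<^bsub>C\<^esub> face X (Suc n) i"
    and "j \<le> n \<Longrightarrow> face X (Suc n) j \<odot>\<^bsub>C\<^esub> degen X n j = Idn C (lev X n)"
    and "j \<le> n \<Longrightarrow> face X (Suc n) (Suc j) \<odot>\<^bsub>C\<^esub> degen X n j = Idn C (lev X n)"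
    and "\<lbrakk>j < i; i \<le> Suc n\<rbrakk> \<Longrightarrow> face X (Suc (Suc n)) (Suc i) \<odot>\<^bsub>C\<^esub> degen X (Suc n) j
          = degen X n j \<odot>\<^bsub>C\<^esub> face X (Suc n) i"
proof -
  note r1 = iffD1[OF simplicial_object_Suc assms]
  note r2 = conjunct2[OF r1]
  note r3 = conjunct2[OF r2]
  note r4 = conjunct2[OF r3]
  note r5 = conjunct2[OF r4]
  note r6 = conjunct2[OF r5]
  note r7 = conjunct2[OF r6]
  note r8 = conjunct2[OF r7]
  note r9 = conjunct2[OF r8]
  note r10 = conjunct2[OF r9]
  note r11 = conjunct2[OF r10]
  show "lev X n \<in> Ob C"
    using conjunct1[OF r1] by blast
  show "i \<le> Suc n \<Longrightarrow> face X (Suc n) i \<in> Hom C (lev X (Suc n)) (lev X n)"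
    using conjunct1[OF r2] by blast
  show "i \<le> n \<Longrightarrow> degen X n i \<in> Hom C (lev X n) (lev X (Suc n))"
    using conjunct1[OF r3] by blast
  show "\<lbrakk>i \<le> j; j \<le> Suc n\<rbrakk> \<Longrightarrow> face X (Suc n) i \<odot>\<^bsub>C\<^esub> face X (Suc (Suc n)) (Suc j)
          = face X (Suc n) j \<odot>\<^bsub>C\<^esub> face X (Suc (Suc n)) i"
    using conjunct1[OF r6] by blast
  show "\<lbrakk>i \<le> j; j \<le> n\<rbrakk> \<Longrightarrow>
        degen X (Suc n) i \<odot>\<^bsub>C\<^esub> degen X n j = degen X (Suc n) (Suc j) \<odot>\<^bsub>C\<^esub> degen X n i"
    using conjunct1[OF r7] by blast
  show "\<lbrakk>i \<le> j; j \<le> n\<rbrakk> \<Longrightarrow> face X (Suc (Suc n)) i \<odot>\<^bsub>C\<^esub> degen X (Suc n) (Suc j)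
          = degen X n j \<odot>\<^bsub>C\<^esub> face X (Suc n) i"
    using conjunct1[OF r8] by blast
  show "j \<le> n \<Longrightarrow> face X (Suc n) j \<odot>\<^bsub>C\<^esub> degen X n j = Idn C (lev X n)"
    using conjunct1[OF r9] by blast
  show "j \<le> n \<Longrightarrow> face X (Suc n) (Suc j) \<odot>\<^bsub>C\<^esub> degen X n j = Idn C (lev X n)"
    using conjunct1[OF r10] by blast
  show "\<lbrakk>j < i; i \<le> Suc n\<rbrakk> \<Longrightarrow> face X (Suc (Suc n)) (Suc i) \<odot>\<^bsub>C\<^esub> degen X (Suc n) j
          = degen X n j \<odot>\<^bsub>C\<^esub> face X (Suc n) i"
    using r11 by blast
qed

lemma simplicial_homD:
  assumes "f \<in> Hom (simplicial C) X X'"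
  shows "f n \<in> Hom C (lev X n) (lev X' n)"
    and "i \<le> Suc n \<Longrightarrow> f n \<odot>\<^bsub>C\<^esub> face X (Suc n) i = face X' (Suc n) i \<odot>\<^bsub>C\<^esub> f (Suc n)"
    and "i \<le> n \<Longrightarrow> f (Suc n) \<odot>\<^bsub>C\<^esub> degen X n i = degen X' n i \<odot>\<^bsub>C\<^esub> f n"
  using assms unfolding simplicial_hom_Suc by blast+

section \<open>Simplicial identities on generalised elements\<close>

context stage
begin

text \<open>The direction opposite to \<open>cmp_eq_by_elements\<close>: an equation between
  composites becomes a rewrite rule for elements.\<close>

lemma cmp_eq_el:
  assumes eq: "g \<odot> f = g' \<odot> f'" and x: "x \<in> el A"
    and h: "f \<in> Hom C A B" "g \<in> Hom C B D" "f' \<in> Hom C A B'" "g' \<in> Hom C B' D"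
    and ob: "A \<in> Ob C" "B \<in> Ob C" "B' \<in> Ob C" "D \<in> Ob C"
  shows "g \<odot> f \<odot> x = g' \<odot> f' \<odot> x"
  using el_assoc[OF x h(1,2) ob(1,2,4)] el_assoc[OF x h(3,4) ob(1,3,4)] eq by simp

lemma cmp_eq_idn_el:
  assumes eq: "g \<odot> f = Idn C A" and x: "x \<in> el A"
    and h: "f \<in> Hom C A B" "g \<in> Hom C B A" and ob: "A \<in> Ob C" "B \<in> Ob C"
  shows "g \<odot> f \<odot> x = x"
  using el_assoc[OF x h ob(1,2,1)] eq idn_cmp[OF Y ob(1) x] by simp

lemma simplicial_hom_el:
  assumes f: "f \<in> Hom (simplicial C) X X'"
    and X: "simplicial_object C X" and X': "simplicial_object C X'"
  shows "x \<in> el (lev X n) \<Longrightarrow> f n \<odot> x \<in> el (lev X' n)"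
    and "\<lbrakk>i \<le> Suc n; x \<in> el (lev X (Suc n))\<rbrakk>
      \<Longrightarrow> f n \<odot> face X (Suc n) i \<odot> x = face X' (Suc n) i \<odot> f (Suc n) \<odot> x"
    and "\<lbrakk>i \<le> n; x \<in> el (lev X n)\<rbrakk>
      \<Longrightarrow> f (Suc n) \<odot> degen X n i \<odot> x = degen X' n i \<odot> f n \<odot> x"
proof -
  note so = simplicial_objectD[OF X] and so' = simplicial_objectD[OF X']
  show "x \<in> el (lev X n) \<Longrightarrow> f n \<odot> x \<in> el (lev X' n)"
    using el_cmp[OF simplicial_homD(1)[OF f]] so(1) so'(1) by blast
  show "f n \<odot> face X (Suc n) i \<odot> x = face X' (Suc n) i \<odot> f (Suc n) \<odot> x"
    if "i \<le> Suc n" "x \<in> el (lev X (Suc n))"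
    by (rule cmp_eq_el[OF simplicial_homD(2)[OF f that(1)] that(2) so(2) simplicial_homD(1)[OF f]
          simplicial_homD(1)[OF f] so'(2) so(1) so(1) so'(1) so'(1)]) (rule that(1))+
  show "f (Suc n) \<odot> degen X n i \<odot> x = degen X' n i \<odot> f n \<odot> x"
    if "i \<le> n" "x \<in> el (lev X n)"
    by (rule cmp_eq_el[OF simplicial_homD(3)[OF f that(1)] that(2) so(3) simplicial_homD(1)[OF f]
          simplicial_homD(1)[OF f] so'(3) so(1) so(1) so'(1) so'(1)]) (rule that(1))+
qed

end

locale simplicial_stage = stage +
  fixes X
  assumes X: "simplicial_object C X"
begin

lemmas lev_ob [simp] = simplicial_objectD(1)[OF X]
lemmas face_hom [simp] = simplicial_objectD(2)[OF X]
lemmas degen_hom [simp] = simplicial_objectD(3)[OF X]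

lemma face_el [simp]:
  "\<lbrakk>i \<le> Suc n; x \<in> el (lev X (Suc n))\<rbrakk> \<Longrightarrow> face X (Suc n) i \<odot> x \<in> el (lev X n)"
  by (rule el_cmp[OF face_hom]) simp_all

lemma degen_el [simp]:
  "\<lbrakk>i \<le> n; x \<in> el (lev X n)\<rbrakk> \<Longrightarrow> degen X n i \<odot> x \<in> el (lev X (Suc n))"
  by (rule el_cmp[OF degen_hom]) simp_all

lemma face_face:
  "\<lbrakk>i \<le> j; j \<le> Suc n; x \<in> el (lev X (Suc (Suc n)))\<rbrakk>
    \<Longrightarrow> face X (Suc n) i \<odot> face X (Suc (Suc n)) (Suc j) \<odot> x
      = face X (Suc n) j \<odot> face X (Suc (Suc n)) i \<odot> x"
  by (rule cmp_eq_el[OF simplicial_objectD(4)[OF X] _ face_hom face_hom face_hom face_hom lev_ob lev_ob lev_ob lev_ob])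
    simp_all

lemma degen_degen:
  "\<lbrakk>i \<le> j; j \<le> n; x \<in> el (lev X n)\<rbrakk>
    \<Longrightarrow> degen X (Suc n) i \<odot> degen X n j \<odot> x = degen X (Suc n) (Suc j) \<odot> degen X n i \<odot> x"
  by (rule cmp_eq_el[OF simplicial_objectD(5)[OF X] _ degen_hom degen_hom degen_hom degen_hom lev_ob lev_ob lev_ob lev_ob])
    simp_all

lemma face_degen_less:
  "\<lbrakk>i \<le> j; j \<le> n; x \<in> el (lev X (Suc n))\<rbrakk>
    \<Longrightarrow> face X (Suc (Suc n)) i \<odot> degen X (Suc n) (Suc j) \<odot> x
      = degen X n j \<odot> face X (Suc n) i \<odot> x"
  by (rule cmp_eq_el[OF simplicial_objectD(6)[OF X] _ degen_hom face_hom face_hom degen_hom lev_ob lev_ob lev_ob lev_ob])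
    simp_all

lemma face_degen_same:
  "\<lbrakk>j \<le> n; x \<in> el (lev X n)\<rbrakk> \<Longrightarrow> face X (Suc n) j \<odot> degen X n j \<odot> x = x"
  by (rule cmp_eq_idn_el[OF simplicial_objectD(7)[OF X] _ degen_hom face_hom lev_ob lev_ob])
    simp_all

lemma face_degen_Suc:
  "\<lbrakk>j \<le> n; x \<in> el (lev X n)\<rbrakk> \<Longrightarrow> face X (Suc n) (Suc j) \<odot> degen X n j \<odot> x = x"
  by (rule cmp_eq_idn_el[OF simplicial_objectD(8)[OF X] _ degen_hom face_hom lev_ob lev_ob])
    simp_all

lemma face_degen_greater:
  "\<lbrakk>j < i; i \<le> Suc n; x \<in> el (lev X (Suc n))\<rbrakk>
    \<Longrightarrow> face X (Suc (Suc n)) (Suc i) \<odot> degen X (Suc n) j \<odot> x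
      = degen X n j \<odot> face X (Suc n) i \<odot> x"
  by (rule cmp_eq_el[OF simplicial_objectD(9)[OF X] _ degen_hom face_hom face_hom degen_hom lev_ob lev_ob lev_ob lev_ob])
    simp_all

end

section \<open>Building simplicial objects and maps; their category; transport of structure\<close>

context category
begin

lemma simplicial_stage:
  "\<lbrakk>Y \<in> Ob C; simplicial_object C X\<rbrakk> \<Longrightarrow> simplicial_stage C Y X"
  by (simp add: simplicial_stage_def simplicial_stage_axioms_def stage)

text \<open>The identities are requested on elements because the objects to be built are towers,
  where a composite is understood through the entries of its value at an element. The clauses for
  indices out of range hold by the construction of \<open>mk_sobj\<close>.\<close>

lemma mk_sobj_simplicial:
  assumes ob: "\<And>n. L n \<in> Ob C"
    and d: "\<And>n i. i \<le> Suc n \<Longrightarrow> d (Suc n) i \<in> Hom C (L (Suc n)) (L n)"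
    and s: "\<And>n i. i \<le> n \<Longrightarrow> s n i \<in> Hom C (L n) (L (Suc n))"
    and dd: "\<And>Y x n i j. \<lbrakk>Y \<in> Ob C; x \<in> Hom C Y (L (Suc (Suc n))); i \<le> j; j \<le> Suc n\<rbrakk>
      \<Longrightarrow> d (Suc n) i \<odot> d (Suc (Suc n)) (Suc j) \<odot> x = d (Suc n) j \<odot> d (Suc (Suc n)) i \<odot> x"
    and ss: "\<And>Y x n i j. \<lbrakk>Y \<in> Ob C; x \<in> Hom C Y (L n); i \<le> j; j \<le> n\<rbrakk>
      \<Longrightarrow> s (Suc n) i \<odot> s n j \<odot> x = s (Suc n) (Suc j) \<odot> s n i \<odot> x"
    and ds1: "\<And>Y x n i j. \<lbrakk>Y \<in> Ob C; x \<in> Hom C Y (L (Suc n)); i \<le> j; j \<le> n\<rbrakk>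
      \<Longrightarrow> d (Suc (Suc n)) i \<odot> s (Suc n) (Suc j) \<odot> x = s n j \<odot> d (Suc n) i \<odot> x"
    and ds2: "\<And>Y x n j. \<lbrakk>Y \<in> Ob C; x \<in> Hom C Y (L n); j \<le> n\<rbrakk>
      \<Longrightarrow> d (Suc n) j \<odot> s n j \<odot> x = x"
    and ds3: "\<And>Y x n j. \<lbrakk>Y \<in> Ob C; x \<in> Hom C Y (L n); j \<le> n\<rbrakk>
      \<Longrightarrow> d (Suc n) (Suc j) \<odot> s n j \<odot> x = x"
    and ds4: "\<And>Y x n i j. \<lbrakk>Y \<in> Ob C; x \<in> Hom C Y (L (Suc n)); j < i; i \<le> Suc n\<rbrakk>
      \<Longrightarrow> d (Suc (Suc n)) (Suc i) \<odot> s (Suc n) j \<odot> x = s n j \<odot> d (Suc n) i \<odot> x"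
  shows "simplicial_object C (mk_sobj L d s)"
proof -
  have "d (Suc n) i \<odot> d (Suc (Suc n)) (Suc j) = d (Suc n) j \<odot> d (Suc (Suc n)) i"
    if "i \<le> j" "j \<le> Suc n" for n i j
    by (rule cmp_eq_by_elements[OF ob ob ob ob]) (use that dd in \<open>auto intro!: d\<close>)
  moreover have "s (Suc n) i \<odot> s n j = s (Suc n) (Suc j) \<odot> s n i" if "i \<le> j" "j \<le> n" for n i j
    by (rule cmp_eq_by_elements[OF ob ob ob ob]) (use that ss in \<open>auto intro!: s\<close>)
  moreover have "d (Suc (Suc n)) i \<odot> s (Suc n) (Suc j) = s n j \<odot> d (Suc n) i"
    if "i \<le> j" "j \<le> n" for n i j
    by (rule cmp_eq_by_elements[OF ob ob ob ob]) (use that ds1 in \<open>auto intro!: s d\<close>)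
  moreover have "d (Suc n) j \<odot> s n j = Idn C (L n)" if "j \<le> n" for n j
    by (rule cmp_eq_idn_by_elements[OF ob ob]) (use that ds2 in \<open>auto intro!: s d\<close>)
  moreover have "d (Suc n) (Suc j) \<odot> s n j = Idn C (L n)" if "j \<le> n" for n j
    by (rule cmp_eq_idn_by_elements[OF ob ob]) (use that ds3 in \<open>auto intro!: s d\<close>)
  moreover have "d (Suc (Suc n)) (Suc i) \<odot> s (Suc n) j = s n j \<odot> d (Suc n) i"
    if "j < i" "i \<le> Suc n" for n i j
    by (rule cmp_eq_by_elements[OF ob ob ob ob]) (use that ds4 in \<open>auto intro!: s d\<close>)
  ultimately show ?thesis
    unfolding simplicial_object_Suc by (auto simp: ob d s) (auto simp: mk_sobj_def)
qed

lemma simplicial_homI: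
  assumes X: "simplicial_object C X" and X': "simplicial_object C X'"
    and f: "\<And>n. f n \<in> Hom C (lev X n) (lev X' n)"
    and d: "\<And>Y x n i. \<lbrakk>Y \<in> Ob C; x \<in> Hom C Y (lev X (Suc n)); i \<le> Suc n\<rbrakk>
      \<Longrightarrow> f n \<odot> face X (Suc n) i \<odot> x = face X' (Suc n) i \<odot> f (Suc n) \<odot> x"
    and s: "\<And>Y x n i. \<lbrakk>Y \<in> Ob C; x \<in> Hom C Y (lev X n); i \<le> n\<rbrakk>
      \<Longrightarrow> f (Suc n) \<odot> degen X n i \<odot> x = degen X' n i \<odot> f n \<odot> x"
  shows "f \<in> Hom (simplicial C) X X'"
proof -
  note ob = simplicial_objectD(1)[OF X] simplicial_objectD(1)[OF X']
  note hom = f simplicial_objectD(2,3)[OF X] simplicial_objectD(2,3)[OF X']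
  have "f n \<odot> face X (Suc n) i = face X' (Suc n) i \<odot> f (Suc n)" if "i \<le> Suc n" for n i
    by (rule cmp_eq_by_elements[OF ob(1) ob(1) ob(2) ob(2)]) (use that d in \<open>auto intro!: hom\<close>)
  moreover have "f (Suc n) \<odot> degen X n i = degen X' n i \<odot> f n" if "i \<le> n" for n i
    by (rule cmp_eq_by_elements[OF ob(1) ob(1) ob(2) ob(2)]) (use that s in \<open>auto intro!: hom\<close>)
  ultimately show ?thesis using f by (simp add: simplicial_hom_Suc)
qed

lemma category_simplicial: "category (simplicial C)"
proof (unfold_locales, simp_all)
  fix X assume X: "simplicial_object C X"
  note so = simplicial_objectD[OF X]
  show "(\<lambda>n. Idn C (lev X n)) \<in> Hom (simplicial C) X X"
    unfolding simplicial_hom_Suc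
    by (simp add: idn_in so(1) cmp_idn[OF so(1) so(1) so(2)] cmp_idn[OF so(1) so(1) so(3)]
        idn_cmp[OF so(1) so(1) so(2)] idn_cmp[OF so(1) so(1) so(3)])
next
  fix X X' X'' f g
  assume *: "simplicial_object C X" "simplicial_object C X'" "simplicial_object C X''"
    "f \<in> Hom (simplicial C) X X'" "g \<in> Hom (simplicial C) X' X''"
  note ob = simplicial_objectD(1)[OF *(1)] simplicial_objectD(1)[OF *(2)] simplicial_objectD(1)[OF *(3)]
  note hom = simplicial_homD(1)[OF *(4)] simplicial_homD(1)[OF *(5)]
  show "(\<lambda>n. g n \<odot> f n) \<in> Hom (simplicial C) X X''"
  proof (rule simplicial_homI[OF *(1,3)])
    fix n show "g n \<odot> f n \<in> Hom C (lev X n) (lev X'' n)"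
      using ob hom by (blast intro: cmp_in)
  next
    fix Y x n and i :: nat assume a: "Y \<in> Ob C" "x \<in> Hom C Y (lev X (Suc n))" "i \<le> Suc n"
    interpret simplicial_stage C Y X using a * by (simp add: simplicial_stage)
    show "(g n \<odot> f n) \<odot> face X (Suc n) i \<odot> x = face X'' (Suc n) i \<odot> (g (Suc n) \<odot> f (Suc n)) \<odot> x"
      using a * by (simp add: el_assoc[OF _ hom ob] simplicial_hom_el[OF *(4)] simplicial_hom_el[OF *(5)])
  next
    fix Y x n and i :: nat assume a: "Y \<in> Ob C" "x \<in> Hom C Y (lev X n)" "i \<le> n"
    interpret simplicial_stage C Y X using a * by (simp add: simplicial_stage)
    show "(g (Suc n) \<odot> f (Suc n)) \<odot> degen X n i \<odot> x = degen X'' n i \<odot> (g n \<odot> f n) \<odot> x"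
      using a * by (simp add: el_assoc[OF _ hom ob] simplicial_hom_el[OF *(4)] simplicial_hom_el[OF *(5)])
  qed
next
  fix X X' f
  assume *: "simplicial_object C X" "simplicial_object C X'" "f \<in> Hom (simplicial C) X X'"
  note ob = simplicial_objectD(1)[OF *(1)] simplicial_objectD(1)[OF *(2)]
  show "(\<lambda>n. f n \<odot> Idn C (lev X n)) = f" "(\<lambda>n. Idn C (lev X' n) \<odot> f n) = f"
    by (simp_all add: cmp_idn[OF ob simplicial_homD(1)[OF *(3)]]
        idn_cmp[OF ob simplicial_homD(1)[OF *(3)]])
next
  fix X X1 X2 X3 f g h
  assume *: "simplicial_object C X" "simplicial_object C X1" "simplicial_object C X2"
    "simplicial_object C X3" "f \<in> Hom (simplicial C) X X1" "g \<in> Hom (simplicial C) X1 X2"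
    "h \<in> Hom (simplicial C) X2 X3"
  show "(\<lambda>n. (h n \<odot> g n) \<odot> f n) = (\<lambda>n. h n \<odot> g n \<odot> f n)"
    by (intro ext cmp_assoc[OF *(1-4)[THEN simplicial_objectD(1)] *(5-7)[THEN simplicial_homD(1)]])
qed

text \<open>Transport of structure: every element of \<open>L n\<close> is an image under
  \<open>\<alpha> n\<close>, and \<alpha>d, \<alpha>s read backwards pull \<alpha> outside, so each
  identity for \<open>d\<close> and \<open>s\<close> becomes \<alpha> applied to an identity of
  \<open>X\<close>. This takes the place of a direct verification of the identities for the
  universal bundle.\<close>

lemma transport_simplicial:
  assumes X: "simplicial_object C X" and ob: "\<And>n. L n \<in> Ob C"
    and d: "\<And>n i. i \<le> Suc n \<Longrightarrow> d (Suc n) i \<in> Hom C (L (Suc n)) (L n)"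
    and s: "\<And>n i. i \<le> n \<Longrightarrow> s n i \<in> Hom C (L n) (L (Suc n))"
    and \<alpha>: "\<And>n. is_iso C (lev X n) (L n) (\<alpha> n)"
    and \<alpha>d: "\<And>Y x n i. \<lbrakk>Y \<in> Ob C; x \<in> Hom C Y (lev X (Suc n)); i \<le> Suc n\<rbrakk>
      \<Longrightarrow> \<alpha> n \<odot> face X (Suc n) i \<odot> x = d (Suc n) i \<odot> \<alpha> (Suc n) \<odot> x"
    and \<alpha>s: "\<And>Y x n i. \<lbrakk>Y \<in> Ob C; x \<in> Hom C Y (lev X n); i \<le> n\<rbrakk>
      \<Longrightarrow> \<alpha> (Suc n) \<odot> degen X n i \<odot> x = s n i \<odot> \<alpha> n \<odot> x"
  shows "simplicial_object C (mk_sobj L d s)"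
    and "\<alpha> \<in> Hom (simplicial C) X (mk_sobj L d s)"
    and "is_iso (simplicial C) X (mk_sobj L d s) \<alpha>"
proof -
  have \<alpha>h: "\<alpha> n \<in> Hom C (lev X n) (L n)" for n using \<alpha> by (simp add: is_iso_def)
  obtain \<beta> where \<beta>: "\<And>n. \<beta> n \<in> Hom C (L n) (lev X n)" "\<And>n. \<beta> n \<odot> \<alpha> n = Idn C (lev X n)"
      "\<And>n. \<alpha> n \<odot> \<beta> n = Idn C (L n)"
    using \<alpha> unfolding is_iso_def by metis
  \<comment> \<open>The preimage of \<open>y\<close> is \<open>\<beta> n \<odot> y\<close>. From
    here on an arbitrary element may be replaced by an \<alpha>-image.\<close>
  have surj: "\<exists>x\<in>Hom C Y (lev X n). y = \<alpha> n \<odot> x" if "Y \<in> Ob C" "y \<in> Hom C Y (L n)" for Y y n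
  proof
    interpret simplicial_stage C Y X using that X by (simp add: simplicial_stage)
    show "\<beta> n \<odot> y \<in> Hom C Y (lev X n)" using that ob el_cmp[OF \<beta>(1)] by simp
    show "y = \<alpha> n \<odot> \<beta> n \<odot> y"
      using cmp_eq_idn_el[OF \<beta>(3) that(2) \<beta>(1) \<alpha>h] ob by simp
  qed
  show S: "simplicial_object C (mk_sobj L d s)"
  proof (rule mk_sobj_simplicial[where L = L and d = d and s = s, OF ob d s])
    fix Y y n and i j :: nat
    assume a: "Y \<in> Ob C" "y \<in> Hom C Y (L (Suc (Suc n)))" "i \<le> j" "j \<le> Suc n"
    then obtain x where x: "x \<in> Hom C Y (lev X (Suc (Suc n)))" "y = \<alpha> (Suc (Suc n)) \<odot> x"
      using surj by blast
    interpret simplicial_stage C Y X using a X by (simp add: simplicial_stage)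
    from x a show "d (Suc n) i \<odot> d (Suc (Suc n)) (Suc j) \<odot> y = d (Suc n) j \<odot> d (Suc (Suc n)) i \<odot> y"
      by (simp add: \<alpha>d[symmetric] face_face)
  next
    fix Y y n and i j :: nat
    assume a: "Y \<in> Ob C" "y \<in> Hom C Y (L n)" "i \<le> j" "j \<le> n"
    then obtain x where x: "x \<in> Hom C Y (lev X n)" "y = \<alpha> n \<odot> x"
      using surj by blast
    interpret simplicial_stage C Y X using a X by (simp add: simplicial_stage)
    from x a show "s (Suc n) i \<odot> s n j \<odot> y = s (Suc n) (Suc j) \<odot> s n i \<odot> y"
      by (simp add: \<alpha>s[symmetric] degen_degen)
  next
    fix Y y n and i j :: nat
    assume a: "Y \<in> Ob C" "y \<in> Hom C Y (L (Suc n))" "i \<le> j" "j \<le> n"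
    then obtain x where x: "x \<in> Hom C Y (lev X (Suc n))" "y = \<alpha> (Suc n) \<odot> x"
      using surj by blast
    interpret simplicial_stage C Y X using a X by (simp add: simplicial_stage)
    from x a show "d (Suc (Suc n)) i \<odot> s (Suc n) (Suc j) \<odot> y = s n j \<odot> d (Suc n) i \<odot> y"
      by (simp add: \<alpha>s[symmetric] \<alpha>d[symmetric] face_degen_less)
  next
    fix Y y n and j :: nat
    assume a: "Y \<in> Ob C" "y \<in> Hom C Y (L n)" "j \<le> n"
    then obtain x where x: "x \<in> Hom C Y (lev X n)" "y = \<alpha> n \<odot> x"
      using surj by blast
    interpret simplicial_stage C Y X using a X by (simp add: simplicial_stage)
    from x a show "d (Suc n) j \<odot> s n j \<odot> y = y" "d (Suc n) (Suc j) \<odot> s n j \<odot> y = y"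
      by (simp_all add: \<alpha>s[symmetric] \<alpha>d[symmetric] face_degen_same face_degen_Suc)
  next
    fix Y y n and i j :: nat
    assume a: "Y \<in> Ob C" "y \<in> Hom C Y (L (Suc n))" "j < i" "i \<le> Suc n"
    then obtain x where x: "x \<in> Hom C Y (lev X (Suc n))" "y = \<alpha> (Suc n) \<odot> x"
      using surj by blast
    interpret simplicial_stage C Y X using a X by (simp add: simplicial_stage)
    from x a show "d (Suc (Suc n)) (Suc i) \<odot> s (Suc n) j \<odot> y = s n j \<odot> d (Suc n) i \<odot> y"
      by (simp add: \<alpha>s[symmetric] \<alpha>d[symmetric] face_degen_greater)
  qed
  show \<alpha>H: "\<alpha> \<in> Hom (simplicial C) X (mk_sobj L d s)"
    by (rule simplicial_homI[OF X S]) (simp_all add: \<alpha>h \<alpha>d \<alpha>s)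
  have \<beta>\<alpha>: "\<beta> n \<odot> \<alpha> n \<odot> x = x" if "Y \<in> Ob C" "x \<in> Hom C Y (lev X n)" for Y x n
  proof -
    interpret simplicial_stage C Y X using that X by (simp add: simplicial_stage)
    show ?thesis using cmp_eq_idn_el[OF \<beta>(2) that(2) \<alpha>h \<beta>(1)] ob by simp
  qed
  \<comment> \<open>A levelwise inverse of a simplicial map is simplicial: evaluate at an
    \<alpha>-image and let \<beta> cancel \<alpha>.\<close>
  have "\<beta> \<in> Hom (simplicial C) (mk_sobj L d s) X"
  proof (rule simplicial_homI[OF S X])
    fix Y y n and i :: nat assume a: "Y \<in> Ob C" "y \<in> Hom C Y (lev (mk_sobj L d s) (Suc n))" "i \<le> Suc n"
    then obtain x where x: "x \<in> Hom C Y (lev X (Suc n))" "y = \<alpha> (Suc n) \<odot> x"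
      using surj unfolding sobj_sel_mk by blast
    interpret simplicial_stage C Y X using a X by (simp add: simplicial_stage)
    show "\<beta> n \<odot> face (mk_sobj L d s) (Suc n) i \<odot> y = face X (Suc n) i \<odot> \<beta> (Suc n) \<odot> y"
      using x a by (simp add: \<alpha>d[symmetric] \<beta>\<alpha>)
  next
    fix Y y n and i :: nat assume a: "Y \<in> Ob C" "y \<in> Hom C Y (lev (mk_sobj L d s) n)" "i \<le> n"
    then obtain x where x: "x \<in> Hom C Y (lev X n)" "y = \<alpha> n \<odot> x"
      using surj unfolding sobj_sel_mk by blast
    interpret simplicial_stage C Y X using a X by (simp add: simplicial_stage)
    show "\<beta> (Suc n) \<odot> degen (mk_sobj L d s) n i \<odot> y = degen X n i \<odot> \<beta> n \<odot> y"
      using x a by (simp add: \<alpha>s[symmetric] \<beta>\<alpha>)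
  qed (simp add: \<beta>(1))
  with \<alpha>H show "is_iso (simplicial C) X (mk_sobj L d s) \<alpha>"
    unfolding is_iso_def by (auto simp: \<beta> fun_eq_iff intro!: bexI[of _ \<beta>])
qed

end

lemma levelwise_functor:
  assumes F: "is_functor C D F"
  shows "is_functor (simplicial C) (simplicial D) (levelwise F)"
proof (rule is_functorI)
  interpret C: category C by (rule is_functorD(1)[OF F])
  interpret D: category D by (rule is_functorD(2)[OF F])
  show "category (simplicial C)" "category (simplicial D)"
    by (rule C.category_simplicial D.category_simplicial)+
  note FD = is_functorD(3,4)[OF F]
  note comp = is_functorD(6)[OF F, symmetric]
  {
    fix X assume "X \<in> Ob (simplicial C)"
    then have X: "simplicial_object C X" by simp
    note so = simplicial_objectD[OF X]
    \<comment> \<open>Composites of images are collected into one application of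
      \<open>fmap F\<close>, so that an identity for the image becomes the image of an identity of
      \<open>X\<close>. The source \<open>A\<close> must be explicit because an arrow does not
      determine it.\<close>
    have [simp]: "fmap F (lev X (Suc n)) (lev X n) (face X (Suc n) i) \<odot>\<^bsub>D\<^esub> fmap F A (lev X (Suc n)) f
          = fmap F A (lev X n) (face X (Suc n) i \<odot>\<^bsub>C\<^esub> f)"
      if "A \<in> Ob C" "f \<in> Hom C A (lev X (Suc n))" "i \<le> Suc n" for n i A f
      using that by (intro comp so)
    have [simp]: "fmap F (lev X n) (lev X (Suc n)) (degen X n i) \<odot>\<^bsub>D\<^esub> fmap F A (lev X n) f
          = fmap F A (lev X (Suc n)) (degen X n i \<odot>\<^bsub>C\<^esub> f)"
      if "A \<in> Ob C" "f \<in> Hom C A (lev X n)" "i \<le> n" for n i A f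
      using that by (intro comp so)
    have "simplicial_object D (fob (levelwise F) X)"
      unfolding simplicial_object_Suc
    proof (intro conjI allI impI, goal_cases)
      case 4
      then show ?case by (auto simp: levelwise_def mk_sobj_def)
    next
      case 5
      then show ?case by (simp add: levelwise_def mk_sobj_def)
    qed (simp_all add: levelwise_def FD so is_functorD(5)[OF F])
    then show "fob (levelwise F) X \<in> Ob (simplicial D)" by simp
  next
    fix X X' f assume "X \<in> Ob (simplicial C)" "X' \<in> Ob (simplicial C)" "f \<in> Hom (simplicial C) X X'"
    then have X: "simplicial_object C X" "simplicial_object C X'"
      and f: "f \<in> Hom (simplicial C) X X'" by simp_all
    note so = simplicial_objectD[OF X(1)] and so' = simplicial_objectD[OF X(2)]
    note h = simplicial_homD[OF f]
    show "fmap (levelwise F) X X' f \<in> Hom (simplicial D) (fob (levelwise F) X) (fob (levelwise F) X')"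
      unfolding simplicial_hom_Suc
      by (simp add: levelwise_def FD so(1) so'(1) h comp[OF so(1) so(1) so'(1) so(2) h(1)]
          comp[OF so(1) so'(1) so'(1) h(1) so'(2)] comp[OF so(1) so(1) so'(1) so(3) h(1)]
          comp[OF so(1) so'(1) so'(1) h(1) so'(3)])
  next
    fix X assume "X \<in> Ob (simplicial C)"
    then show "fmap (levelwise F) X X (Idn (simplicial C) X)
        = Idn (simplicial D) (fob (levelwise F) X)"
      by (simp add: levelwise_def is_functorD(5)[OF F] simplicial_objectD)
  next
    fix X X' X'' f g assume "X \<in> Ob (simplicial C)" "X' \<in> Ob (simplicial C)" "X'' \<in> Ob (simplicial C)"
      "f \<in> Hom (simplicial C) X X'" "g \<in> Hom (simplicial C) X' X''"
    then show "fmap (levelwise F) X X'' (g \<odot>\<^bsub>simplicial C\<^esub> f)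
       = fmap (levelwise F) X' X'' g \<odot>\<^bsub>simplicial D\<^esub> fmap (levelwise F) X X' f"
      by (auto simp: levelwise_def intro!: ext is_functorD(6)[OF F] simplicial_objectD(1) simplicial_homD(1))
  }
qed

section \<open>Finite products\<close>

context fp_category
begin

lemma prd_ob [simp]: "set As \<subseteq> Ob C \<Longrightarrow> prd C As \<in> Ob C"
  using product by (simp add: is_product_def)

lemma prj_hom: "\<lbrakk>set As \<subseteq> Ob C; i < length As\<rbrakk> \<Longrightarrow> prj C As i \<in> Hom C (prd C As) (As ! i)"
  using product by (simp add: is_product_def)

lemma tuple_ex1:
  assumes "X \<in> Ob C" "set As \<subseteq> Ob C" "length fs = length As"
    and "\<And>i. i < length As \<Longrightarrow> fs ! i \<in> Hom C X (As ! i)"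
  shows "\<exists>!h. h \<in> Hom C X (prd C As) \<and> (\<forall>i<length As. prj C As i \<odot> h = fs ! i)"
  using product[OF assms(2)] assms unfolding is_product_def by blast

lemma
  assumes "X \<in> Ob C" "set As \<subseteq> Ob C" "length fs = length As"
    and "\<And>i. i < length As \<Longrightarrow> fs ! i \<in> Hom C X (As ! i)"
  shows tuple_hom: "tuple C X As fs \<in> Hom C X (prd C As)"
    and prj_tuple: "i < length As \<Longrightarrow> prj C As i \<odot> tuple C X As fs = fs ! i"
  using theI'[OF tuple_ex1[OF assms]] unfolding tuple_def by simp_all

text \<open>Joint monicity of the projections, obtained from the uniqueness of the arrow induced by
  the cone of composites of \<open>k\<close>.\<close>

lemma prd_eqI:
  assumes "X \<in> Ob C" "set As \<subseteq> Ob C" and h: "h \<in> Hom C X (prd C As)" "k \<in> Hom C X (prd C As)"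
    and eq: "\<And>i. i < length As \<Longrightarrow> prj C As i \<odot> h = prj C As i \<odot> k"
  shows "h = k"
proof -
  have "\<exists>!h. h \<in> Hom C X (prd C As) \<and> (\<forall>i<length As. prj C As i \<odot> h
      = map (\<lambda>i. prj C As i \<odot> k) [0..<length As] ! i)"
    by (rule tuple_ex1) (use assms in \<open>auto intro!: cmp_in[OF _ _ _ h(2)] prj_hom\<close>)
  then show ?thesis using h eq by auto
qed

text \<open>The typing of the components is recovered from \<open>h\<close>: each component is a
  projection composed with it.\<close>

lemma tuple_unique:
  assumes "X \<in> Ob C" "set As \<subseteq> Ob C" "length fs = length As" "h \<in> Hom C X (prd C As)"
    and "\<And>i. i < length As \<Longrightarrow> prj C As i \<odot> h = fs ! i"
  shows "tuple C X As fs = h"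
proof -
  have fs: "fs ! i \<in> Hom C X (As ! i)" if i: "i < length As" for i
  proof -
    have "As ! i \<in> Ob C" using assms(2) i nth_mem by blast
    then have "prj C As i \<odot> h \<in> Hom C X (As ! i)"
      using cmp_in[OF assms(1) prd_ob[OF assms(2)] _ assms(4) prj_hom[OF assms(2) i]] by blast
    then show ?thesis by (simp only: assms(5)[OF i])
  qed
  show ?thesis
  proof (rule prd_eqI[OF assms(1,2)])
    show "tuple C X As fs \<in> Hom C X (prd C As)" by (rule tuple_hom[OF assms(1-3) fs])
    show "prj C As i \<odot> tuple C X As fs = prj C As i \<odot> h" if "i < length As" for i
      by (simp only: prj_tuple[OF assms(1-3) fs that] assms(5)[OF that])
  qed (rule assms(4))
qed

lemma prod_map_hom:
  assumes "set As \<subseteq> Ob C" "set Bs \<subseteq> Ob C" "length Bs = length As"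
    and "\<And>i. i < length As \<Longrightarrow> fs ! i \<in> Hom C (As ! i) (Bs ! i)"
  shows "prod_map C As Bs fs \<in> Hom C (prd C As) (prd C Bs)"
proof -
  have ob: "As ! k \<in> Ob C" "Bs ! k \<in> Ob C" if "k < length As" for k
    using assms(1-3) that nth_mem[of k As] nth_mem[of k Bs] by auto
  show ?thesis
    unfolding prod_map_def
  proof (rule tuple_hom[OF prd_ob[OF assms(1)] assms(2)])
    fix k assume "k < length Bs"
    then show "map (\<lambda>i. fs ! i \<odot> prj C As i) [0..<length As] ! k \<in> Hom C (prd C As) (Bs ! k)"
      using assms(3) cmp_in[OF prd_ob[OF assms(1)] ob prj_hom[OF assms(1)] assms(4), of k] by simp
  qed (simp add: assms(3))
qed

end

locale fp_stage = fp_category C + stage C Y for C (structure) and Y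
begin

lemma prj_el:
  assumes "set As \<subseteq> Ob C" "i < length As" "x \<in> el (prd C As)"
  shows "prj C As i \<odot> x \<in> el (As ! i)"
proof (rule el_cmp[OF prj_hom[OF assms(1,2)] assms(3) prd_ob[OF assms(1)]])
  show "As ! i \<in> Ob C" using assms(1,2) nth_mem by blast
qed

lemma prj_tuple_el:
  assumes "x \<in> el X" "X \<in> Ob C" "set As \<subseteq> Ob C" "length fs = length As" "i < length As"
    and "\<And>i. i < length As \<Longrightarrow> fs ! i \<in> Hom C X (As ! i)"
  shows "prj C As i \<odot> tuple C X As fs \<odot> x = fs ! i \<odot> x"
proof -
  have "As ! i \<in> Ob C" using assms(3,5) nth_mem by blast
  then show ?thesis
    using el_assoc[OF assms(1) tuple_hom[OF assms(2-4,6)] prj_hom[OF assms(3,5)] assms(2) prd_ob[OF assms(3)]]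
    by (simp only: prj_tuple[OF assms(2-4,6,5)])
qed

lemma tuple_cmp:
  assumes "x \<in> el X" "X \<in> Ob C" "set As \<subseteq> Ob C" "length fs = length As"
    and "\<And>i. i < length As \<Longrightarrow> fs ! i \<in> Hom C X (As ! i)"
  shows "tuple C X As fs \<odot> x = tuple C Y As (map (\<lambda>f. f \<odot> x) fs)"
proof (rule tuple_unique[OF Y, symmetric])
  show "tuple C X As fs \<odot> x \<in> el (prd C As)"
    by (rule el_cmp[OF tuple_hom[OF assms(2-5)] assms(1,2) prd_ob[OF assms(3)]])
  show "prj C As i \<odot> tuple C X As fs \<odot> x = map (\<lambda>f. f \<odot> x) fs ! i" if "i < length As" for i
    using that assms(4) by (simp add: prj_tuple_el[OF assms(1-4) that assms(5)])
qed (simp_all add: assms(3,4))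

lemma prj_prod_map_el:
  assumes "x \<in> el (prd C As)" "set As \<subseteq> Ob C" "set Bs \<subseteq> Ob C" "length Bs = length As" "i < length As"
    and fs: "\<And>i. i < length As \<Longrightarrow> fs ! i \<in> Hom C (As ! i) (Bs ! i)"
  shows "prj C Bs i \<odot> prod_map C As Bs fs \<odot> x = fs ! i \<odot> prj C As i \<odot> x"
proof -
  have ob: "As ! k \<in> Ob C" "Bs ! k \<in> Ob C" if "k < length As" for k
    using assms(2-4) that nth_mem[of k As] nth_mem[of k Bs] by auto
  have *: "map (\<lambda>i. fs ! i \<odot> prj C As i) [0..<length As] ! k \<in> Hom C (prd C As) (Bs ! k)"
    if "k < length Bs" for k
    using that assms(4) cmp_in[OF prd_ob[OF assms(2)] ob prj_hom[OF assms(2)] fs, of k] by simp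
  have "prj C Bs i \<odot> prod_map C As Bs fs \<odot> x
      = map (\<lambda>i. fs ! i \<odot> prj C As i) [0..<length As] ! i \<odot> x"
    unfolding prod_map_def
    by (rule prj_tuple_el[OF assms(1) prd_ob[OF assms(2)] assms(3) _ _ *]) (simp_all add: assms(4,5))
  also have "\<dots> = fs ! i \<odot> prj C As i \<odot> x"
    using assms(5) el_assoc[OF assms(1) prj_hom[OF assms(2,5)] fs[OF assms(5)] prd_ob[OF assms(2)] ob[OF assms(5)]]
    by simp
  finally show ?thesis .
qed

lemma prod_map_el:
  assumes "x \<in> el (prd C As)" "set As \<subseteq> Ob C" "set Bs \<subseteq> Ob C" "length Bs = length As"
    and "\<And>i. i < length As \<Longrightarrow> fs ! i \<in> Hom C (As ! i) (Bs ! i)"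
  shows "prod_map C As Bs fs \<odot> x \<in> el (prd C Bs)"
  by (rule el_cmp[OF prod_map_hom[OF assms(2-5)] assms(1)]) (simp_all add: assms(2,3))

end

lemma (in fp_category) fp_stage: "Y \<in> Ob C \<Longrightarrow> fp_stage C Y"
  by (simp add: fp_stage_def stage fp_category_axioms)

section \<open>Towers\<close>

lemma length_tower [simp]: "length (tower F n) = Suc n"
  by (simp add: tower_def)

lemma nth_tower [simp]: "j \<le> n \<Longrightarrow> tower F n ! j = F (n - j)"
  by (simp add: tower_def rev_nth del: upt_Suc)

lemma set_tower: "set (tower F n) = F ` {..n}"
  unfolding tower_def by (simp del: upt_Suc add: atLeast0LessThan lessThan_Suc_atMost)

lemma map_tower: "map f (tower F n) = tower (\<lambda>k. f (F k)) n"
  by (simp add: tower_def)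

lemma tower_eqI:
  assumes "length xs = Suc n" "\<And>j. j \<le> n \<Longrightarrow> xs ! j = F (n - j)"
  shows "xs = tower F n"
  using assms by (intro nth_equalityI) (auto simp: less_Suc_eq_le)

text \<open>
  The formulas for faces and degeneracies, indexed by the level \<open>k\<close> of an entry instead of its
  position \<open>n - k\<close>.
\<close>

lemma shift_face_tower:
  assumes "i \<le> Suc n"
  shows "shift_face C X (Suc n) i = tuple C (prd C (tower (lev X) (Suc n))) (tower (lev X) n)
    (tower (\<lambda>k. if k + i \<le> n then entry C X (Suc n) k
      else face X (Suc k) (k + i - n) \<odot>\<^bsub>C\<^esub> entry C X (Suc n) (Suc k)) n)"
proof -
  have "map (\<lambda>j. face X (Suc n - j) (i - j) \<odot>\<^bsub>C\<^esub> entry C X (Suc n) (Suc n - j)) [0..<i]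
      @ map (entry C X (Suc n)) (rev [0..<Suc n - i])
    = tower (\<lambda>k. if k + i \<le> n then entry C X (Suc n) k
      else face X (Suc k) (k + i - n) \<odot>\<^bsub>C\<^esub> entry C X (Suc n) (Suc k)) n"
    by (rule tower_eqI) (use assms in \<open>auto simp: nth_append rev_nth Suc_diff_le simp del: upt_Suc\<close>)
  then show ?thesis by (simp add: shift_face_def Let_def)
qed

text \<open>The old entry of level \<open>n - i\<close> occurs twice: unchanged at the last level of
  the first case, and under s_0 one level higher. In the second case \<open>k\<close> is positive,
  because \<open>i \<le> n < k + i\<close>, so \<open>k - 1\<close> is not truncated.\<close>

lemma shift_degen_tower:
  assumes "i \<le> n"
  shows "shift_degen C X n i = tuple C (prd C (tower (lev X) n)) (tower (lev X) (Suc n))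
    (tower (\<lambda>k. if k + i \<le> n then entry C X n k
      else degen X (k - 1) (k + i - Suc n) \<odot>\<^bsub>C\<^esub> entry C X n (k - 1)) (Suc n))"
proof -
  have "map (\<lambda>j. degen X (n - j) (i - j) \<odot>\<^bsub>C\<^esub> entry C X n (n - j)) [0..<i + 1]
       @ map (entry C X n) (rev [0..<n - i + 1])
    = tower (\<lambda>k. if k + i \<le> n then entry C X n k
      else degen X (k - 1) (k + i - Suc n) \<odot>\<^bsub>C\<^esub> entry C X n (k - 1)) (Suc n)"
    by (rule tower_eqI) (use assms in \<open>auto simp: nth_append rev_nth Suc_diff_le simp del: upt_Suc\<close>)
  then show ?thesis by (simp only: shift_degen_def Let_def Suc_eq_plus1)
qed

locale fp_simplicial_stage = fp_stage C Y + simplicial_stage C Y X for C (structure) and Y X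
begin

abbreviation "L \<equiv> lev X"
abbreviation P where "P n \<equiv> prd C (tower L n)"
abbreviation e where "e \<equiv> entry C X"

lemma tower_ob [simp]: "set (tower L n) \<subseteq> Ob C"
  by (auto simp: set_tower)

lemma entry_hom [simp]: "k \<le> n \<Longrightarrow> e n k \<in> Hom C (P n) (L k)"
  using prj_hom[of "tower L n" "n - k"] by (simp add: entry_def)

lemma entry_el [simp]: "\<lbrakk>k \<le> n; x \<in> el (P n)\<rbrakk> \<Longrightarrow> e n k \<odot> x \<in> el (L k)"
  by (rule el_cmp[OF entry_hom]) simp_all

lemma tower_el_eqI:
  assumes "x \<in> el (P n)" "y \<in> el (P n)" "\<And>k. k \<le> n \<Longrightarrow> e n k \<odot> x = e n k \<odot> y"
  shows "x = y"
proof (rule prd_eqI[OF Y _ assms(1,2)])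
  fix i assume "i < length (tower L n)"
  then show "prj C (tower L n) i \<odot> x = prj C (tower L n) i \<odot> y"
    using assms(3)[of "n - i"] by (simp add: entry_def)
qed simp

lemma tower_tuple_hom:
  assumes "Z \<in> Ob C" "\<And>k. k \<le> n \<Longrightarrow> F k \<in> Hom C Z (L k)"
  shows "tuple C Z (tower L n) (tower F n) \<in> Hom C Z (P n)"
  using assms by (intro tuple_hom) (simp_all add: less_Suc_eq_le)

lemma entry_tower_tuple:
  assumes "x \<in> el Z" "Z \<in> Ob C" "\<And>k. k \<le> n \<Longrightarrow> F k \<in> Hom C Z (L k)" "k \<le> n"
  shows "e n k \<odot> tuple C Z (tower L n) (tower F n) \<odot> x = F k \<odot> x"
  unfolding entry_def using prj_tuple_el[OF assms(1,2), of "tower L n" "tower F n" "n - k"] assms(3,4)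
  by (simp add: less_Suc_eq_le)

lemma shift_face_hom [simp]: "i \<le> Suc n \<Longrightarrow> shift_face C X (Suc n) i \<in> Hom C (P (Suc n)) (P n)"
  unfolding shift_face_tower by (rule tower_tuple_hom) (auto intro!: cmp_in[OF _ _ _ entry_hom])

lemma shift_degen_hom [simp]: "i \<le> n \<Longrightarrow> shift_degen C X n i \<in> Hom C (P n) (P (Suc n))"
  unfolding shift_degen_tower
  apply (rule tower_tuple_hom)
  subgoal by simp
  subgoal for k by (cases k) (auto intro!: cmp_in[OF _ _ _ entry_hom])
  done

lemma shift_face_el [simp]:
  "\<lbrakk>i \<le> Suc n; x \<in> el (P (Suc n))\<rbrakk> \<Longrightarrow> shift_face C X (Suc n) i \<odot> x \<in> el (P n)"
  by (rule el_cmp[OF shift_face_hom]) simp_all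

lemma shift_degen_el [simp]:
  "\<lbrakk>i \<le> n; x \<in> el (P n)\<rbrakk> \<Longrightarrow> shift_degen C X n i \<odot> x \<in> el (P (Suc n))"
  by (rule el_cmp[OF shift_degen_hom]) simp_all

text \<open>Level \<open>k\<close> of the result stands in position \<open>n - k\<close>. Positions
  from \<open>i\<close> on hold entries that keep their level; an earlier position receives its
  entry from level \<open>Suc k\<close> through the face with index
  \<open>i - (n - k)\<close>.\<close>

lemma entry_shift_face [simp]:
  assumes i: "i \<le> Suc n" and k: "k \<le> n" and x: "x \<in> el (P (Suc n))"
  shows "e n k \<odot> shift_face C X (Suc n) i \<odot> x = (if k + i \<le> n then e (Suc n) k \<odot> x
    else face X (Suc k) (k + i - n) \<odot> e (Suc n) (Suc k) \<odot> x)"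
  unfolding shift_face_tower[OF i] using i k x
  by (subst entry_tower_tuple)
    (auto simp: el_assoc[OF x entry_hom face_hom] intro!: cmp_in[OF _ _ _ entry_hom])

lemma entry_shift_degen:
  assumes i: "i \<le> n" and k: "k \<le> Suc n" and x: "x \<in> el (P n)"
  shows "e (Suc n) k \<odot> shift_degen C X n i \<odot> x = (if k + i \<le> n then e n k \<odot> x
    else degen X (k - 1) (k + i - Suc n) \<odot> e n (k - 1) \<odot> x)"
proof -
  have *: "(if l + i \<le> n then e n l
      else degen X (l - 1) (l + i - Suc n) \<odot> e n (l - 1)) \<in> Hom C (P n) (L l)"
    if "l \<le> Suc n" for l
    using that i by (cases l) (auto intro!: cmp_in[OF _ _ _ entry_hom])
  show ?thesis
    unfolding shift_degen_tower[OF i] using i k x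
    by (cases k) (auto simp: entry_tower_tuple[OF x prd_ob[OF tower_ob] *]
      el_assoc[OF x entry_hom degen_hom] simp del: One_nat_def)
qed

lemma entry_shift_degen_0 [simp]:
  "\<lbrakk>i \<le> n; x \<in> el (P n)\<rbrakk> \<Longrightarrow> e (Suc n) 0 \<odot> shift_degen C X n i \<odot> x = e n 0 \<odot> x"
  by (simp add: entry_shift_degen)

text \<open>Splitting the general formula into level 0 and successor levels removes
  \<open>k - 1\<close>; the bound \<open>Suc k + i \<le> n\<close> appears as
  \<open>k + i < n\<close>.\<close>

lemma entry_shift_degen_Suc [simp]:
  "\<lbrakk>i \<le> n; k \<le> n; x \<in> el (P n)\<rbrakk> \<Longrightarrow> e (Suc n) (Suc k) \<odot> shift_degen C X n i \<odot> x
    = (if k + i < n then e n (Suc k) \<odot> x else degen X k (k + i - n) \<odot> e n k \<odot> x)"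
  by (simp add: entry_shift_degen Suc_le_eq)

text \<open>At level \<open>k\<close> the two sides apply no face, one face or two faces to an entry
  of \<open>x\<close>. Only the last case uses an identity of \<open>X\<close>, the same one with
  both indices lowered by \<open>n - k\<close>; the other identities below follow the same
  pattern.\<close>

lemma shift_face_shift_face:
  "\<lbrakk>i \<le> j; j \<le> Suc n; x \<in> el (P (Suc (Suc n)))\<rbrakk>
    \<Longrightarrow> shift_face C X (Suc n) i \<odot> shift_face C X (Suc (Suc n)) (Suc j) \<odot> x
      = shift_face C X (Suc n) j \<odot> shift_face C X (Suc (Suc n)) i \<odot> x"
  by (rule tower_el_eqI[of _ n]) (simp_all add: face_face Suc_diff_le)

lemma shift_degen_shift_degen:
  assumes "i \<le> j" "j \<le> n" "x \<in> el (P n)"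
  shows "shift_degen C X (Suc n) i \<odot> shift_degen C X n j \<odot> x
    = shift_degen C X (Suc n) (Suc j) \<odot> shift_degen C X n i \<odot> x" (is "?l = ?r")
proof (rule tower_el_eqI[of _ "Suc (Suc n)"])
  fix k assume "k \<le> Suc (Suc n)"
  with assms show "e (Suc (Suc n)) k \<odot> ?l = e (Suc (Suc n)) k \<odot> ?r"
    by (cases k; cases "k - 1") (auto simp: degen_degen Suc_diff_le)
qed (use assms in simp_all)

lemma shift_face_shift_degen_less:
  assumes "i \<le> j" "j \<le> n" "x \<in> el (P (Suc n))"
  shows "shift_face C X (Suc (Suc n)) i \<odot> shift_degen C X (Suc n) (Suc j) \<odot> x
    = shift_degen C X n j \<odot> shift_face C X (Suc n) i \<odot> x" (is "?l = ?r")
proof (rule tower_el_eqI[of _ "Suc n"])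
  fix k assume "k \<le> Suc n"
  with assms show "e (Suc n) k \<odot> ?l = e (Suc n) k \<odot> ?r"
    by (cases k) (auto simp: face_degen_less Suc_diff_le)
qed (use assms in simp_all)

text \<open>Levels with \<open>k + j \<le> n\<close> form the untouched tail. Above them an entry is
  degenerated and then faced, both with index \<open>k + j - n\<close>.\<close>

lemma shift_face_shift_degen_same:
  assumes "j \<le> n" "x \<in> el (P n)"
  shows "shift_face C X (Suc n) j \<odot> shift_degen C X n j \<odot> x = x" (is "?l = ?r")
proof (rule tower_el_eqI[of _ n])
  fix k assume "k \<le> n"
  with assms show "e n k \<odot> ?l = e n k \<odot> ?r"
    by (cases k) (auto simp: face_degen_same Suc_diff_le)
qed (use assms in simp_all)

lemma shift_face_shift_degen_Suc:
  assumes "j \<le> n" "x \<in> el (P n)"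
  shows "shift_face C X (Suc n) (Suc j) \<odot> shift_degen C X n j \<odot> x = x" (is "?l = ?r")
proof (rule tower_el_eqI[of _ n])
  fix k assume "k \<le> n"
  with assms show "e n k \<odot> ?l = e n k \<odot> ?r"
    by (cases k) (auto simp: face_degen_Suc Suc_diff_le)
qed (use assms in simp_all)

lemma shift_face_shift_degen_greater:
  assumes "j < i" "i \<le> Suc n" "x \<in> el (P (Suc n))"
  shows "shift_face C X (Suc (Suc n)) (Suc i) \<odot> shift_degen C X (Suc n) j \<odot> x
    = shift_degen C X n j \<odot> shift_face C X (Suc n) i \<odot> x" (is "?l = ?r")
proof (rule tower_el_eqI[of _ "Suc n"])
  fix k assume "k \<le> Suc n"
  with assms show "e (Suc n) k \<odot> ?l = e (Suc n) k \<odot> ?r"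
    by (cases k) (auto simp: face_degen_greater Suc_diff_le)
qed (use assms in simp_all)

end

section \<open>The shift monad\<close>

definition shift_funct ::
  "('o, 'm, 'z) fpcat_scheme
    \<Rightarrow> (('o, 'm) sobj, nat \<Rightarrow> 'm, ('o, 'm) sobj, nat \<Rightarrow> 'm) funct" where
  "shift_funct C = \<lparr>
    fob = (\<lambda>X. mk_sobj (\<lambda>n. prd C (tower (lev X) n)) (shift_face C X) (shift_degen C X)),
    fmap = tower_map C\<rparr>"

abbreviation shift_obj :: "('o, 'm, 'z) fpcat_scheme \<Rightarrow> ('o, 'm) sobj \<Rightarrow> ('o, 'm) sobj" where
  "shift_obj C \<equiv> fob (shift_funct C)"

lemma shift_obj_sel [simp]:
  "lev (shift_obj C X) n = prd C (tower (lev X) n)"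
  "i \<le> Suc n \<Longrightarrow> face (shift_obj C X) (Suc n) i = shift_face C X (Suc n) i"
  "i \<le> n \<Longrightarrow> degen (shift_obj C X) n i = shift_degen C X n i"
  by (simp_all add: shift_funct_def)

text \<open>\<open>n\<close> is the starting level and \<open>m\<close> the number of steps, so the
  next zeroth face is taken at level \<open>n - m\<close>; the values are meaningful for
  \<open>m \<le> n\<close>.\<close>

primrec face0_pow :: "('o, 'm, 'z) cat_scheme \<Rightarrow> ('o, 'm) sobj \<Rightarrow> nat \<Rightarrow> nat \<Rightarrow> 'm" where
  "face0_pow C X n 0 = Idn C (lev X n)"
| "face0_pow C X n (Suc m) = face X (n - m) 0 \<odot>\<^bsub>C\<^esub> face0_pow C X n m"

text \<open>\<open>g \<mapsto> (g, d\<^sub>0 g, d\<^sub>0\<^sup>2 g, \<dots>)\<close>\<close>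

definition shift_unit :: "('o, 'm, 'z) fpcat_scheme \<Rightarrow> ('o, 'm) sobj \<Rightarrow> nat \<Rightarrow> 'm" where
  "shift_unit C X n
    = tuple C (lev X n) (tower (lev X) n) (tower (\<lambda>k. face0_pow C X n (n - k)) n)"

definition shift_mult :: "('o, 'm, 'z) fpcat_scheme \<Rightarrow> ('o, 'm) sobj \<Rightarrow> nat \<Rightarrow> 'm" where
  "shift_mult C X n = tuple C (prd C (tower (lev (shift_obj C X)) n)) (tower (lev X) n)
    (tower (\<lambda>k. entry C X k k \<odot>\<^bsub>C\<^esub> entry C (shift_obj C X) n k) n)"

lemma (in fp_category) fp_simplicial_stage:
  "\<lbrakk>Y \<in> Ob C; simplicial_object C X\<rbrakk> \<Longrightarrow> fp_simplicial_stage C Y X"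
  by (simp add: fp_simplicial_stage_def fp_stage simplicial_stage)

lemma (in category) face0_pow_hom:
  assumes X: "simplicial_object C X"
  shows "m \<le> n \<Longrightarrow> face0_pow C X n m \<in> Hom C (lev X n) (lev X (n - m))"
proof (induction m)
  case 0
  show ?case using simplicial_objectD(1)[OF X] by (simp add: idn_in)
next
  case (Suc m)
  then have n: "n - m = Suc (n - Suc m)" by simp
  show ?case
    using Suc simplicial_objectD(2)[OF X, of 0 "n - Suc m"]
    by (auto simp: n intro!: cmp_in[OF _ _ _ Suc.IH] simplicial_objectD(1)[OF X])
qed

section \<open>Iterated zeroth faces\<close>

context simplicial_stage
begin

abbreviation d0_to where "d0_to n k \<equiv> face0_pow C X n (n - k)"

lemma d0_to_hom: "k \<le> n \<Longrightarrow> d0_to n k \<in> Hom C (lev X n) (lev X k)"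
  using face0_pow_hom[OF X, of "n - k" n] by simp

lemma d0_to_el [simp]: "\<lbrakk>k \<le> n; x \<in> el (lev X n)\<rbrakk> \<Longrightarrow> d0_to n k \<odot> x \<in> el (lev X k)"
  by (rule el_cmp[OF d0_to_hom]) simp_all

lemma idn_el [simp]: "x \<in> el (lev X n) \<Longrightarrow> Idn C (lev X n) \<odot> x = x"
  by (rule idn_cmp[OF Y lev_ob])

lemma d0_to_less:
  assumes "k < n" "x \<in> el (lev X n)"
  shows "d0_to n k \<odot> x = face X (Suc k) 0 \<odot> d0_to n (Suc k) \<odot> x"
proof -
  have n: "n - k = Suc (n - Suc k)" "n - (n - Suc k) = Suc k" using assms by simp_all
  have "Suc k \<le> n" using assms by simp
  then show ?thesis unfolding n(1) face0_pow.simps n(2)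
    using el_assoc[OF assms(2) d0_to_hom[of "Suc k" n] face_hom[of 0 k]] by simp
qed

text \<open>Compatibility of the unit with faces, read at level \<open>k\<close>; the right-hand
  side has the shape of \<open>entry_shift_face\<close>. Moving d_0 across a face of positive index
  lowers that index by one, and once the index is 0 the face is one more d_0.\<close>

lemma d0_to_face:
  assumes "k \<le> n" "i \<le> Suc n" "x \<in> el (lev X (Suc n))"
  shows "d0_to n k \<odot> face X (Suc n) i \<odot> x = (if k + i \<le> n then d0_to (Suc n) k \<odot> x
    else face X (Suc k) (k + i - n) \<odot> d0_to (Suc n) (Suc k) \<odot> x)"
  using assms(1)
proof (induction rule: inc_induct)
  case base
  then show ?case using assms d0_to_less[of n "Suc n" x] by (cases i) (simp_all del: face0_pow.simps(2))
next
  case (step k)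
  have "d0_to n k \<odot> face X (Suc n) i \<odot> x = face X (Suc k) 0 \<odot> d0_to n (Suc k) \<odot> face X (Suc n) i \<odot> x"
    using step assms by (intro d0_to_less) simp_all
  moreover have "d0_to (Suc n) k \<odot> x = face X (Suc k) 0 \<odot> d0_to (Suc n) (Suc k) \<odot> x"
    "d0_to (Suc n) (Suc k) \<odot> x = face X (Suc (Suc k)) 0 \<odot> d0_to (Suc n) (Suc (Suc k)) \<odot> x"
    using step assms by (intro d0_to_less; simp)+
  moreover have "face X (Suc k) 0 \<odot> face X (Suc (Suc k)) (Suc (k + i - n)) \<odot> d0_to (Suc n) (Suc (Suc k)) \<odot> x
    = face X (Suc k) (k + i - n) \<odot> face X (Suc (Suc k)) 0 \<odot> d0_to (Suc n) (Suc (Suc k)) \<odot> x"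
    using step assms by (intro face_face d0_to_el) simp_all
  ultimately show ?case
    using step assms by (cases "k + i = n") (simp_all add: Suc_diff_le)
qed

text \<open>The counterpart for degeneracies, in the shape of \<open>entry_shift_degen\<close>: each
  d_0 lowers the index of the degeneracy until it meets s_0 and cancels it.\<close>

lemma d0_to_degen:
  assumes "k \<le> Suc n" "i \<le> n" "x \<in> el (lev X n)"
  shows "d0_to (Suc n) k \<odot> degen X n i \<odot> x = (if k + i \<le> n then d0_to n k \<odot> x
    else degen X (k - 1) (k + i - Suc n) \<odot> d0_to n (k - 1) \<odot> x)"
  using assms(1)
proof (induction rule: inc_induct)
  case base
  then show ?case using assms by simp
next
  case (step k)
  then have k: "k \<le> n" by simp
  have rec: "d0_to (Suc n) k \<odot> degen X n i \<odot> x = face X (Suc k) 0 \<odot> d0_to (Suc n) (Suc k) \<odot> degen X n i \<odot> x"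
    using step assms by (intro d0_to_less) simp_all
  consider "Suc k + i \<le> n" | "k + i = n" | "n < k + i" by linarith
  then show ?case
  proof cases
    case 1
    then have "d0_to n k \<odot> x = face X (Suc k) 0 \<odot> d0_to n (Suc k) \<odot> x"
      using assms by (intro d0_to_less) simp_all
    with 1 show ?thesis unfolding rec step.IH by simp
  next
    case 2
    \<comment> \<open>The index of the degeneracy has just come down to 0, and the next d_0 removes
      it.\<close>
    then show ?thesis unfolding rec step.IH using k assms by (simp add: face_degen_same)
  next
    case 3
    then obtain m where m: "k = Suc m" using assms by (cases k) simp_all
    with 3 have *: "Suc m - 1 = m" "k + i - n = Suc (m + i - n)" by simp_all
    have "face X (Suc k) 0 \<odot> degen X k (Suc (m + i - n)) \<odot> d0_to n k \<odot> x
      = degen X m (m + i - n) \<odot> face X (Suc m) 0 \<odot> d0_to n k \<odot> x"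
      unfolding m using 3 k m assms by (intro face_degen_less) simp_all
    moreover have "d0_to n m \<odot> x = face X (Suc m) 0 \<odot> d0_to n k \<odot> x"
      unfolding m using k m assms by (intro d0_to_less) simp_all
    ultimately show ?thesis unfolding rec step.IH using 3 k m by (simp add: Suc_diff_le)
  qed
qed

lemma d0_to_natural:
  assumes f: "f \<in> Hom (simplicial C) X X'" and X': "simplicial_object C X'"
    and "k \<le> n" "x \<in> el (lev X n)"
  shows "f k \<odot> d0_to n k \<odot> x = face0_pow C X' n (n - k) \<odot> f n \<odot> x"
  using assms(3)
proof (induction rule: inc_induct)
  interpret X': simplicial_stage C Y X' by (rule simplicial_stage[OF Y X'])
  note fel = simplicial_hom_el[OF f X X']
  case base
  then show ?case using assms fel(1) by simp
next
  interpret X': simplicial_stage C Y X' by (rule simplicial_stage[OF Y X'])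
  note fel = simplicial_hom_el[OF f X X']
  case (step k)
  have "f k \<odot> d0_to n k \<odot> x = f k \<odot> face X (Suc k) 0 \<odot> d0_to n (Suc k) \<odot> x"
    using d0_to_less step assms by simp
  also have "\<dots> = face X' (Suc k) 0 \<odot> f (Suc k) \<odot> d0_to n (Suc k) \<odot> x"
    using step assms by (intro fel(2)) simp_all
  also have "\<dots> = face0_pow C X' n (n - k) \<odot> f n \<odot> x"
    using step assms X'.d0_to_less[of k n "f n \<odot> x"] fel(1) by simp
  finally show ?case .
qed

end

context fp_category
begin

lemma simplicial_shift_obj:
  assumes X: "simplicial_object C X"
  shows "simplicial_object C (shift_obj C X)"
proof -
  have st: "fp_simplicial_stage C Y X" if "Y \<in> Ob C" for Y
    using that X by (rule fp_simplicial_stage)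
  \<comment> \<open>The typing facts do not mention a stage, but the locale requires one;
    \<open>lev X 0\<close> is an object at hand.\<close>
  note st0 = st[OF simplicial_objectD(1)[OF X, of 0]]
  show ?thesis
    unfolding shift_funct_def funct.simps
    by (rule mk_sobj_simplicial)
      (simp_all add: prd_ob[OF fp_simplicial_stage.tower_ob[OF st0]]
        fp_simplicial_stage.shift_face_hom[OF st0] fp_simplicial_stage.shift_degen_hom[OF st0]
        fp_simplicial_stage.shift_face_shift_face[OF st] fp_simplicial_stage.shift_degen_shift_degen[OF st]
        fp_simplicial_stage.shift_face_shift_degen_less[OF st]
        fp_simplicial_stage.shift_face_shift_degen_same[OF st]
        fp_simplicial_stage.shift_face_shift_degen_Suc[OF st]
        fp_simplicial_stage.shift_face_shift_degen_greater[OF st])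
qed

end

section \<open>Unit, multiplication and action on maps, entry by entry\<close>

context fp_simplicial_stage
begin

lemma tower_map_hom:
  assumes X': "\<And>n. lev X' n \<in> Ob C" and f: "\<And>n. f n \<in> Hom C (L n) (lev X' n)"
  shows "tower_map C X X' f n \<in> Hom C (P n) (prd C (tower (lev X') n))"
  unfolding tower_map_def using X' f
  by (intro prod_map_hom) (auto simp: set_tower less_Suc_eq_le)

lemma tower_map_el:
  assumes X': "\<And>n. lev X' n \<in> Ob C" and f: "\<And>n. f n \<in> Hom C (L n) (lev X' n)" and x: "x \<in> el (P n)"
  shows "tower_map C X X' f n \<odot> x \<in> el (prd C (tower (lev X') n))"
  using X' by (intro el_cmp[OF tower_map_hom[OF X' f] x] prd_ob) (auto simp: set_tower)

lemma entry_tower_map: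
  assumes X': "\<And>n. lev X' n \<in> Ob C" and f: "\<And>n. f n \<in> Hom C (L n) (lev X' n)"
    and x: "x \<in> el (P n)" and k: "k \<le> n"
  shows "entry C X' n k \<odot> tower_map C X X' f n \<odot> x = f k \<odot> e n k \<odot> x"
proof -
  have "entry C X' n k \<odot> tower_map C X X' f n \<odot> x
    = tower f n ! (n - k) \<odot> prj C (tower L n) (n - k) \<odot> x"
    unfolding entry_def tower_map_def
    by (rule prj_prod_map_el[OF x]) (use X' f in \<open>auto simp: set_tower less_Suc_eq_le\<close>)
  then show ?thesis using k by (simp add: entry_def)
qed

lemma shift_unit_hom: "shift_unit C X n \<in> Hom C (L n) (P n)"
  unfolding shift_unit_def by (rule tower_tuple_hom) (simp_all add: d0_to_hom)

lemma shift_unit_el [simp]: "x \<in> el (L n) \<Longrightarrow> shift_unit C X n \<odot> x \<in> el (P n)"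
  by (rule el_cmp[OF shift_unit_hom]) simp_all

lemma entry_shift_unit [simp]:
  "\<lbrakk>x \<in> el (L n); k \<le> n\<rbrakk> \<Longrightarrow> e n k \<odot> shift_unit C X n \<odot> x = d0_to n k \<odot> x"
  unfolding shift_unit_def by (rule entry_tower_tuple) (simp_all add: d0_to_hom)

interpretation Sh: fp_simplicial_stage C Y "shift_obj C X"
  by (rule fp_simplicial_stage[OF Y simplicial_shift_obj[OF X]])

lemma top_entry_hom: "k \<le> n \<Longrightarrow> e k k \<odot> Sh.e n k \<in> Hom C (Sh.P n) (L k)"
  using entry_hom[of k k] Sh.entry_hom[of k n] by (intro cmp_in[OF _ _ _ Sh.entry_hom]) simp_all

lemma shift_mult_hom: "shift_mult C X n \<in> Hom C (Sh.P n) (P n)"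
  unfolding shift_mult_def by (rule tower_tuple_hom) (simp_all only: top_entry_hom prd_ob Sh.tower_ob)

lemma shift_mult_el [simp]: "x \<in> el (Sh.P n) \<Longrightarrow> shift_mult C X n \<odot> x \<in> el (P n)"
  by (rule el_cmp[OF shift_mult_hom]) simp_all

lemma entry_shift_mult [simp]:
  assumes x: "x \<in> el (Sh.P n)" and k: "k \<le> n"
  shows "e n k \<odot> shift_mult C X n \<odot> x = e k k \<odot> Sh.e n k \<odot> x"
proof -
  have "e n k \<odot> shift_mult C X n \<odot> x = (e k k \<odot> Sh.e n k) \<odot> x"
    unfolding shift_mult_def
    by (rule entry_tower_tuple[OF x _ _ k]) (simp_all only: top_entry_hom prd_ob Sh.tower_ob)
  then show ?thesis
    using el_assoc[OF x Sh.entry_hom[OF k], of "e k k" "L k"] k by simp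
qed

text \<open>In the shifted object d_0 deletes the leading entry, so its iterates truncate a tower
  and keep the remaining entries. This is why the multiplication undoes the unit taken at
  \<open>shift_obj C X\<close>.\<close>

lemma entry_Sh_d0_to:
  assumes "k \<le> n" "j \<le> k" "x \<in> el (P n)"
  shows "e k j \<odot> Sh.d0_to n k \<odot> x = e n j \<odot> x"
  using assms(1,2)
proof (induction rule: inc_induct)
  case base
  then show ?case using assms(3) Sh.idn_el[of x n] by simp
next
  case (step k)
  then show ?case using assms(3) Sh.d0_to_less[of k n x] Sh.d0_to_el[of "Suc k" n x] by simp
qed

end

section \<open>The shift functor and its monad structure\<close>

context fp_category
begin

lemma shift_unit_simplicial:
  assumes X: "simplicial_object C X"
  shows "shift_unit C X \<in> Hom (simplicial C) X (shift_obj C X)"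
proof (rule simplicial_homI[OF X simplicial_shift_obj[OF X]])
  fix n
  interpret fp_simplicial_stage C "lev X n" X
    by (rule fp_simplicial_stage[OF simplicial_objectD(1)[OF X] X])
  show "shift_unit C X n \<in> Hom C (lev X n) (lev (shift_obj C X) n)"
    by (simp add: shift_unit_hom)
next
  fix Y x n and i :: nat assume a: "Y \<in> Ob C" "x \<in> Hom C Y (lev X (Suc n))" "i \<le> Suc n"
  interpret fp_simplicial_stage C Y X by (rule fp_simplicial_stage[OF a(1) X])
  interpret Sh: fp_simplicial_stage C Y "shift_obj C X"
    by (rule fp_simplicial_stage[OF a(1) simplicial_shift_obj[OF X]])
  show "shift_unit C X n \<odot> face X (Suc n) i \<odot> x
      = face (shift_obj C X) (Suc n) i \<odot> shift_unit C X (Suc n) \<odot> x"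
    by (rule tower_el_eqI[of _ n]) (use a in \<open>simp_all add: d0_to_face del: face0_pow.simps\<close>)
next
  fix Y x n and i :: nat assume a: "Y \<in> Ob C" "x \<in> Hom C Y (lev X n)" "i \<le> n"
  interpret fp_simplicial_stage C Y X by (rule fp_simplicial_stage[OF a(1) X])
  interpret Sh: fp_simplicial_stage C Y "shift_obj C X"
    by (rule fp_simplicial_stage[OF a(1) simplicial_shift_obj[OF X]])
  show "shift_unit C X (Suc n) \<odot> degen X n i \<odot> x
      = degen (shift_obj C X) n i \<odot> shift_unit C X n \<odot> x" (is "?l = ?r")
  proof (rule tower_el_eqI[of _ "Suc n"])
    fix k assume "k \<le> Suc n"
    with a show "e (Suc n) k \<odot> ?l = e (Suc n) k \<odot> ?r"
      by (simp add: d0_to_degen entry_shift_degen del: face0_pow.simps)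
  qed (use a in simp_all)
qed

lemma shift_mult_simplicial:
  assumes X: "simplicial_object C X"
  shows "shift_mult C X \<in> Hom (simplicial C) (shift_obj C (shift_obj C X)) (shift_obj C X)"
proof (rule simplicial_homI[OF simplicial_shift_obj[OF simplicial_shift_obj[OF X]] simplicial_shift_obj[OF X]])
  fix n
  interpret fp_simplicial_stage C "lev X n" X
    by (rule fp_simplicial_stage[OF simplicial_objectD(1)[OF X] X])
  show "shift_mult C X n \<in> Hom C (lev (shift_obj C (shift_obj C X)) n) (lev (shift_obj C X) n)"
    by (simp add: shift_mult_hom)
next
  fix Y x n and i :: nat
  assume a: "Y \<in> Ob C" "x \<in> Hom C Y (lev (shift_obj C (shift_obj C X)) (Suc n))" "i \<le> Suc n"
  interpret fp_simplicial_stage C Y X by (rule fp_simplicial_stage[OF a(1) X])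
  interpret Sh: fp_simplicial_stage C Y "shift_obj C X"
    by (rule fp_simplicial_stage[OF a(1) simplicial_shift_obj[OF X]])
  have x: "x \<in> el (Sh.P (Suc n))" using a(2) by simp
  show "shift_mult C X n \<odot> face (shift_obj C (shift_obj C X)) (Suc n) i \<odot> x
      = face (shift_obj C X) (Suc n) i \<odot> shift_mult C X (Suc n) \<odot> x" (is "?l = ?r")
  proof (rule tower_el_eqI[of _ n])
    fix k assume k: "k \<le> n"
    show "e n k \<odot> ?l = e n k \<odot> ?r"
    proof (cases "k + i \<le> n")
      case False
      \<comment> \<open>The inner face has index \<open>k + i - n\<close>, which is positive here,
        so it acts on the leading entry of the tower of level \<open>Suc k\<close> instead of
        dropping it.\<close>
      then have "\<not> k + (k + i) - n \<le> k" by linarith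
      with False show ?thesis using a(3) x k Sh.entry_el[of "Suc k" "Suc n" x] by simp
    qed (use a(3) x k in simp)
  qed (use a(3) x in simp_all)
next
  fix Y x n and i :: nat
  assume a: "Y \<in> Ob C" "x \<in> Hom C Y (lev (shift_obj C (shift_obj C X)) n)" "i \<le> n"
  interpret fp_simplicial_stage C Y X by (rule fp_simplicial_stage[OF a(1) X])
  interpret Sh: fp_simplicial_stage C Y "shift_obj C X"
    by (rule fp_simplicial_stage[OF a(1) simplicial_shift_obj[OF X]])
  have x: "x \<in> el (Sh.P n)" using a(2) by simp
  show "shift_mult C X (Suc n) \<odot> degen (shift_obj C (shift_obj C X)) n i \<odot> x
      = degen (shift_obj C X) n i \<odot> shift_mult C X n \<odot> x" (is "?l = ?r")
  proof (rule tower_el_eqI[of _ "Suc n"])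
    fix k assume k: "k \<le> Suc n"
    show "e (Suc n) k \<odot> ?l = e (Suc n) k \<odot> ?r"
    proof (cases k)
      case 0
      then show ?thesis using a(3) x by simp
    next
      case (Suc m)
      show ?thesis
      proof (cases "m + i < n")
        case False
        \<comment> \<open>Whatever the index \<open>m + i - n\<close> of the inner degeneracy is,
          the new leading entry at level \<open>Suc m\<close> is a degeneracy of the old leading
          entry at level \<open>m\<close>.\<close>
        then have "\<not> m + (m + i) - n < m" by linarith
        with False Suc show ?thesis using a(3) x k Sh.entry_el[of m n x] by simp
      qed (use Suc a(3) x k in simp)
    qed
  qed (use a(3) x in simp_all)
qed

lemma tower_map_simplicial:
  assumes X: "simplicial_object C X" and X': "simplicial_object C X'"
    and f: "f \<in> Hom (simplicial C) X X'"
  shows "tower_map C X X' f \<in> Hom (simplicial C) (shift_obj C X) (shift_obj C X')"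
proof (rule simplicial_homI[OF simplicial_shift_obj[OF X] simplicial_shift_obj[OF X']])
  note ob' = simplicial_objectD(1)[OF X'] and fh = simplicial_homD(1)[OF f]
  {
    fix n
    interpret fp_simplicial_stage C "lev X n" X
      by (rule fp_simplicial_stage[OF simplicial_objectD(1)[OF X] X])
    show "tower_map C X X' f n \<in> Hom C (lev (shift_obj C X) n) (lev (shift_obj C X') n)"
      by (simp add: tower_map_hom[OF ob' fh])
  next
    fix Y x n and i :: nat
    assume a: "Y \<in> Ob C" "x \<in> Hom C Y (lev (shift_obj C X) (Suc n))" "i \<le> Suc n"
    interpret fp_simplicial_stage C Y X by (rule fp_simplicial_stage[OF a(1) X])
    interpret Sh: fp_simplicial_stage C Y "shift_obj C X"
      by (rule fp_simplicial_stage[OF a(1) simplicial_shift_obj[OF X]])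
    interpret X': fp_simplicial_stage C Y X' by (rule fp_simplicial_stage[OF a(1) X'])
    note [simp] = entry_tower_map[OF ob' fh] tower_map_el[OF ob' fh] simplicial_hom_el[OF f X X']
    show "tower_map C X X' f n \<odot> face (shift_obj C X) (Suc n) i \<odot> x
        = face (shift_obj C X') (Suc n) i \<odot> tower_map C X X' f (Suc n) \<odot> x"
      by (rule X'.tower_el_eqI[of _ n]) (use a in simp_all)
  next
    fix Y x n and i :: nat
    assume a: "Y \<in> Ob C" "x \<in> Hom C Y (lev (shift_obj C X) n)" "i \<le> n"
    interpret fp_simplicial_stage C Y X by (rule fp_simplicial_stage[OF a(1) X])
    interpret Sh: fp_simplicial_stage C Y "shift_obj C X"
      by (rule fp_simplicial_stage[OF a(1) simplicial_shift_obj[OF X]])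
    interpret X': fp_simplicial_stage C Y X' by (rule fp_simplicial_stage[OF a(1) X'])
    note [simp] = entry_tower_map[OF ob' fh] tower_map_el[OF ob' fh] simplicial_hom_el[OF f X X']
    show "tower_map C X X' f (Suc n) \<odot> degen (shift_obj C X) n i \<odot> x
        = degen (shift_obj C X') n i \<odot> tower_map C X X' f n \<odot> x" (is "?l = ?r")
    proof (rule X'.tower_el_eqI[of _ "Suc n"])
      fix k assume "k \<le> Suc n"
      with a show "entry C X' (Suc n) k \<odot> ?l = entry C X' (Suc n) k \<odot> ?r"
        by (cases k) simp_all
    qed (use a in simp_all)
  }
qed

lemma simplicial_hom_eqI:
  assumes X: "simplicial_object C X" and X': "simplicial_object C X'"
    and h: "f \<in> Hom (simplicial C) X X'" "g \<in> Hom (simplicial C) X X'"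
    and eq: "\<And>Y x n. \<lbrakk>Y \<in> Ob C; x \<in> Hom C Y (lev X n)\<rbrakk> \<Longrightarrow> f n \<odot> x = g n \<odot> x"
  shows "f = g"
proof
  fix n show "f n = g n"
    by (rule eq_by_elements[OF simplicial_objectD(1)[OF X] simplicial_objectD(1)[OF X']
          simplicial_homD(1)[OF h(1)] simplicial_homD(1)[OF h(2)] eq])
qed

lemma simplicial_cmp_el:
  assumes "simplicial_object C X" "simplicial_object C X'" "simplicial_object C X''"
    and "f \<in> Hom (simplicial C) X X'" "g \<in> Hom (simplicial C) X' X''"
    and "Y \<in> Ob C" "x \<in> Hom C Y (lev X n)"
  shows "(g \<odot>\<^bsub>simplicial C\<^esub> f) n \<odot> x = g n \<odot> f n \<odot> x"
proof -
  interpret stage C Y by (rule stage[OF assms(6)])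
  show ?thesis using assms simplicial_homD(1)
    by (simp add: el_assoc[OF assms(7) simplicial_homD(1)[OF assms(4)] simplicial_homD(1)[OF assms(5)]]
        simplicial_objectD(1))
qed

lemma shift_functor: "is_functor (simplicial C) (simplicial C) (shift_funct C)"
proof (rule is_functorI)
  show "category (simplicial C)" "category (simplicial C)" by (rule category_simplicial)+
next
  fix X assume "X \<in> Ob (simplicial C)"
  then have X: "simplicial_object C X" by simp
  then show "shift_obj C X \<in> Ob (simplicial C)" by (simp add: simplicial_shift_obj)
  have id: "Idn (simplicial C) X \<in> Hom (simplicial C) X X"
    "Idn (simplicial C) (shift_obj C X) \<in> Hom (simplicial C) (shift_obj C X) (shift_obj C X)"
    using X simplicial_shift_obj[OF X]
    by (intro category.idn_in[OF category_simplicial]; simp)+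
  show "fmap (shift_funct C) X X (Idn (simplicial C) X) = Idn (simplicial C) (shift_obj C X)"
    (is "?l = ?r")
  proof (rule simplicial_hom_eqI[OF simplicial_shift_obj[OF X] simplicial_shift_obj[OF X] _ id(2)])
    show "?l \<in> Hom (simplicial C) (shift_obj C X) (shift_obj C X)"
      using tower_map_simplicial[OF X X id(1)] by (simp add: shift_funct_def)
  next
    fix Y x n assume a: "Y \<in> Ob C" "x \<in> Hom C Y (lev (shift_obj C X) n)"
    interpret fp_simplicial_stage C Y X by (rule fp_simplicial_stage[OF a(1) X])
    interpret Sh: fp_simplicial_stage C Y "shift_obj C X"
      by (rule fp_simplicial_stage[OF a(1) simplicial_shift_obj[OF X]])
    have "tower_map C X X (\<lambda>n. Idn C (L n)) n \<odot> x = x"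
      by (rule tower_el_eqI[of _ n])
        (use a in \<open>simp_all add: tower_map_el entry_tower_map idn_in\<close>)
    then show "?l n \<odot> x = ?r n \<odot> x"
      using a Sh.idn_el[of x n] by (simp add: shift_funct_def)
  qed
next
  fix X X' f assume "X \<in> Ob (simplicial C)" "X' \<in> Ob (simplicial C)" "f \<in> Hom (simplicial C) X X'"
  then show "fmap (shift_funct C) X X' f \<in> Hom (simplicial C) (shift_obj C X) (shift_obj C X')"
    using tower_map_simplicial by (simp add: shift_funct_def)
next
  fix X X' X'' f g
  assume "X \<in> Ob (simplicial C)" "X' \<in> Ob (simplicial C)" "X'' \<in> Ob (simplicial C)"
    and f: "f \<in> Hom (simplicial C) X X'" and g: "g \<in> Hom (simplicial C) X' X''"
  then have X: "simplicial_object C X" and X': "simplicial_object C X'" and X'': "simplicial_object C X''"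
    by simp_all
  note ob' = simplicial_objectD(1)[OF X'] and ob'' = simplicial_objectD(1)[OF X'']
  note fh = simplicial_homD(1)[OF f] and gh = simplicial_homD(1)[OF g]
  note SX = X[THEN simplicial_shift_obj] and SX' = X'[THEN simplicial_shift_obj]
    and SX'' = X''[THEN simplicial_shift_obj]
  have gf: "g \<odot>\<^bsub>simplicial C\<^esub> f \<in> Hom (simplicial C) X X''"
    by (rule category.cmp_in[OF category_simplicial _ _ _ f g]) (simp_all add: X X' X'')
  note tm = tower_map_simplicial[OF X X' f] tower_map_simplicial[OF X' X'' g]
  show "fmap (shift_funct C) X X'' (g \<odot>\<^bsub>simplicial C\<^esub> f)
    = fmap (shift_funct C) X' X'' g \<odot>\<^bsub>simplicial C\<^esub> fmap (shift_funct C) X X' f"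
    unfolding shift_funct_def funct.simps
  proof (rule simplicial_hom_eqI[OF SX SX'' tower_map_simplicial[OF X X'' gf]])
    show "tower_map C X' X'' g \<odot>\<^bsub>simplicial C\<^esub> tower_map C X X' f
        \<in> Hom (simplicial C) (shift_obj C X) (shift_obj C X'')"
      by (rule category.cmp_in[OF category_simplicial _ _ _ tm]) (simp_all add: SX SX' SX'')
  next
    fix Y x n assume a: "Y \<in> Ob C" "x \<in> Hom C Y (lev (shift_obj C X) n)"
    interpret fp_simplicial_stage C Y X by (rule fp_simplicial_stage[OF a(1) X])
    interpret Sh: fp_simplicial_stage C Y "shift_obj C X"
      by (rule fp_simplicial_stage[OF a(1) simplicial_shift_obj[OF X]])
    interpret X': fp_simplicial_stage C Y X' by (rule fp_simplicial_stage[OF a(1) X'])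
    interpret X'': fp_simplicial_stage C Y X'' by (rule fp_simplicial_stage[OF a(1) X''])
    note gfh = simplicial_homD(1)[OF gf]
    \<comment> \<open>Composites in \<open>simplicial C\<close> stay folded, so that the instances
      of \<open>simplicial_cmp_el\<close> below can match them.\<close>
    note [simp del] = simplicial_sel(3)
    note [simp] = entry_tower_map[OF ob' fh] tower_map_el[OF ob' fh]
      X'.entry_tower_map[OF ob'' gh] X'.tower_map_el[OF ob'' gh]
      entry_tower_map[OF ob'' gfh] tower_map_el[OF ob'' gfh]
      simplicial_cmp_el[OF X X' X'' f g a(1)] simplicial_cmp_el[OF SX SX' SX'' tm a(1)]
    show "tower_map C X X'' (g \<odot>\<^bsub>simplicial C\<^esub> f) n \<odot> x
      = (tower_map C X' X'' g \<odot>\<^bsub>simplicial C\<^esub> tower_map C X X' f) n \<odot> x"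
      by (rule X''.tower_el_eqI[of _ n]) (use a in simp_all)
  qed
qed

lemma simplicial_cmp_eqI:
  assumes X: "simplicial_object C X" "simplicial_object C X1" "simplicial_object C X2" "simplicial_object C X'"
    and h: "f1 \<in> Hom (simplicial C) X X1" "g1 \<in> Hom (simplicial C) X1 X'"
      "f2 \<in> Hom (simplicial C) X X2" "g2 \<in> Hom (simplicial C) X2 X'"
    and eq: "\<And>Y x n. \<lbrakk>Y \<in> Ob C; x \<in> Hom C Y (lev X n)\<rbrakk> \<Longrightarrow> g1 n \<odot> f1 n \<odot> x = g2 n \<odot> f2 n \<odot> x"
  shows "g1 \<odot>\<^bsub>simplicial C\<^esub> f1 = g2 \<odot>\<^bsub>simplicial C\<^esub> f2"
proof (rule simplicial_hom_eqI[OF X(1,4)])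
  show "g1 \<odot>\<^bsub>simplicial C\<^esub> f1 \<in> Hom (simplicial C) X X'"
    by (rule category.cmp_in[OF category_simplicial _ _ _ h(1,2)]) (simp_all add: X)
  show "g2 \<odot>\<^bsub>simplicial C\<^esub> f2 \<in> Hom (simplicial C) X X'"
    by (rule category.cmp_in[OF category_simplicial _ _ _ h(3,4)]) (simp_all add: X)
  show "(g1 \<odot>\<^bsub>simplicial C\<^esub> f1) n \<odot> x = (g2 \<odot>\<^bsub>simplicial C\<^esub> f2) n \<odot> x"
    if "Y \<in> Ob C" "x \<in> Hom C Y (lev X n)" for Y x n
    unfolding simplicial_cmp_el[OF X(1,2,4) h(1,2) that] simplicial_cmp_el[OF X(1,3,4) h(3,4) that]
    by (rule eq[OF that])
qed

lemma simplicial_cmp_eq_idnI: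
  assumes X: "simplicial_object C X" "simplicial_object C X'"
    and h: "f \<in> Hom (simplicial C) X X'" "g \<in> Hom (simplicial C) X' X"
    and eq: "\<And>Y x n. \<lbrakk>Y \<in> Ob C; x \<in> Hom C Y (lev X n)\<rbrakk> \<Longrightarrow> g n \<odot> f n \<odot> x = x"
  shows "g \<odot>\<^bsub>simplicial C\<^esub> f = Idn (simplicial C) X"
proof (rule simplicial_hom_eqI[OF X(1) X(1)])
  show "g \<odot>\<^bsub>simplicial C\<^esub> f \<in> Hom (simplicial C) X X"
    by (rule category.cmp_in[OF category_simplicial _ _ _ h]) (simp_all add: X)
  show "Idn (simplicial C) X \<in> Hom (simplicial C) X X"
    by (rule category.idn_in[OF category_simplicial]) (simp add: X)
  show "(g \<odot>\<^bsub>simplicial C\<^esub> f) n \<odot> x = Idn (simplicial C) X n \<odot> x"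
    if "Y \<in> Ob C" "x \<in> Hom C Y (lev X n)" for Y x n
    unfolding simplicial_cmp_el[OF X(1,2,1) h that] eq[OF that]
    using idn_cmp[OF that(1) simplicial_objectD(1)[OF X(1)] that(2)] by simp
qed

text \<open>At level \<open>k\<close> the multiplication reads off a leading entry. After the unit
  of the shifted object this is the leading entry of a truncated tower; after the shifted unit it is
  the leading entry of (g_k, d_0 g_k, ...), that is g_k; in the associative law both sides take the
  leading entry of a leading entry.\<close>

theorem shift_monad: "monad (simplicial C) (shift_funct C) (shift_unit C) (shift_mult C)"
proof -
  note F = shift_functor
  have \<eta>: "nat_trans (simplicial C) (simplicial C) id_funct (shift_funct C) (shift_unit C)"
    unfolding nat_trans_def
  proof (intro conjI ballI F is_functor_id category_simplicial)
    fix X assume "X \<in> Ob (simplicial C)"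
    then show "shift_unit C X \<in> Hom (simplicial C) (fob id_funct X) (shift_obj C X)"
      using shift_unit_simplicial by (simp add: id_funct_def)
  next
    fix X X' f assume "X \<in> Ob (simplicial C)" "X' \<in> Ob (simplicial C)"
      and f: "f \<in> Hom (simplicial C) X X'"
    then have X: "simplicial_object C X" and X': "simplicial_object C X'" by simp_all
    note ob' = simplicial_objectD(1)[OF X'] and fh = simplicial_homD(1)[OF f]
    have "shift_unit C X' \<odot>\<^bsub>simplicial C\<^esub> f = tower_map C X X' f \<odot>\<^bsub>simplicial C\<^esub> shift_unit C X"
    proof (rule simplicial_cmp_eqI[OF X X' simplicial_shift_obj[OF X] simplicial_shift_obj[OF X'] f
          shift_unit_simplicial[OF X'] shift_unit_simplicial[OF X] tower_map_simplicial[OF X X' f]])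
      fix Y x n assume a: "Y \<in> Ob C" "x \<in> Hom C Y (lev X n)"
      interpret fp_simplicial_stage C Y X by (rule fp_simplicial_stage[OF a(1) X])
      interpret Sh: fp_simplicial_stage C Y "shift_obj C X"
        by (rule fp_simplicial_stage[OF a(1) simplicial_shift_obj[OF X]])
      interpret X': fp_simplicial_stage C Y X' by (rule fp_simplicial_stage[OF a(1) X'])
      show "shift_unit C X' n \<odot> f n \<odot> x = tower_map C X X' f n \<odot> shift_unit C X n \<odot> x"
        by (rule X'.tower_el_eqI[of _ n])
          (use a in \<open>simp_all add: entry_tower_map[OF ob' fh] tower_map_el[OF ob' fh]
              simplicial_hom_el[OF f X X'] d0_to_natural[OF f X']\<close>)
    qed
    then show "shift_unit C X' \<odot>\<^bsub>simplicial C\<^esub> fmap id_funct X X' f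
        = fmap (shift_funct C) X X' f \<odot>\<^bsub>simplicial C\<^esub> shift_unit C X"
      by (simp only: id_funct_def shift_funct_def funct.simps)
  qed
  have \<mu>: "nat_trans (simplicial C) (simplicial C) (shift_funct C \<circ>\<^sub>F shift_funct C) (shift_funct C) (shift_mult C)"
    unfolding nat_trans_def
  proof (intro conjI ballI)
    show "is_functor (simplicial C) (simplicial C) (shift_funct C \<circ>\<^sub>F shift_funct C)"
      by (rule is_functor_comp[OF F F])
    show "is_functor (simplicial C) (simplicial C) (shift_funct C)" by (rule F)
  next
    fix X assume "X \<in> Ob (simplicial C)"
    then show "shift_mult C X \<in> Hom (simplicial C) (fob (shift_funct C \<circ>\<^sub>F shift_funct C) X) (shift_obj C X)"
      using shift_mult_simplicial by (simp add: comp_funct_def)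
  next
    fix X X' f assume "X \<in> Ob (simplicial C)" "X' \<in> Ob (simplicial C)"
      and f: "f \<in> Hom (simplicial C) X X'"
    then have X: "simplicial_object C X" and X': "simplicial_object C X'" by simp_all
    note ob' = simplicial_objectD(1)[OF X'] and fh = simplicial_homD(1)[OF f]
    note SX = X[THEN simplicial_shift_obj] and SX' = X'[THEN simplicial_shift_obj]
    note Sf = tower_map_simplicial[OF X X' f]
    note Sob' = simplicial_objectD(1)[OF SX'] and Sfh = simplicial_homD(1)[OF Sf]
    have "shift_mult C X' \<odot>\<^bsub>simplicial C\<^esub> tower_map C (shift_obj C X) (shift_obj C X') (tower_map C X X' f)
      = tower_map C X X' f \<odot>\<^bsub>simplicial C\<^esub> shift_mult C X"
    proof (rule simplicial_cmp_eqI[OF simplicial_shift_obj[OF SX] simplicial_shift_obj[OF SX'] SX SX'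
          tower_map_simplicial[OF SX SX' Sf] shift_mult_simplicial[OF X'] shift_mult_simplicial[OF X] Sf])
      fix Y x n assume a: "Y \<in> Ob C" "x \<in> Hom C Y (lev (shift_obj C (shift_obj C X)) n)"
      interpret fp_simplicial_stage C Y X by (rule fp_simplicial_stage[OF a(1) X])
      interpret Sh: fp_simplicial_stage C Y "shift_obj C X"
        by (rule fp_simplicial_stage[OF a(1) simplicial_shift_obj[OF X]])
      interpret X': fp_simplicial_stage C Y X' by (rule fp_simplicial_stage[OF a(1) X'])
      have x: "x \<in> el (Sh.P n)" using a(2) by simp
      note S1 = Sh.tower_map_el[OF Sob' Sfh x]
      show "shift_mult C X' n \<odot> tower_map C (shift_obj C X) (shift_obj C X') (tower_map C X X' f) n \<odot> x
        = tower_map C X X' f n \<odot> shift_mult C X n \<odot> x" (is "?l = ?r")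
      proof (rule X'.tower_el_eqI[of _ n])
        fix k assume k: "k \<le> n"
        have "Sh.e n k \<odot> x \<in> el (P k)" using Sh.entry_el[OF k x] by simp
        with k show "entry C X' n k \<odot> ?l = entry C X' n k \<odot> ?r"
          using Sh.entry_tower_map[OF Sob' Sfh x k] S1 x
          by (simp add: entry_tower_map[OF ob' fh])
      qed (use S1 x in \<open>simp_all add: tower_map_el[OF ob' fh]\<close>)
    qed
    then show "shift_mult C X' \<odot>\<^bsub>simplicial C\<^esub> fmap (shift_funct C \<circ>\<^sub>F shift_funct C) X X' f
        = fmap (shift_funct C) X X' f \<odot>\<^bsub>simplicial C\<^esub> shift_mult C X"
      by (simp add: comp_funct_def shift_funct_def)
  qed
  show ?thesis
    unfolding monad_def
  proof (intro conjI ballI F \<eta> \<mu>)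
    fix X assume "X \<in> Ob (simplicial C)"
    then have X: "simplicial_object C X" by simp
    note SX = simplicial_shift_obj[OF X] note SSX = simplicial_shift_obj[OF SX]
    note SSSX = simplicial_shift_obj[OF SSX]
    note ob = simplicial_objectD(1)[OF X] and Sob = simplicial_objectD(1)[OF SX]
      and SSob = simplicial_objectD(1)[OF SSX]
    note u = shift_unit_simplicial[OF X] and m = shift_mult_simplicial[OF X]
    note Su = shift_unit_simplicial[OF SX] and Sm = shift_mult_simplicial[OF SX]
    note uh = simplicial_homD(1)[OF u] and mh = simplicial_homD(1)[OF m]
    show "shift_mult C X \<odot>\<^bsub>simplicial C\<^esub> shift_unit C (shift_obj C X) = Idn (simplicial C) (shift_obj C X)"
    proof (rule simplicial_cmp_eq_idnI[OF SX SSX Su m])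
      fix Y x n assume a: "Y \<in> Ob C" "x \<in> Hom C Y (lev (shift_obj C X) n)"
      interpret fp_simplicial_stage C Y X by (rule fp_simplicial_stage[OF a(1) X])
      interpret Sh: fp_simplicial_stage C Y "shift_obj C X"
        by (rule fp_simplicial_stage[OF a(1) simplicial_shift_obj[OF X]])
      show "shift_mult C X n \<odot> shift_unit C (shift_obj C X) n \<odot> x = x" (is "?l = ?r")
      proof (rule tower_el_eqI[of _ n])
        have x: "x \<in> el (P n)" using a(2) by simp
        have u: "shift_unit C (shift_obj C X) n \<odot> x \<in> el (Sh.P n)" by (rule Sh.shift_unit_el[OF a(2)])
        then show "shift_mult C X n \<odot> shift_unit C (shift_obj C X) n \<odot> x \<in> el (P n)" by simp
        show "x \<in> el (P n)" by (rule x)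
        fix k assume k: "k \<le> n"
        then show "e n k \<odot> ?l = e n k \<odot> ?r"
          unfolding entry_shift_mult[OF u k] Sh.entry_shift_unit[OF a(2) k] by (rule entry_Sh_d0_to[OF _ _ x]) simp
      qed
    qed
    have "shift_mult C X \<odot>\<^bsub>simplicial C\<^esub> tower_map C X (shift_obj C X) (shift_unit C X)
      = Idn (simplicial C) (shift_obj C X)"
    proof (rule simplicial_cmp_eq_idnI[OF SX SSX tower_map_simplicial[OF X SX u] m])
      fix Y x n assume a: "Y \<in> Ob C" "x \<in> Hom C Y (lev (shift_obj C X) n)"
      interpret fp_simplicial_stage C Y X by (rule fp_simplicial_stage[OF a(1) X])
      interpret Sh: fp_simplicial_stage C Y "shift_obj C X"
        by (rule fp_simplicial_stage[OF a(1) simplicial_shift_obj[OF X]])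
      show "shift_mult C X n \<odot> tower_map C X (shift_obj C X) (shift_unit C X) n \<odot> x = x" (is "?l = ?r")
      proof (rule tower_el_eqI[of _ n])
        have x: "x \<in> el (P n)" using a(2) by simp
        note t = tower_map_el[OF Sob uh x]
        show "shift_mult C X n \<odot> tower_map C X (shift_obj C X) (shift_unit C X) n \<odot> x \<in> el (P n)"
          by (rule shift_mult_el[OF t])
        show "x \<in> el (P n)" by (rule x)
        fix k assume k: "k \<le> n"
        show "e n k \<odot> ?l = e n k \<odot> ?r"
          unfolding entry_shift_mult[OF t k] entry_tower_map[OF Sob uh x k] using k x by simp
      qed
    qed
    then show "shift_mult C X \<odot>\<^bsub>simplicial C\<^esub> fmap (shift_funct C) X (shift_obj C X) (shift_unit C X)
      = Idn (simplicial C) (shift_obj C X)"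
      by (simp add: shift_funct_def)
    have "shift_mult C X \<odot>\<^bsub>simplicial C\<^esub> shift_mult C (shift_obj C X)
      = shift_mult C X \<odot>\<^bsub>simplicial C\<^esub>
        tower_map C (shift_obj C (shift_obj C X)) (shift_obj C X) (shift_mult C X)"
    proof (rule simplicial_cmp_eqI[OF SSSX SSX SSX SX Sm m tower_map_simplicial[OF SSX SX m] m])
      fix Y x n assume a: "Y \<in> Ob C" "x \<in> Hom C Y (lev (shift_obj C (shift_obj C (shift_obj C X))) n)"
      interpret fp_simplicial_stage C Y X by (rule fp_simplicial_stage[OF a(1) X])
      interpret Sh: fp_simplicial_stage C Y "shift_obj C X"
        by (rule fp_simplicial_stage[OF a(1) simplicial_shift_obj[OF X]])
      interpret ShSh: fp_simplicial_stage C Y "shift_obj C (shift_obj C X)"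
        by (rule fp_simplicial_stage[OF a(1) simplicial_shift_obj[OF SX]])
      have x: "x \<in> el (ShSh.P n)" using a(2) by simp
      note t = ShSh.tower_map_el[OF Sob mh x] and m' = Sh.shift_mult_el[OF x]
      show "shift_mult C X n \<odot> shift_mult C (shift_obj C X) n \<odot> x
        = shift_mult C X n \<odot> tower_map C (shift_obj C (shift_obj C X)) (shift_obj C X) (shift_mult C X) n \<odot> x" (is "?l = ?r")
      proof (rule tower_el_eqI[of _ n])
        fix k assume k: "k \<le> n"
        have "ShSh.e n k \<odot> x \<in> el (Sh.P k)" using ShSh.entry_el[OF k x] by simp
        then show "e n k \<odot> ?l = e n k \<odot> ?r"
          unfolding entry_shift_mult[OF t k] entry_shift_mult[OF m' k]
            Sh.entry_shift_mult[OF x k] ShSh.entry_tower_map[OF Sob mh x k]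
          by simp
      qed (rule shift_mult_el[OF t] shift_mult_el[OF m'])+
    qed
    then show "shift_mult C X \<odot>\<^bsub>simplicial C\<^esub> shift_mult C (shift_obj C X)
      = shift_mult C X \<odot>\<^bsub>simplicial C\<^esub>
        fmap (shift_funct C) (shift_obj C (shift_obj C X)) (shift_obj C X) (shift_mult C X)"
      by (simp add: shift_funct_def)
  qed
qed

end

section \<open>The category of algebras has finite products\<close>

lemma set_replicate_ob: "a \<in> S \<Longrightarrow> set (replicate n a) \<subseteq> S"
  by auto

context fp_category
begin

abbreviation "pow n a \<equiv> prd C (replicate n a)"
abbreviation "pow_map n a b h \<equiv> prod_map C (replicate n a) (replicate n b) (replicate n h)"

lemma pow_ob: "a \<in> Ob C \<Longrightarrow> pow n a \<in> Ob C"
  by (rule prd_ob[OF set_replicate_ob])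

lemma pow_map_hom:
  assumes "a \<in> Ob C" "b \<in> Ob C" "h \<in> Hom C a b"
  shows "pow_map n a b h
    \<in> Hom C (pow n a) (pow n b)"
  by (rule prod_map_hom[OF set_replicate_ob[OF assms(1)] set_replicate_ob[OF assms(2)]])
    (simp_all add: assms(3))

end

context fp_stage
begin

lemma pow_el_eqI:
  assumes "a \<in> Ob C" "x \<in> el (pow n a)" "y \<in> el (pow n a)"
    and "\<And>i. i < n \<Longrightarrow> prj C (replicate n a) i \<odot> x = prj C (replicate n a) i \<odot> y"
  shows "x = y"
  by (rule prd_eqI[OF Y set_replicate_ob[OF assms(1)] assms(2,3)]) (simp add: assms(4))

lemma pow_map_el:
  assumes "a \<in> Ob C" "b \<in> Ob C" "h \<in> Hom C a b" "x \<in> el (pow n a)"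
  shows "pow_map n a b h \<odot> x \<in> el (pow n b)"
  by (rule prod_map_el[OF assms(4) set_replicate_ob[OF assms(1)] set_replicate_ob[OF assms(2)]])
    (simp_all add: assms)

lemma prj_pow_map:
  assumes "a \<in> Ob C" "b \<in> Ob C" "h \<in> Hom C a b" "x \<in> el (pow n a)" "i < n"
  shows "prj C (replicate n b) i \<odot> pow_map n a b h \<odot> x
    = h \<odot> prj C (replicate n a) i \<odot> x"
  using prj_prod_map_el[OF assms(4) set_replicate_ob[OF assms(1)] set_replicate_ob[OF assms(2)],
      where i = i and fs = "replicate n h"] assms by simp

lemma prj_pow_el:
  assumes "a \<in> Ob C" "x \<in> el (pow n a)" "i < n"
  shows "prj C (replicate n a) i \<odot> x \<in> el a"
  using prj_el[OF set_replicate_ob[OF assms(1)] _ assms(2)] assms(3) by simp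

lemma pow_map_id:
  assumes "a \<in> Ob C" "x \<in> el (pow n a)"
  shows "pow_map n a a (Idn C a) \<odot> x = x"
proof (rule pow_el_eqI[OF assms(1) pow_map_el[OF assms(1,1) idn_in[OF assms(1)] assms(2)] assms(2)])
  fix i assume i: "i < n"
  show "prj C (replicate n a) i \<odot> pow_map n a a (Idn C a) \<odot> x
    = prj C (replicate n a) i \<odot> x"
    unfolding prj_pow_map[OF assms(1,1) idn_in[OF assms(1)] assms(2) i]
    by (rule idn_cmp[OF Y assms(1) prj_pow_el[OF assms i]])
qed

lemma pow_map_cmp:
  assumes ob: "a \<in> Ob C" "b \<in> Ob C" "c \<in> Ob C" and h: "f \<in> Hom C a b" "g \<in> Hom C b c"
    and x: "x \<in> el (pow n a)"
  shows "pow_map n a c (g \<odot> f) \<odot> x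
    = pow_map n b c g
      \<odot> pow_map n a b f \<odot> x"
proof (rule pow_el_eqI[OF ob(3)])
  note gf = cmp_in[OF ob h] and fx = pow_map_el[OF ob(1,2) h(1) x]
  show "pow_map n a c (g \<odot> f) \<odot> x \<in> el (pow n c)"
    by (rule pow_map_el[OF ob(1,3) gf x])
  show "pow_map n b c g
      \<odot> pow_map n a b f \<odot> x \<in> el (pow n c)"
    by (rule pow_map_el[OF ob(2,3) h(2) fx])
  fix i assume i: "i < n"
  show "prj C (replicate n c) i \<odot> pow_map n a c (g \<odot> f) \<odot> x
    = prj C (replicate n c) i \<odot> pow_map n b c g
      \<odot> pow_map n a b f \<odot> x"
    unfolding prj_pow_map[OF ob(1,3) gf x i] prj_pow_map[OF ob(2,3) h(2) fx i]
      prj_pow_map[OF ob(1,2) h(1) x i]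
    by (rule el_assoc[OF prj_pow_el[OF ob(1) x i] h ob])
qed

end

lemma TAlg_sel [simp]:
  "A \<in> Ob (TAlg C T) \<longleftrightarrow> t_algebra C T A"
  "Idn (TAlg C T) A = Idn C (tcarr A)"
  "Cmp (TAlg C T) = Cmp C"
  by (simp_all add: TAlg_def)

lemma t_algebraD:
  assumes "t_algebra C T A"
  shows "tcarr A \<in> Ob C"
    and "\<omega> \<in> Hom T n 1 \<Longrightarrow> talg_op A n \<omega> \<in> Hom C (prd C (replicate n (tcarr A))) (tcarr A)"
    and "\<omega> \<notin> Hom T n 1 \<Longrightarrow> talg_op A n \<omega> = undefined"
    and "i < n \<Longrightarrow> talg_op A n (lproj T n i) = prj C (replicate n (tcarr A)) i"
    and "\<lbrakk>\<tau> \<in> Hom T n m; \<omega> \<in> Hom T m 1\<rbrakk> \<Longrightarrow> talg_op A n (\<omega> \<odot>\<^bsub>T\<^esub> \<tau>)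
          = talg_op A m \<omega> \<odot>\<^bsub>C\<^esub>
            tuple C (prd C (replicate n (tcarr A))) (replicate m (tcarr A))
              (map (\<lambda>i. talg_op A n (lproj T m i \<odot>\<^bsub>T\<^esub> \<tau>)) [0..<m])"
proof -
  note r1 = assms[unfolded t_algebra_def]
  note r2 = conjunct2[OF r1]
  note r3 = conjunct2[OF r2]
  note r4 = conjunct2[OF r3]
  show "tcarr A \<in> Ob C"
    using conjunct1[OF r1] .
  show "\<omega> \<in> Hom T n 1 \<Longrightarrow> talg_op A n \<omega> \<in> Hom C (prd C (replicate n (tcarr A))) (tcarr A)"
    using conjunct1[OF r2] by blast
  show "\<omega> \<notin> Hom T n 1 \<Longrightarrow> talg_op A n \<omega> = undefined"
    using conjunct1[OF r3] by blast
  show "i < n \<Longrightarrow> talg_op A n (lproj T n i) = prj C (replicate n (tcarr A)) i"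
    using conjunct1[OF r4] by blast
  show "\<lbrakk>\<tau> \<in> Hom T n m; \<omega> \<in> Hom T m 1\<rbrakk> \<Longrightarrow> talg_op A n (\<omega> \<odot>\<^bsub>T\<^esub> \<tau>)
          = talg_op A m \<omega> \<odot>\<^bsub>C\<^esub>
            tuple C (prd C (replicate n (tcarr A))) (replicate m (tcarr A))
              (map (\<lambda>i. talg_op A n (lproj T m i \<odot>\<^bsub>T\<^esub> \<tau>)) [0..<m])"
    using conjunct2[OF r4] by blast
qed

lemma TAlg_homD:
  assumes "h \<in> Hom (TAlg C T) A B"
  shows "h \<in> Hom C (tcarr A) (tcarr B)"
    and "\<omega> \<in> Hom T n 1 \<Longrightarrow> h \<odot>\<^bsub>C\<^esub> talg_op A n \<omega> = talg_op B n \<omega> \<odot>\<^bsub>C\<^esub>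
      prod_map C (replicate n (tcarr A)) (replicate n (tcarr B)) (replicate n h)"
  using assms by (simp_all add: TAlg_def)

lemma (in fp_stage) TAlg_hom_el:
  assumes A: "t_algebra C T A" and B: "t_algebra C T B" and h: "h \<in> Hom (TAlg C T) A B"
    and \<omega>: "\<omega> \<in> Hom T n 1" and x: "x \<in> el (pow n (tcarr A))"
  shows "h \<odot> talg_op A n \<omega> \<odot> x
    = talg_op B n \<omega> \<odot> pow_map n (tcarr A) (tcarr B) h \<odot> x"
proof -
  note ob = t_algebraD(1)[OF A] t_algebraD(1)[OF B]
  show ?thesis
    by (rule cmp_eq_el[OF TAlg_homD(2)[OF h \<omega>] x t_algebraD(2)[OF A \<omega>] TAlg_homD(1)[OF h]
          pow_map_hom[OF ob TAlg_homD(1)[OF h]] t_algebraD(2)[OF B \<omega>]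
          pow_ob[OF ob(1)] ob(1) pow_ob[OF ob(2)] ob(2)])
qed

lemma (in fp_category) TAlg_homI:
  assumes A: "t_algebra C T A" and B: "t_algebra C T B" and h: "h \<in> Hom C (tcarr A) (tcarr B)"
    and eq: "\<And>Y n \<omega> x. \<lbrakk>Y \<in> Ob C; \<omega> \<in> Hom T n 1; x \<in> Hom C Y (pow n (tcarr A))\<rbrakk>
      \<Longrightarrow> h \<odot> talg_op A n \<omega> \<odot> x = talg_op B n \<omega>
        \<odot> pow_map n (tcarr A) (tcarr B) h \<odot> x"
  shows "h \<in> Hom (TAlg C T) A B"
proof -
  note ob = t_algebraD(1)[OF A] t_algebraD(1)[OF B]
  have "h \<odot> talg_op A n \<omega> = talg_op B n \<omega>
        \<odot> pow_map n (tcarr A) (tcarr B) h"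
    if \<omega>: "\<omega> \<in> Hom T n 1" for n \<omega>
    by (rule cmp_eq_by_elements[OF pow_ob[OF ob(1)] ob(1) ob(2) pow_ob[OF ob(2)] t_algebraD(2)[OF A \<omega>] h
          pow_map_hom[OF ob h] t_algebraD(2)[OF B \<omega>] eq[OF _ \<omega>]])
  then show ?thesis using h by (simp add: TAlg_def)
qed

section \<open>Operations of an algebra and their composition\<close>

locale algebras = fp_category C + T: lawvere_theory T
  for C :: "('o, 'm, 'z) fpcat_scheme" (structure) and T :: "'t lawvere"
begin

lemma lproj_hom: "i < n \<Longrightarrow> lproj T n i \<in> Hom T n 1"
  using T.powers[of n] by (simp add: is_product_def)

lemma T_cmp_in: "\<lbrakk>\<tau> \<in> Hom T n m; \<omega> \<in> Hom T m k\<rbrakk> \<Longrightarrow> \<omega> \<odot>\<^bsub>T\<^esub> \<tau> \<in> Hom T n k"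
  by (rule T.cmp_in) (simp_all add: T.objects)

lemma talg_pow_ob: "t_algebra C T A \<Longrightarrow> pow n (tcarr A) \<in> Ob C"
  by (rule prd_ob[OF set_replicate_ob[OF t_algebraD(1)]])

text \<open>An algebra is a product-preserving functor recorded through its values on arrows into 1;
  this recovers its value on an arrow \<tau> from \<open>n\<close> to \<open>m\<close>.\<close>

abbreviation "op_tuple A n m \<tau> \<equiv> tuple C (pow n (tcarr A)) (replicate m (tcarr A))
              (map (\<lambda>i. talg_op A n (lproj T m i \<odot>\<^bsub>T\<^esub> \<tau>)) [0..<m])"

lemma op_tuple_hom:
  assumes A: "t_algebra C T A" and "\<tau> \<in> Hom T n m"
  shows "op_tuple A n m \<tau> \<in> Hom C (pow n (tcarr A)) (pow m (tcarr A))"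
  by (rule tuple_hom[OF talg_pow_ob[OF A] set_replicate_ob[OF t_algebraD(1)[OF A]]])
    (simp_all add: t_algebraD(2)[OF A, simplified] T_cmp_in[OF assms(2) lproj_hom[simplified]])

end

locale algebras_stage = algebras C T + fp_stage C Y
  for C :: "('o, 'm, 'z) fpcat_scheme" (structure) and T :: "'t lawvere" and Y
begin

lemma op_el:
  assumes A: "t_algebra C T A" and "\<omega> \<in> Hom T n 1" "x \<in> el (pow n (tcarr A))"
  shows "talg_op A n \<omega> \<odot> x \<in> el (tcarr A)"
  by (rule el_cmp[OF t_algebraD(2)[OF A assms(2)] assms(3) talg_pow_ob[OF A] t_algebraD(1)[OF A]])

lemma op_tuple_el:
  assumes A: "t_algebra C T A" and "\<tau> \<in> Hom T n m" "x \<in> el (pow n (tcarr A))"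
  shows "op_tuple A n m \<tau> \<odot> x \<in> el (pow m (tcarr A))"
  by (rule el_cmp[OF op_tuple_hom[OF A assms(2)] assms(3) talg_pow_ob[OF A] talg_pow_ob[OF A]])

lemma prj_op_tuple:
  assumes A: "t_algebra C T A" and \<tau>: "\<tau> \<in> Hom T n m"
    and x: "x \<in> el (pow n (tcarr A))" and i: "i < m"
  shows "prj C (replicate m (tcarr A)) i \<odot> op_tuple A n m \<tau> \<odot> x
    = talg_op A n (lproj T m i \<odot>\<^bsub>T\<^esub> \<tau>) \<odot> x"
  using prj_tuple_el[OF x talg_pow_ob[OF A] set_replicate_ob[OF t_algebraD(1)[OF A]],
      of "map (\<lambda>i. talg_op A n (lproj T m i \<odot>\<^bsub>T\<^esub> \<tau>)) [0..<m]" m i] i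
  by (simp add: t_algebraD(2)[OF A, simplified] T_cmp_in[OF \<tau> lproj_hom[simplified]])

lemma op_cmp:
  assumes A: "t_algebra C T A" and \<tau>: "\<tau> \<in> Hom T n m" and \<omega>: "\<omega> \<in> Hom T m 1"
    and x: "x \<in> el (pow n (tcarr A))"
  shows "talg_op A n (\<omega> \<odot>\<^bsub>T\<^esub> \<tau>) \<odot> x = talg_op A m \<omega> \<odot> op_tuple A n m \<tau> \<odot> x"
  unfolding t_algebraD(5)[OF A \<tau> \<omega>]
  by (rule el_assoc[OF x op_tuple_hom[OF A \<tau>] t_algebraD(2)[OF A \<omega>] talg_pow_ob[OF A] talg_pow_ob[OF A] t_algebraD(1)[OF A]])

end

context algebras
begin

lemma algebras_stage: "Y \<in> Ob C \<Longrightarrow> algebras_stage C T Y"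
  by (simp add: algebras_stage_def algebras_axioms fp_stage)

lemma category_TAlg: "category (TAlg C T)"
proof (unfold_locales, simp_all)
  fix A assume A: "t_algebra C T A"
  show "Idn C (tcarr A) \<in> Hom (TAlg C T) A A"
  proof (rule TAlg_homI[OF A A])
    show "Idn C (tcarr A) \<in> Hom C (tcarr A) (tcarr A)" by (rule idn_in[OF t_algebraD(1)[OF A]])
    fix Y n \<omega> x assume a: "Y \<in> Ob C" "\<omega> \<in> Hom T n 1" "x \<in> Hom C Y (pow n (tcarr A))"
    interpret algebras_stage C T Y by (rule algebras_stage[OF a(1)])
    show "Idn C (tcarr A) \<odot> talg_op A n \<omega> \<odot> x
      = talg_op A n \<omega> \<odot> pow_map n (tcarr A) (tcarr A) (Idn C (tcarr A)) \<odot> x"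
      unfolding pow_map_id[OF t_algebraD(1)[OF A] a(3)]
      by (rule idn_cmp[OF Y t_algebraD(1)[OF A] op_el[OF A a(2,3)]])
  qed
next
  fix A B D f g assume A: "t_algebra C T A" and B: "t_algebra C T B" and D: "t_algebra C T D"
    and f: "f \<in> Hom (TAlg C T) A B" and g: "g \<in> Hom (TAlg C T) B D"
  note ob = t_algebraD(1)[OF A] t_algebraD(1)[OF B] t_algebraD(1)[OF D]
    and h = TAlg_homD(1)[OF f] TAlg_homD(1)[OF g]
  show "g \<odot> f \<in> Hom (TAlg C T) A D"
  proof (rule TAlg_homI[OF A D])
    show "g \<odot> f \<in> Hom C (tcarr A) (tcarr D)" by (rule cmp_in[OF ob h])
    fix Y n \<omega> x assume a: "Y \<in> Ob C" "\<omega> \<in> Hom T n 1" "x \<in> Hom C Y (pow n (tcarr A))"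
    interpret algebras_stage C T Y by (rule algebras_stage[OF a(1)])
    note fx = pow_map_el[OF ob(1,2) h(1) a(3)]
    show "(g \<odot> f) \<odot> talg_op A n \<omega> \<odot> x
      = talg_op D n \<omega> \<odot> pow_map n (tcarr A) (tcarr D) (g \<odot> f) \<odot> x"
      unfolding pow_map_cmp[OF ob h a(3)] el_assoc[OF op_el[OF A a(2,3)] h ob]
        TAlg_hom_el[OF A B f a(2,3)] TAlg_hom_el[OF B D g a(2) fx] ..
  qed
next
  fix A B f assume A: "t_algebra C T A" and B: "t_algebra C T B" and f: "f \<in> Hom (TAlg C T) A B"
  note ob = t_algebraD(1)[OF A] t_algebraD(1)[OF B] and h = TAlg_homD(1)[OF f]
  show "f \<odot> Idn C (tcarr A) = f" by (rule cmp_idn[OF ob h])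
  show "Idn C (tcarr B) \<odot> f = f" by (rule idn_cmp[OF ob h])
next
  fix A A1 A2 A3 f g h
  assume A: "t_algebra C T A" "t_algebra C T A1" "t_algebra C T A2" "t_algebra C T A3"
    "f \<in> Hom (TAlg C T) A A1" "g \<in> Hom (TAlg C T) A1 A2" "h \<in> Hom (TAlg C T) A2 A3"
  show "(h \<odot> g) \<odot> f = h \<odot> g \<odot> f"
    by (rule cmp_assoc[OF A(1-4)[THEN t_algebraD(1)] A(5-7)[THEN TAlg_homD(1)]])
qed

end

text \<open>Results on \<open>shift_funct\<close> speak of a category with a choice of products. For
  algebras the choice is \<open>prod_talg\<close>, with projections and composition taken from
  \<open>C\<close>, so that the instance can be compared with the formulas for W_T.\<close>

definition TAlg_fp ::
  "('o, 'm, 'z) fpcat_scheme \<Rightarrow> 't lawvere \<Rightarrow> (('o, 'm, 't) talg, 'm) fpcat" where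
  "TAlg_fp C T = \<lparr>Ob = Ob (TAlg C T), Hom = Hom (TAlg C T), Idn = Idn (TAlg C T),
    Cmp = Cmp (TAlg C T), prd = prod_talg C T, prj = (\<lambda>As. prj C (map tcarr As))\<rparr>"

lemma TAlg_fp_sel [simp]:
  "Ob (TAlg_fp C T) = Ob (TAlg C T)" "Hom (TAlg_fp C T) = Hom (TAlg C T)"
  "Idn (TAlg_fp C T) = Idn (TAlg C T)" "Cmp (TAlg_fp C T) = Cmp C"
  "prd (TAlg_fp C T) = prod_talg C T" "prj (TAlg_fp C T) As = prj C (map tcarr As)"
  by (simp_all add: TAlg_fp_def)

text \<open>\<open>simplicial\<close> reads only the fields belonging to \<open>cat\<close>; the
  choice of products is invisible to it.\<close>

lemma simplicial_TAlg_fp: "simplicial (TAlg_fp C T) = simplicial (TAlg C T)"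
  by (simp add: simplicial_def simplicial_object_def)

lemma tcarr_prod_talg [simp]: "tcarr (prod_talg C T As) = prd C (map tcarr As)"
  by (simp add: prod_talg_def Let_def)

section \<open>Products of algebras\<close>

context algebras
begin

context
  fixes As :: "('o, 'm, 't) talg list"
  assumes As: "set As \<subseteq> Collect (t_algebra C T)"
begin

lemma As_alg: "j < length As \<Longrightarrow> t_algebra C T (As ! j)"
  using As nth_mem by blast

lemma As_carr: "set (map tcarr As) \<subseteq> Ob C"
  using As t_algebraD(1) by fastforce

lemma As_carr_nth: "j < length As \<Longrightarrow> tcarr (As ! j) \<in> Ob C"
  using As_alg t_algebraD(1) by blast

lemma As_prj: "j < length As \<Longrightarrow> prj C (map tcarr As) j \<in> Hom C (prd C (map tcarr As)) (tcarr (As ! j))"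
  using prj_hom[OF As_carr, of j] by simp

abbreviation "PA \<equiv> prd C (map tcarr As)"

lemma pow_PA_ob: "pow n PA \<in> Ob C"
  by (rule prd_ob[OF set_replicate_ob[OF prd_ob[OF As_carr]]])

abbreviation "pow_prj n j \<equiv> pow_map n PA (tcarr (As ! j)) (prj C (map tcarr As) j)"

lemma pow_prj_hom:
  "j < length As \<Longrightarrow> pow_prj n j \<in> Hom C (pow n PA) (pow n (tcarr (As ! j)))"
  by (rule pow_map_hom[OF prd_ob[OF As_carr] As_carr_nth As_prj])

lemma prod_op_entry_hom:
  assumes "\<omega> \<in> Hom T n 1" "j < length As"
  shows "talg_op (As ! j) n \<omega> \<odot> pow_prj n j \<in> Hom C (pow n PA) (tcarr (As ! j))"
  by (rule cmp_in[OF pow_PA_ob talg_pow_ob[OF As_alg[OF assms(2)]] As_carr_nth[OF assms(2)] pow_prj_hom[OF assms(2)]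
        t_algebraD(2)[OF As_alg[OF assms(2)] assms(1)]])

lemma talg_op_prod:
  assumes "\<omega> \<in> Hom T n 1"
  shows "talg_op (prod_talg C T As) n \<omega> = tuple C (pow n PA) (map tcarr As)
    (map (\<lambda>j. talg_op (As ! j) n \<omega> \<odot> pow_prj n j) [0..<length As])"
proof -
  have "map (\<lambda>j. talg_op (As ! j) n \<omega> \<odot> pow_map n PA (map tcarr As ! j) (prj C (map tcarr As) j)) [0..<length As]
    = map (\<lambda>j. talg_op (As ! j) n \<omega> \<odot> pow_prj n j) [0..<length As]"
    by simp
  then show ?thesis using assms by (simp only: prod_talg_def Let_def talg.simps if_True)
qed

lemma prod_op_hom:
  assumes "\<omega> \<in> Hom T n 1"
  shows "talg_op (prod_talg C T As) n \<omega> \<in> Hom C (pow n PA) PA"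
  unfolding talg_op_prod[OF assms]
  by (rule tuple_hom[OF pow_PA_ob As_carr]) (simp_all add: prod_op_entry_hom[OF assms])

end

end

context algebras_stage
begin

context
  fixes As :: "('o, 'm, 't) talg list"
  assumes As: "set As \<subseteq> Collect (t_algebra C T)"
begin

lemma prod_op_el:
  assumes "\<omega> \<in> Hom T n 1" "x \<in> el (pow n (PA As))"
  shows "talg_op (prod_talg C T As) n \<omega> \<odot> x \<in> el (PA As)"
  by (rule el_cmp[OF prod_op_hom[OF As assms(1)] assms(2) pow_PA_ob[OF As] prd_ob[OF As_carr[OF As]]])

lemma prj_prod_op:
  assumes \<omega>: "\<omega> \<in> Hom T n 1" and x: "x \<in> el (pow n (PA As))" and j: "j < length As"
  shows "prj C (map tcarr As) j \<odot> talg_op (prod_talg C T As) n \<omega> \<odot> x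
    = talg_op (As ! j) n \<omega> \<odot> pow_prj As n j \<odot> x"
proof -
  have "prj C (map tcarr As) j \<odot> talg_op (prod_talg C T As) n \<omega> \<odot> x
    = (talg_op (As ! j) n \<omega> \<odot> pow_prj As n j) \<odot> x"
    unfolding talg_op_prod[OF As \<omega>]
    using prj_tuple_el[OF x pow_PA_ob[OF As] As_carr[OF As],
        of "map (\<lambda>j. talg_op (As ! j) n \<omega> \<odot> pow_prj As n j) [0..<length As]" j]
      prod_op_entry_hom[OF As \<omega>] j by simp
  also have "\<dots> = talg_op (As ! j) n \<omega> \<odot> pow_prj As n j \<odot> x"
    by (rule el_assoc[OF x pow_prj_hom[OF As j] t_algebraD(2)[OF As_alg[OF As j] \<omega>] pow_PA_ob[OF As]
          talg_pow_ob[OF As_alg[OF As j]] As_carr_nth[OF As j]])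
  finally show ?thesis .
qed

lemma pow_prj_el:
  assumes "x \<in> el (pow n (PA As))" "j < length As"
  shows "pow_prj As n j \<odot> x \<in> el (pow n (tcarr (As ! j)))"
  by (rule el_cmp[OF pow_prj_hom[OF As assms(2)] assms(1) pow_PA_ob[OF As] talg_pow_ob[OF As_alg[OF As assms(2)]]])

lemma prj_pow_prj:
  assumes "x \<in> el (pow n (PA As))" "j < length As" "i < n"
  shows "prj C (replicate n (tcarr (As ! j))) i \<odot> pow_prj As n j \<odot> x
    = prj C (map tcarr As) j \<odot> prj C (replicate n (PA As)) i \<odot> x"
  by (rule prj_pow_map[OF prd_ob[OF As_carr[OF As]] As_carr_nth[OF As assms(2)] As_prj[OF As assms(2)] assms(1,3)])

lemma PA_el_eqI:
  assumes "x \<in> el (PA As)" "y \<in> el (PA As)"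
    "\<And>j. j < length As \<Longrightarrow> prj C (map tcarr As) j \<odot> x = prj C (map tcarr As) j \<odot> y"
  shows "x = y"
  by (rule prd_eqI[OF Y As_carr[OF As] assms(1,2)]) (simp add: assms(3))

end

end

context algebras
begin

text \<open>Each equational clause concerns arrows into a product, so it can be tested on the
  factors, where it becomes the same clause for the factor algebra.\<close>

lemma t_algebra_prod:
  assumes As: "set As \<subseteq> Collect (t_algebra C T)"
  shows "t_algebra C T (prod_talg C T As)"
  unfolding t_algebra_def tcarr_prod_talg
proof (intro conjI allI impI ballI)
  note PA_ob = prd_ob[OF As_carr[OF As]] and pPA_ob = pow_PA_ob[OF As]
  show "PA As \<in> Ob C" by (rule PA_ob)
  fix n
  show "talg_op (prod_talg C T As) n \<omega> \<in> Hom C (pow n (PA As)) (PA As)"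
    if "\<omega> \<in> Hom T n 1" for \<omega> by (rule prod_op_hom[OF As that])
  show "talg_op (prod_talg C T As) n \<omega> = undefined" if "\<omega> \<notin> Hom T n 1" for \<omega>
    using that by (simp add: prod_talg_def Let_def)
  show "talg_op (prod_talg C T As) n (lproj T n i) = prj C (replicate n (PA As)) i"
    if i: "i < n" for i
  proof (rule eq_by_elements[OF pPA_ob PA_ob prod_op_hom[OF As lproj_hom[OF i]]])
    show "prj C (replicate n (PA As)) i \<in> Hom C (pow n (PA As)) (PA As)"
      using prj_hom[OF set_replicate_ob[OF PA_ob], of i n] i by simp
    fix Y x assume a: "Y \<in> Ob C" "x \<in> Hom C Y (pow n (PA As))"
    interpret algebras_stage C T Y by (rule algebras_stage[OF a(1)])
    show "talg_op (prod_talg C T As) n (lproj T n i) \<odot> x = prj C (replicate n (PA As)) i \<odot> x"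
    proof (rule PA_el_eqI[OF As prod_op_el[OF As lproj_hom[OF i] a(2)] prj_pow_el[OF PA_ob a(2) i]])
      fix j assume j: "j < length As"
      show "prj C (map tcarr As) j \<odot> talg_op (prod_talg C T As) n (lproj T n i) \<odot> x
        = prj C (map tcarr As) j \<odot> prj C (replicate n (PA As)) i \<odot> x"
        unfolding prj_prod_op[OF As lproj_hom[OF i] a(2) j] t_algebraD(4)[OF As_alg[OF As j] i]
        by (rule prj_pow_prj[OF As a(2) j i])
    qed
  qed
  fix m \<tau> \<omega> assume \<tau>: "\<tau> \<in> Hom T n m" and \<omega>: "\<omega> \<in> Hom T m 1"
  let ?op = "talg_op (prod_talg C T As)"
  let ?t = "tuple C (pow n (PA As)) (replicate m (PA As)) (map (\<lambda>i. ?op n (lproj T m i \<odot>\<^bsub>T\<^esub> \<tau>)) [0..<m])"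
  have p: "lproj T m i \<odot>\<^bsub>T\<^esub> \<tau> \<in> Hom T n 1" if "i < m" for i by (rule T_cmp_in[OF \<tau> lproj_hom[OF that]])
  have hs: "map (\<lambda>i. ?op n (lproj T m i \<odot>\<^bsub>T\<^esub> \<tau>)) [0..<m] ! i
      \<in> Hom C (pow n (PA As)) (replicate m (PA As) ! i)" if "i < length (replicate m (PA As))" for i
    using that prod_op_hom[OF As p] by simp
  have t: "?t \<in> Hom C (pow n (PA As)) (pow m (PA As))"
    by (rule tuple_hom[OF pPA_ob set_replicate_ob[OF PA_ob] _ hs]) simp_all
  show "?op n (\<omega> \<odot>\<^bsub>T\<^esub> \<tau>) = ?op m \<omega> \<odot> ?t"
  proof (rule eq_by_elements[OF pPA_ob PA_ob prod_op_hom[OF As T_cmp_in[OF \<tau> \<omega>]]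
        cmp_in[OF pPA_ob pPA_ob PA_ob t prod_op_hom[OF As \<omega>]]])
    fix Y x assume a: "Y \<in> Ob C" "x \<in> Hom C Y (pow n (PA As))"
    interpret algebras_stage C T Y by (rule algebras_stage[OF a(1)])
    have tx: "?t \<odot> x \<in> el (pow m (PA As))" by (rule el_cmp[OF t a(2) pPA_ob pPA_ob])
    have "?op n (\<omega> \<odot>\<^bsub>T\<^esub> \<tau>) \<odot> x = ?op m \<omega> \<odot> ?t \<odot> x"
    proof (rule PA_el_eqI[OF As prod_op_el[OF As T_cmp_in[OF \<tau> \<omega>] a(2)] prod_op_el[OF As \<omega> tx]])
      fix j assume j: "j < length As"
      note px = pow_prj_el[OF As a(2) j]
      \<comment> \<open>Projecting to the factor \<open>j\<close> commutes with the interpretation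
        of \<tau>. On each coordinate \<open>i\<close> this is the definition of the operations of
        the product.\<close>
      have "op_tuple (As ! j) n m \<tau> \<odot> pow_prj As n j \<odot> x = pow_prj As m j \<odot> ?t \<odot> x"
      proof (rule pow_el_eqI[OF As_carr_nth[OF As j] op_tuple_el[OF As_alg[OF As j] \<tau> px] pow_prj_el[OF As tx j]])
        fix i assume i: "i < m"
        have "prj C (replicate m (PA As)) i \<odot> ?t \<odot> x = ?op n (lproj T m i \<odot>\<^bsub>T\<^esub> \<tau>) \<odot> x"
          using prj_tuple_el[OF a(2) pPA_ob set_replicate_ob[OF PA_ob] _ _ hs, of i] i by simp
        then show "prj C (replicate m (tcarr (As ! j))) i \<odot> op_tuple (As ! j) n m \<tau> \<odot> pow_prj As n j \<odot> x
          = prj C (replicate m (tcarr (As ! j))) i \<odot> pow_prj As m j \<odot> ?t \<odot> x"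
          by (simp add: prj_pow_prj[OF As tx j i] prj_op_tuple[OF As_alg[OF As j] \<tau> px i]
              prj_prod_op[OF As p[OF i] a(2) j])
      qed
      then show "prj C (map tcarr As) j \<odot> ?op n (\<omega> \<odot>\<^bsub>T\<^esub> \<tau>) \<odot> x = prj C (map tcarr As) j \<odot> ?op m \<omega> \<odot> ?t \<odot> x"
        by (simp add: prj_prod_op[OF As T_cmp_in[OF \<tau> \<omega>] a(2) j] prj_prod_op[OF As \<omega> tx j]
            op_cmp[OF As_alg[OF As j] \<tau> \<omega> px])
    qed
    then show "?op n (\<omega> \<odot>\<^bsub>T\<^esub> \<tau>) \<odot> x = (?op m \<omega> \<odot> ?t) \<odot> x"
      using el_assoc[OF a(2) t prod_op_hom[OF As \<omega>] pPA_ob pPA_ob PA_ob] by simp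
  qed
qed

lemma prod_talg_prj:
  assumes As: "set As \<subseteq> Collect (t_algebra C T)" and j: "j < length As"
  shows "prj C (map tcarr As) j \<in> Hom (TAlg C T) (prod_talg C T As) (As ! j)"
proof (rule TAlg_homI[OF t_algebra_prod[OF As] As_alg[OF As j]])
  show "prj C (map tcarr As) j \<in> Hom C (tcarr (prod_talg C T As)) (tcarr (As ! j))"
    using As_prj[OF As j] by simp
  fix Y n \<omega> x
  assume a: "Y \<in> Ob C" "\<omega> \<in> Hom T n 1" "x \<in> Hom C Y (pow n (tcarr (prod_talg C T As)))"
  interpret algebras_stage C T Y by (rule algebras_stage[OF a(1)])
  show "prj C (map tcarr As) j \<odot> talg_op (prod_talg C T As) n \<omega> \<odot> x = talg_op (As ! j) n \<omega>
    \<odot> pow_map n (tcarr (prod_talg C T As)) (tcarr (As ! j)) (prj C (map tcarr As) j) \<odot> x"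
    using prj_prod_op[OF As a(2) _ j] a(3) by simp
qed

lemma tuple_TAlg_hom:
  assumes As: "set As \<subseteq> Collect (t_algebra C T)" and X: "t_algebra C T X" and len: "length fs = length As"
    and fs: "\<And>j. j < length As \<Longrightarrow> fs ! j \<in> Hom (TAlg C T) X (As ! j)"
  shows "tuple C (tcarr X) (map tcarr As) fs \<in> Hom (TAlg C T) X (prod_talg C T As)"
proof (rule TAlg_homI[OF X t_algebra_prod[OF As]], unfold tcarr_prod_talg)
  let ?t = "tuple C (tcarr X) (map tcarr As) fs"
  note Xob = t_algebraD(1)[OF X] and PA_ob = prd_ob[OF As_carr[OF As]]
  have fh: "fs ! j \<in> Hom C (tcarr X) (map tcarr As ! j)" if "j < length (map tcarr As)" for j
    using fs[of j, THEN TAlg_homD(1)] that by simp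
  show t: "?t \<in> Hom C (tcarr X) (PA As)"
    by (rule tuple_hom[OF Xob As_carr[OF As] _ fh]) (simp_all add: len)
  fix Y n \<omega> x
  assume a: "Y \<in> Ob C" "\<omega> \<in> Hom T n 1" "x \<in> Hom C Y (pow n (tcarr X))"
  interpret algebras_stage C T Y by (rule algebras_stage[OF a(1)])
  note tx = pow_map_el[OF Xob PA_ob t a(3)] and ox = op_el[OF X a(2,3)]
  have pt: "prj C (map tcarr As) j \<odot> ?t \<odot> y = fs ! j \<odot> y" if "y \<in> el (tcarr X)" "j < length As" for y j
    by (rule prj_tuple_el[OF that(1) Xob As_carr[OF As] _ _ fh]) (simp_all add: len that)
  show "?t \<odot> talg_op X n \<omega> \<odot> x = talg_op (prod_talg C T As) n \<omega>
    \<odot> pow_map n (tcarr X) (PA As) ?t \<odot> x"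
  proof (rule PA_el_eqI[OF As el_cmp[OF t ox Xob PA_ob] prod_op_el[OF As a(2) tx]])
    fix j assume j: "j < length As"
    \<comment> \<open>On the factor \<open>j\<close> the tuple becomes \<open>fs ! j\<close>, also
      after passing to powers; it remains to use that \<open>fs ! j\<close> is a
      homomorphism.\<close>
    have "pow_map n (tcarr X) (tcarr (As ! j)) (fs ! j) \<odot> x
      = pow_prj As n j \<odot> pow_map n (tcarr X) (PA As) ?t \<odot> x"
    proof (rule pow_el_eqI[OF As_carr_nth[OF As j] _ pow_prj_el[OF As tx j]])
      show "pow_map n (tcarr X) (tcarr (As ! j)) (fs ! j) \<odot> x
        \<in> el (pow n (tcarr (As ! j)))"
        by (rule pow_map_el[OF Xob As_carr_nth[OF As j] _ a(3)]) (use fh j in simp)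
      fix i assume i: "i < n"
      show "prj C (replicate n (tcarr (As ! j))) i
          \<odot> pow_map n (tcarr X) (tcarr (As ! j)) (fs ! j) \<odot> x
        = prj C (replicate n (tcarr (As ! j))) i \<odot> pow_prj As n j
          \<odot> pow_map n (tcarr X) (PA As) ?t \<odot> x"
        using fh[of j] j by (simp add: prj_pow_prj[OF As tx j i] prj_pow_map[OF Xob PA_ob t a(3) i]
          prj_pow_map[OF Xob As_carr_nth[OF As j] _ a(3) i] pt[OF prj_pow_el[OF Xob a(3) i] j])
    qed
    then show "prj C (map tcarr As) j \<odot> ?t \<odot> talg_op X n \<omega> \<odot> x
      = prj C (map tcarr As) j \<odot> talg_op (prod_talg C T As) n \<omega>
        \<odot> pow_map n (tcarr X) (PA As) ?t \<odot> x"
      by (simp add: pt[OF ox j] prj_prod_op[OF As a(2) tx j] TAlg_hom_el[OF X As_alg[OF As j] fs[OF j] a(2,3)])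
  qed
qed

text \<open>Uniqueness already holds among all arrows of \<open>C\<close> between the carriers,
  hence among homomorphisms; existence rests on a tuple of homomorphisms being one.\<close>

lemma fp_category_TAlg: "fp_category (TAlg_fp C T)"
proof -
  have "category (TAlg_fp C T)"
    using category_TAlg by (simp add: category_def)
  moreover have "is_product (TAlg_fp C T) As (prod_talg C T As) (prj C (map tcarr As))"
    if "set As \<subseteq> Ob (TAlg C T)" for As
  proof -
    have As: "set As \<subseteq> Collect (t_algebra C T)" using that by auto
    show ?thesis
      unfolding is_product_def
    proof (intro conjI allI impI ballI)
      show "prod_talg C T As \<in> Ob (TAlg_fp C T)" using t_algebra_prod[OF As] by simp
      show "prj C (map tcarr As) i \<in> Hom (TAlg_fp C T) (prod_talg C T As) (As ! i)" if "i < length As" for i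
        using prod_talg_prj[OF As that] by simp
      fix X fs assume "X \<in> Ob (TAlg_fp C T)"
        and "length fs = length As \<and> (\<forall>i<length As. fs ! i \<in> Hom (TAlg_fp C T) X (As ! i))"
      then have X: "t_algebra C T X" and len: "length fs = length As"
        and fs: "\<And>i. i < length As \<Longrightarrow> fs ! i \<in> Hom (TAlg C T) X (As ! i)" by simp_all
      have fh: "fs ! j \<in> Hom C (tcarr X) (map tcarr As ! j)" if "j < length (map tcarr As)" for j
        using fs[of j, THEN TAlg_homD(1)] that by simp
      have len': "length fs = length (map tcarr As)" using len by simp
      let ?t = "tuple C (tcarr X) (map tcarr As) fs"
      show "\<exists>!h. h \<in> Hom (TAlg_fp C T) X (prod_talg C T As)
        \<and> (\<forall>i<length As. prj C (map tcarr As) i \<odot>\<^bsub>TAlg_fp C T\<^esub> h = fs ! i)"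
      proof (rule ex1I[of _ ?t])
        show "?t \<in> Hom (TAlg_fp C T) X (prod_talg C T As)
          \<and> (\<forall>i<length As. prj C (map tcarr As) i \<odot>\<^bsub>TAlg_fp C T\<^esub> ?t = fs ! i)"
          using tuple_TAlg_hom[OF As X len fs] prj_tuple[OF t_algebraD(1)[OF X] As_carr[OF As] len' fh] by simp
        fix h assume "h \<in> Hom (TAlg_fp C T) X (prod_talg C T As)
          \<and> (\<forall>i<length As. prj C (map tcarr As) i \<odot>\<^bsub>TAlg_fp C T\<^esub> h = fs ! i)"
        then have "h \<in> Hom C (tcarr X) (PA As)" "\<And>i. i < length As \<Longrightarrow> prj C (map tcarr As) i \<odot> h = fs ! i"
          using TAlg_homD(1)[of h C T X "prod_talg C T As"] by simp_all
        then show "h = ?t"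
          using tuple_unique[OF t_algebraD(1)[OF X] As_carr[OF As] len'] by simp
      qed
    qed
  qed
  ultimately show ?thesis
    by (simp add: fp_category_def fp_category_axioms_def)
qed

text \<open>The two sides are definite descriptions relative to different categories. They agree
  because the tuple of \<open>C\<close> is a homomorphism and so solves the description made among
  algebras.\<close>

lemma tuple_TAlg:
  assumes "set As \<subseteq> Collect (t_algebra C T)" "t_algebra C T X" "length fs = length As"
    and "\<And>j. j < length As \<Longrightarrow> fs ! j \<in> Hom (TAlg C T) X (As ! j)"
  shows "tuple (TAlg_fp C T) X As fs = tuple C (tcarr X) (map tcarr As) fs"
proof -
  interpret D: fp_category "TAlg_fp C T" by (rule fp_category_TAlg)
  have fh: "fs ! j \<in> Hom C (tcarr X) (map tcarr As ! j)" if "j < length (map tcarr As)" for j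
    using assms(4)[of j, THEN TAlg_homD(1)] that by simp
  show ?thesis
  proof (rule D.tuple_unique)
    show "tuple C (tcarr X) (map tcarr As) fs \<in> Hom (TAlg_fp C T) X (prd (TAlg_fp C T) As)"
      using tuple_TAlg_hom[OF assms] by simp
    show "prj (TAlg_fp C T) As i \<odot>\<^bsub>TAlg_fp C T\<^esub> tuple C (tcarr X) (map tcarr As) fs = fs ! i"
      if "i < length As" for i
      using prj_tuple[OF t_algebraD(1)[OF assms(2)] As_carr[OF assms(1)] _ fh] assms(3) that by simp
  qed (use assms in auto)
qed

end

section \<open>Towers of algebras compared with towers of carriers\<close>

lemma tower_cong: "(\<And>k. k \<le> n \<Longrightarrow> F k = G k) \<Longrightarrow> tower F n = tower G n"
  by (simp add: tower_def less_Suc_eq_le)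

lemma talg_underlying_sel [simp]:
  "lev (talg_underlying A) = (\<lambda>n. tcarr (lev A n))"
  "i \<le> Suc n \<Longrightarrow> face (talg_underlying A) (Suc n) i = face A (Suc n) i"
  "i \<le> n \<Longrightarrow> degen (talg_underlying A) n i = degen A n i"
  by (simp_all add: talg_underlying_def)

lemma entry_TAlg_fp: "entry (TAlg_fp C T) A n k = entry C (talg_underlying A) n k"
  by (simp add: entry_def map_tower)

context algebras
begin

lemma tower_tuple_TAlg:
  assumes A: "simplicial_object (TAlg C T) A" and X: "t_algebra C T X"
    and F: "\<And>k. k \<le> n \<Longrightarrow> F k \<in> Hom (TAlg C T) X (lev A k)"
  shows "tuple (TAlg_fp C T) X (tower (lev A) n) (tower F n)
    = tuple C (tcarr X) (tower (\<lambda>k. tcarr (lev A k)) n) (tower F n)"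
proof -
  have "set (tower (lev A) n) \<subseteq> Collect (t_algebra C T)"
    using simplicial_objectD(1)[OF A] by (auto simp: set_tower)
  then show ?thesis
    using tuple_TAlg[OF _ X, of "tower (lev A) n" "tower F n"] F
    by (simp add: map_tower less_Suc_eq_le)
qed

lemma simplicial_object_TAlg_fp: "simplicial_object (TAlg_fp C T) A \<longleftrightarrow> simplicial_object (TAlg C T) A"
  by (simp add: simplicial_object_def)

text \<open>On the left the tuples are formed among algebras, on the right, as in the definition of
  W_T, among carriers. The bounds on \<open>i\<close> make all components homomorphisms, so that
  \<open>tuple_TAlg\<close> applies to them.\<close>

lemma
  assumes A: "simplicial_object (TAlg C T) A"
  shows shift_face_TAlg_fp: "i \<le> Suc n \<Longrightarrow>
      shift_face (TAlg_fp C T) A (Suc n) i = shift_face C (talg_underlying A) (Suc n) i"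
    and shift_degen_TAlg_fp: "i \<le> n \<Longrightarrow>
      shift_degen (TAlg_fp C T) A n i = shift_degen C (talg_underlying A) n i"
proof -
  interpret D: fp_category "TAlg_fp C T" by (rule fp_category_TAlg)
  have A': "simplicial_object (TAlg_fp C T) A" using A by (simp add: simplicial_object_TAlg_fp)
  interpret D: fp_simplicial_stage "TAlg_fp C T" "lev A 0" A
    by (rule D.fp_simplicial_stage[OF simplicial_objectD(1)[OF A'] A'])
  have P: "t_algebra C T (prod_talg C T (tower (lev A) n))" for n
    using D.prd_ob[OF D.tower_ob[of n]] by simp
  have P': "tcarr (prod_talg C T (tower (lev A) n)) = prd C (tower (lev (talg_underlying A)) n)" for n
    by (simp add: map_tower)
  {
    assume i: "i \<le> Suc n"
    let ?F = "\<lambda>k. if k + i \<le> n then entry (TAlg_fp C T) A (Suc n) k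
      else face A (Suc k) (k + i - n) \<odot>\<^bsub>TAlg_fp C T\<^esub> entry (TAlg_fp C T) A (Suc n) (Suc k)"
    have F: "?F k \<in> Hom (TAlg_fp C T) (prd (TAlg_fp C T) (tower (lev A) (Suc n))) (lev A k)" if "k \<le> n" for k
      using that i
      by (auto simp del: TAlg_fp_sel intro!: D.cmp_in[OF _ _ _ D.entry_hom])
    have "shift_face (TAlg_fp C T) A (Suc n) i
      = tuple C (prd C (tower (lev (talg_underlying A)) (Suc n))) (tower (lev (talg_underlying A)) n) (tower ?F n)"
      unfolding shift_face_tower[OF i] TAlg_fp_sel
      using tower_tuple_TAlg[OF A P[of "Suc n"] F[unfolded TAlg_fp_sel], of n] unfolding P' TAlg_fp_sel by simp
    also have "tower ?F n = tower (\<lambda>k. if k + i \<le> n then entry C (talg_underlying A) (Suc n) k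
      else face (talg_underlying A) (Suc k) (k + i - n) \<odot> entry C (talg_underlying A) (Suc n) (Suc k)) n"
      by (rule tower_cong) (use i in \<open>simp add: entry_TAlg_fp\<close>)
    finally show "shift_face (TAlg_fp C T) A (Suc n) i = shift_face C (talg_underlying A) (Suc n) i"
      by (simp only: shift_face_tower[OF i])
  next
    assume i: "i \<le> n"
    let ?F = "\<lambda>k. if k + i \<le> n then entry (TAlg_fp C T) A n k
      else degen A (k - 1) (k + i - Suc n) \<odot>\<^bsub>TAlg_fp C T\<^esub> entry (TAlg_fp C T) A n (k - 1)"
    have F: "?F k \<in> Hom (TAlg_fp C T) (prd (TAlg_fp C T) (tower (lev A) n)) (lev A k)" if "k \<le> Suc n" for k
      using that i
      by (cases k) (auto simp del: TAlg_fp_sel intro!: D.cmp_in[OF _ _ _ D.entry_hom])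
    have "shift_degen (TAlg_fp C T) A n i
      = tuple C (prd C (tower (lev (talg_underlying A)) n)) (tower (lev (talg_underlying A)) (Suc n)) (tower ?F (Suc n))"
      unfolding shift_degen_tower[OF i] TAlg_fp_sel
      using tower_tuple_TAlg[OF A P[of n] F[unfolded TAlg_fp_sel], of "Suc n"] unfolding P' TAlg_fp_sel by simp
    also have "tower ?F (Suc n) = tower (\<lambda>k. if k + i \<le> n then entry C (talg_underlying A) n k
      else degen (talg_underlying A) (k - 1) (k + i - Suc n) \<odot> entry C (talg_underlying A) n (k - 1)) (Suc n)"
    proof (rule tower_cong)
      fix k assume "k \<le> Suc n"
      with i show "?F k = (if k + i \<le> n then entry C (talg_underlying A) n k
        else degen (talg_underlying A) (k - 1) (k + i - Suc n) \<odot> entry C (talg_underlying A) n (k - 1))"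
        by (cases k) (simp_all add: entry_TAlg_fp)
    qed
    finally show "shift_degen (TAlg_fp C T) A n i = shift_degen C (talg_underlying A) n i"
      by (simp only: shift_degen_tower[OF i])
  }
qed

lemma tower_map_TAlg_fp:
  assumes A: "simplicial_object (TAlg C T) A" and B: "simplicial_object (TAlg C T) B"
    and f: "\<And>n. f n \<in> Hom (TAlg C T) (lev A n) (lev B n)"
  shows "tower_map (TAlg_fp C T) A B f n = tower_map C (talg_underlying A) (talg_underlying B) f n"
proof -
  interpret D: fp_category "TAlg_fp C T" by (rule fp_category_TAlg)
  have A': "simplicial_object (TAlg_fp C T) A" using A by (simp add: simplicial_object_TAlg_fp)
  interpret D: fp_simplicial_stage "TAlg_fp C T" "lev A 0" A
    by (rule D.fp_simplicial_stage[OF simplicial_objectD(1)[OF A'] A'])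
  have P: "t_algebra C T (prod_talg C T (tower (lev A) n))"
    using D.prd_ob[OF D.tower_ob[of n]] by simp
  have eq: "map (\<lambda>i. tower f n ! i \<odot> prj (TAlg_fp C T) (tower (lev A) n) i) [0..<Suc n]
    = tower (\<lambda>k. f k \<odot> entry (TAlg_fp C T) A n k) n"
    by (rule tower_eqI) (simp_all add: entry_def del: upt_Suc)
  have F: "f k \<odot>\<^bsub>TAlg_fp C T\<^esub> entry (TAlg_fp C T) A n k
      \<in> Hom (TAlg_fp C T) (prd (TAlg_fp C T) (tower (lev A) n)) (lev B k)" if "k \<le> n" for k
    by (rule D.cmp_in[OF D.prd_ob[OF D.tower_ob] D.lev_ob _ D.entry_hom[OF that]])
      (use simplicial_objectD(1)[OF B] f in simp_all)
  have "tower_map (TAlg_fp C T) A B f n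
    = tuple (TAlg_fp C T) (prod_talg C T (tower (lev A) n)) (tower (lev B) n)
        (tower (\<lambda>k. f k \<odot> entry (TAlg_fp C T) A n k) n)"
    using eq by (simp add: tower_map_def prod_map_def del: upt_Suc)
  also have "\<dots> = tuple C (prd C (tower (lev (talg_underlying A)) n)) (tower (lev (talg_underlying B)) n)
        (tower (\<lambda>k. f k \<odot> entry (TAlg_fp C T) A n k) n)"
    using tower_tuple_TAlg[OF B P F[unfolded TAlg_fp_sel], of n] by (simp add: map_tower)
  also have "\<dots> = tower_map C (talg_underlying A) (talg_underlying B) f n"
    using eq by (simp add: tower_map_def prod_map_def map_tower del: upt_Suc)
  finally show ?thesis .
qed

lemma WT_eq_shift: "funct_eq (sTAlg C T) (sTAlg C T) (shift_funct (TAlg_fp C T)) (WT_funct C T)"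
proof (rule funct_eqI)
  interpret D: fp_category "TAlg_fp C T" by (rule fp_category_TAlg)
  show "is_functor (sTAlg C T) (sTAlg C T) (shift_funct (TAlg_fp C T))"
    using D.shift_functor by (simp add: simplicial_TAlg_fp)
next
  fix A assume "A \<in> Ob (sTAlg C T)"
  then have A: "simplicial_object (TAlg C T) A" by simp
  show "fob (WT_funct C T) A = shift_obj (TAlg_fp C T) A"
    unfolding WT_funct_def shift_funct_def funct.simps
    by (rule mk_sobj_cong) (simp_all add: shift_face_TAlg_fp[OF A] shift_degen_TAlg_fp[OF A])
next
  fix A B f assume "A \<in> Ob (sTAlg C T)" "B \<in> Ob (sTAlg C T)" "f \<in> Hom (sTAlg C T) A B"
  then show "fmap (WT_funct C T) A B f = fmap (shift_funct (TAlg_fp C T)) A B f"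
    by (auto simp: WT_funct_def shift_funct_def tower_map_TAlg_fp simplicial_homD(1))
qed

lemma WT_functor: "is_functor (sTAlg C T) (sTAlg C T) (WT_funct C T)"
  by (rule funct_eqD(2)[OF WT_eq_shift])

lemma WT_monad: "\<exists>\<eta> \<mu>. monad (sTAlg C T) (WT_funct C T) \<eta> \<mu>"
proof -
  interpret D: fp_category "TAlg_fp C T" by (rule fp_category_TAlg)
  show ?thesis
    using monad_cong[OF D.shift_monad[unfolded simplicial_TAlg_fp] WT_eq_shift] by blast
qed

end

section \<open>Group objects\<close>

lemma group_objectD:
  assumes "group_object C G"
  shows "gcarr G \<in> Ob C"
    and "gmult G \<in> Hom C (prd C [gcarr G, gcarr G]) (gcarr G)"
    and "gunit G \<in> Hom C (prd C []) (gcarr G)"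
    and "ginv G \<in> Hom C (gcarr G) (gcarr G)"
    and "\<lbrakk>X \<in> Ob C; a \<in> Hom C X (gcarr G); b \<in> Hom C X (gcarr G); c \<in> Hom C X (gcarr G)\<rbrakk>
      \<Longrightarrow> gtimes C G X (gtimes C G X a b) c = gtimes C G X a (gtimes C G X b c)"
    and "\<lbrakk>X \<in> Ob C; a \<in> Hom C X (gcarr G)\<rbrakk> \<Longrightarrow> gtimes C G X (gone C G X) a = a"
    and "\<lbrakk>X \<in> Ob C; a \<in> Hom C X (gcarr G)\<rbrakk> \<Longrightarrow> gtimes C G X a (gone C G X) = a"
    and "\<lbrakk>X \<in> Ob C; a \<in> Hom C X (gcarr G)\<rbrakk> \<Longrightarrow> gtimes C G X (ginv G \<odot>\<^bsub>C\<^esub> a) a = gone C G X"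
    and "\<lbrakk>X \<in> Ob C; a \<in> Hom C X (gcarr G)\<rbrakk> \<Longrightarrow> gtimes C G X a (ginv G \<odot>\<^bsub>C\<^esub> a) = gone C G X"
proof -
  note r = assms[unfolded group_object_def]
  show "gcarr G \<in> Ob C" "gmult G \<in> Hom C (prd C [gcarr G, gcarr G]) (gcarr G)"
    "gunit G \<in> Hom C (prd C []) (gcarr G)" "ginv G \<in> Hom C (gcarr G) (gcarr G)"
    using r by simp_all
  note r5 = r[THEN conjunct2, THEN conjunct2, THEN conjunct2, THEN conjunct2]
  show "\<lbrakk>X \<in> Ob C; a \<in> Hom C X (gcarr G); b \<in> Hom C X (gcarr G); c \<in> Hom C X (gcarr G)\<rbrakk>
      \<Longrightarrow> gtimes C G X (gtimes C G X a b) c = gtimes C G X a (gtimes C G X b c)"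
    using conjunct1[OF r5] by blast
  show "\<lbrakk>X \<in> Ob C; a \<in> Hom C X (gcarr G)\<rbrakk> \<Longrightarrow> gtimes C G X (gone C G X) a = a"
    "\<lbrakk>X \<in> Ob C; a \<in> Hom C X (gcarr G)\<rbrakk> \<Longrightarrow> gtimes C G X a (gone C G X) = a"
    "\<lbrakk>X \<in> Ob C; a \<in> Hom C X (gcarr G)\<rbrakk> \<Longrightarrow> gtimes C G X (ginv G \<odot>\<^bsub>C\<^esub> a) a = gone C G X"
    "\<lbrakk>X \<in> Ob C; a \<in> Hom C X (gcarr G)\<rbrakk> \<Longrightarrow> gtimes C G X a (ginv G \<odot>\<^bsub>C\<^esub> a) = gone C G X"
    using conjunct2[OF r5] by blast+
qed

lemma nth_pair_hom:
  assumes "x \<in> Hom C X a" "y \<in> Hom C X a" "i < length [a, a]"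
  shows "[x, y] ! i \<in> Hom C X ([a, a] ! i)"
  using assms by (auto simp: less_Suc_eq)

section \<open>Pairs and the multiplication of generalised elements\<close>

context fp_stage
begin

lemma pair_el:
  assumes "a \<in> Ob C" "x \<in> el a" "y \<in> el a"
  shows "tuple C Y [a, a] [x, y] \<in> el (prd C [a, a])"
  by (rule tuple_hom[OF Y]) (use assms in \<open>auto simp: less_Suc_eq\<close>)

lemma pair_cmp:
  assumes "a \<in> Ob C" "X \<in> Ob C" "x \<in> Hom C X a" "y \<in> Hom C X a" "z \<in> el X"
  shows "tuple C X [a, a] [x, y] \<odot> z = tuple C Y [a, a] [x \<odot> z, y \<odot> z]"
  using tuple_cmp[OF assms(5,2) _ _ nth_pair_hom[OF assms(3,4)]] assms(1) by simp

lemma pair_eqI: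
  assumes "a \<in> Ob C" "x \<in> el a" "y \<in> el a" "w \<in> el (prd C [a, a])"
    "prj C [a, a] 0 \<odot> w = x" "prj C [a, a] 1 \<odot> w = y"
  shows "w = tuple C Y [a, a] [x, y]"
  by (rule tuple_unique[OF Y, symmetric]) (use assms in \<open>auto simp: less_Suc_eq\<close>)

lemma prj_pair:
  assumes "a \<in> Ob C" "x \<in> el a" "y \<in> el a"
  shows "prj C [a, a] 0 \<odot> tuple C Y [a, a] [x, y] = x"
    "prj C [a, a] (Suc 0) \<odot> tuple C Y [a, a] [x, y] = y"
  using prj_tuple[OF Y _ _ nth_pair_hom[OF assms(2,3)], of 0]
    prj_tuple[OF Y _ _ nth_pair_hom[OF assms(2,3)], of 1] assms(1) by simp_all

lemma prod_map_pair:
  assumes "a \<in> Ob C" "b \<in> Ob C" "h \<in> Hom C a b" "x \<in> el a" "y \<in> el a"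
  shows "prod_map C [a, a] [b, b] [h, h] \<odot> tuple C Y [a, a] [x, y] = tuple C Y [b, b] [h \<odot> x, h \<odot> y]"
proof (rule pair_eqI[OF assms(2) el_cmp[OF assms(3,4,1,2)] el_cmp[OF assms(3,5,1,2)]])
  note p = pair_el[OF assms(1,4,5)]
  \<comment> \<open>Pairs are powers with exponent 2; rewriting them so makes the facts about
    \<open>pow_map\<close> available.\<close>
  have r: "[a, a] = replicate 2 a" "[b, b] = replicate 2 b" "[h, h] = replicate 2 h"
    by (simp_all add: numeral_2_eq_2)
  show "prod_map C [a, a] [b, b] [h, h] \<odot> tuple C Y [a, a] [x, y] \<in> el (prd C [b, b])"
    using pow_map_el[OF assms(1-3), of _ 2, folded r, OF p] .
  show "prj C [b, b] 0 \<odot> prod_map C [a, a] [b, b] [h, h] \<odot> tuple C Y [a, a] [x, y] = h \<odot> x"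
    using prj_pow_map[OF assms(1-3), of _ 2 0, folded r, OF p] prj_pair[OF assms(1,4,5)] by simp
  show "prj C [b, b] 1 \<odot> prod_map C [a, a] [b, b] [h, h] \<odot> tuple C Y [a, a] [x, y] = h \<odot> y"
    using prj_pow_map[OF assms(1-3), of _ 2 1, folded r, OF p] prj_pair[OF assms(1,4,5)] by simp
qed

lemma pair_ob: "a \<in> Ob C \<Longrightarrow> prd C [a, a] \<in> Ob C"
  by (rule prd_ob) simp

lemma gtimes_el:
  assumes "group_object C G" "x \<in> el (gcarr G)" "y \<in> el (gcarr G)"
  shows "gtimes C G Y x y \<in> el (gcarr G)"
  unfolding gtimes_def
  by (rule el_cmp[OF group_objectD(2)[OF assms(1)] pair_el[OF group_objectD(1)[OF assms(1)] assms(2,3)]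
        pair_ob[OF group_objectD(1)[OF assms(1)]] group_objectD(1)[OF assms(1)]])

lemma gone_el:
  assumes "group_object C G"
  shows "gone C G Y \<in> el (gcarr G)"
  unfolding gone_def
  by (rule el_cmp[OF group_objectD(3)[OF assms] tuple_hom[OF Y] prd_ob group_objectD(1)[OF assms]]) simp_all

lemma ginv_el:
  assumes "group_object C G" "x \<in> el (gcarr G)"
  shows "ginv G \<odot> x \<in> el (gcarr G)"
  by (rule el_cmp[OF group_objectD(4)[OF assms(1)] assms(2) group_objectD(1)[OF assms(1)] group_objectD(1)[OF assms(1)]])

text \<open>Naturality in the stage. The faces of W multiply entries at the stage formed by a whole
  tower; this evaluates such a product at an element.\<close>

lemma gtimes_cmp:
  assumes G: "group_object C G" and X: "X \<in> Ob C" and h: "a \<in> Hom C X (gcarr G)" "b \<in> Hom C X (gcarr G)"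
    and x: "x \<in> el X"
  shows "gtimes C G X a b \<odot> x = gtimes C G Y (a \<odot> x) (b \<odot> x)"
proof -
  interpret X: fp_stage C X by (rule fp_stage[OF X])
  note ob = group_objectD(1)[OF G]
  show ?thesis
    unfolding gtimes_def el_assoc[OF x X.pair_el[OF ob h] group_objectD(2)[OF G] X pair_ob[OF ob] ob]
      pair_cmp[OF ob X h x] ..
qed

lemma gone_cmp:
  assumes G: "group_object C G" and X: "X \<in> Ob C" and x: "x \<in> el X"
  shows "gone C G X \<odot> x = gone C G Y"
proof -
  have t: "tuple C X [] [] \<in> Hom C X (prd C [])" by (rule tuple_hom[OF X]) simp_all
  have "tuple C X [] [] \<odot> x = tuple C Y [] []" using tuple_cmp[OF x X, of "[]" "[]"] by simp
  then show ?thesis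
    unfolding gone_def using el_assoc[OF x t group_objectD(3)[OF G] X _ group_objectD(1)[OF G]] by simp
qed

end

lemma Grp_sel [simp]:
  "G \<in> Ob (Grp C) \<longleftrightarrow> group_object C G"
  "Idn (Grp C) G = Idn C (gcarr G)"
  "Cmp (Grp C) = Cmp C"
  by (simp_all add: Grp_def)

lemma Grp_homD:
  assumes "h \<in> Hom (Grp C) G H"
  shows "h \<in> Hom C (gcarr G) (gcarr H)"
    and "h \<odot>\<^bsub>C\<^esub> gmult G = gmult H \<odot>\<^bsub>C\<^esub> prod_map C [gcarr G, gcarr G] [gcarr H, gcarr H] [h, h]"
  using assms by (simp_all add: Grp_def)

lemma (in fp_category) pair_map_hom:
  assumes "a \<in> Ob C" "b \<in> Ob C" "h \<in> Hom C a b"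
  shows "prod_map C [a, a] [b, b] [h, h] \<in> Hom C (prd C [a, a]) (prd C [b, b])"
  using pow_map_hom[OF assms, of 2] by (simp add: numeral_2_eq_2)

text \<open>Any element of the chosen product of two copies is the pair of its projections, so the
  equation of arrows in \<open>Grp\<close> amounts to preservation of products of elements.\<close>

lemma (in fp_category) Grp_homI:
  assumes G: "group_object C G" and H: "group_object C H" and h: "h \<in> Hom C (gcarr G) (gcarr H)"
    and mult: "\<And>Y x y. \<lbrakk>Y \<in> Ob C; x \<in> Hom C Y (gcarr G); y \<in> Hom C Y (gcarr G)\<rbrakk>
      \<Longrightarrow> h \<odot> gtimes C G Y x y = gtimes C H Y (h \<odot> x) (h \<odot> y)"
  shows "h \<in> Hom (Grp C) G H"
proof -
  note ob = group_objectD(1)[OF G] group_objectD(1)[OF H]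
  have pob: "prd C [gcarr G, gcarr G] \<in> Ob C" "prd C [gcarr H, gcarr H] \<in> Ob C" using ob by simp_all
  have "h \<odot> gmult G = gmult H \<odot> prod_map C [gcarr G, gcarr G] [gcarr H, gcarr H] [h, h]"
  proof (rule cmp_eq_by_elements[OF pob(1) ob pob(2) group_objectD(2)[OF G] h pair_map_hom[OF ob h]
        group_objectD(2)[OF H]])
    fix Y w assume a: "Y \<in> Ob C" "w \<in> Hom C Y (prd C [gcarr G, gcarr G])"
    interpret fp_stage C Y by (rule fp_stage[OF a(1)])
    let ?x = "prj C [gcarr G, gcarr G] 0 \<odot> w" and ?y = "prj C [gcarr G, gcarr G] 1 \<odot> w"
    have xy: "?x \<in> el (gcarr G)" "?y \<in> el (gcarr G)"
      using prj_el[OF _ _ a(2), of 0] prj_el[OF _ _ a(2), of 1] ob by simp_all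
    have w: "w = tuple C Y [gcarr G, gcarr G] [?x, ?y]"
      by (rule pair_eqI[OF ob(1) xy a(2)]) simp_all
    show "h \<odot> gmult G \<odot> w = gmult H \<odot> prod_map C [gcarr G, gcarr G] [gcarr H, gcarr H] [h, h] \<odot> w"
      using mult[OF a(1) xy] prod_map_pair[OF ob h xy] w unfolding gtimes_def by simp
  qed
  then show ?thesis using h by (simp add: Grp_def)
qed

section \<open>Group homomorphisms on elements\<close>

context fp_stage
begin

lemma Grp_hom_mult:
  assumes G: "group_object C G" and H: "group_object C H" and h: "h \<in> Hom (Grp C) G H"
    and xy: "x \<in> el (gcarr G)" "y \<in> el (gcarr G)"
  shows "h \<odot> gtimes C G Y x y = gtimes C H Y (h \<odot> x) (h \<odot> y)"
proof -
  note ob = group_objectD(1)[OF G] group_objectD(1)[OF H]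
  show ?thesis
    unfolding gtimes_def prod_map_pair[OF ob Grp_homD(1)[OF h] xy, symmetric]
    by (rule cmp_eq_el[OF Grp_homD(2)[OF h] pair_el[OF ob(1) xy] group_objectD(2)[OF G] Grp_homD(1)[OF h]
          pair_map_hom[OF ob Grp_homD(1)[OF h]] group_objectD(2)[OF H] pair_ob[OF ob(1)] ob(1) pair_ob[OF ob(2)] ob(2)])
qed

lemma gtimes_left_cancel:
  assumes G: "group_object C G" and el: "x \<in> el (gcarr G)" "y \<in> el (gcarr G)" "z \<in> el (gcarr G)"
    and eq: "gtimes C G Y x y = gtimes C G Y x z"
  shows "y = z"
proof -
  note i = ginv_el[OF G el(1)]
  have "y = gtimes C G Y (ginv G \<odot> x) (gtimes C G Y x y)"
    using group_objectD(5)[OF G Y i el(1,2)] group_objectD(8)[OF G Y el(1)] group_objectD(6)[OF G Y el(2)] by simp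
  also have "\<dots> = z" unfolding eq
    using group_objectD(5)[OF G Y i el(1,3)] group_objectD(8)[OF G Y el(1)] group_objectD(6)[OF G Y el(3)] by simp
  finally show ?thesis .
qed

text \<open>\<open>Grp\<close> asks homomorphisms to preserve multiplication only; the unit follows
  by cancelling in h(1) h(1) = h(1) = h(1) 1.\<close>

lemma Grp_hom_one:
  assumes G: "group_object C G" and H: "group_object C H" and h: "h \<in> Hom (Grp C) G H"
  shows "h \<odot> gone C G Y = gone C H Y"
proof -
  note ob = group_objectD(1)[OF G] group_objectD(1)[OF H] and e = gone_el[OF G] gone_el[OF H]
  have he: "h \<odot> gone C G Y \<in> el (gcarr H)" by (rule el_cmp[OF Grp_homD(1)[OF h] e(1) ob])
  have "gtimes C H Y (h \<odot> gone C G Y) (h \<odot> gone C G Y) = gtimes C H Y (h \<odot> gone C G Y) (gone C H Y)"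
    using Grp_hom_mult[OF G H h e(1) e(1)] group_objectD(6)[OF G Y e(1)] group_objectD(7)[OF H Y he] by simp
  then show ?thesis by (rule gtimes_left_cancel[OF H he he e(2)])
qed

text \<open>Both sides are right inverses of \<open>h \<odot> x\<close>, and left cancellation makes
  these unique. The comparison map with the universal bundle is written with inverses, so faces,
  degeneracies and maps of simplicial groups have to respect them.\<close>

lemma Grp_hom_inv:
  assumes G: "group_object C G" and H: "group_object C H" and h: "h \<in> Hom (Grp C) G H"
    and x: "x \<in> el (gcarr G)"
  shows "h \<odot> ginv G \<odot> x = ginv H \<odot> h \<odot> x"
proof -
  note ob = group_objectD(1)[OF G] group_objectD(1)[OF H] and ix = ginv_el[OF G x]
  have hx: "h \<odot> x \<in> el (gcarr H)" and hix: "h \<odot> ginv G \<odot> x \<in> el (gcarr H)"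
    by (rule el_cmp[OF Grp_homD(1)[OF h] _ ob], rule x ix)+
  have "gtimes C H Y (h \<odot> x) (h \<odot> ginv G \<odot> x) = gtimes C H Y (h \<odot> x) (ginv H \<odot> h \<odot> x)"
    using Grp_hom_mult[OF G H h x ix] group_objectD(9)[OF G Y x] group_objectD(9)[OF H Y hx]
      Grp_hom_one[OF G H h] by simp
  then show ?thesis by (rule gtimes_left_cancel[OF H hx hix ginv_el[OF H hx]])
qed

end

lemma (in fp_category) category_Grp: "category (Grp C)"
proof (unfold_locales, simp_all)
  fix G assume G: "group_object C G"
  note ob = group_objectD(1)[OF G]
  show "Idn C (gcarr G) \<in> Hom (Grp C) G G"
  proof (rule Grp_homI[OF G G idn_in[OF ob]])
    fix Y x y assume a: "Y \<in> Ob C" "x \<in> Hom C Y (gcarr G)" "y \<in> Hom C Y (gcarr G)"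
    interpret fp_stage C Y by (rule fp_stage[OF a(1)])
    show "Idn C (gcarr G) \<odot> gtimes C G Y x y
      = gtimes C G Y (Idn C (gcarr G) \<odot> x) (Idn C (gcarr G) \<odot> y)"
      using idn_cmp[OF a(1) ob] a(2,3) gtimes_el[OF G a(2,3)] by simp
  qed
next
  fix G H K f g assume G: "group_object C G" and H: "group_object C H" and K: "group_object C K"
    and f: "f \<in> Hom (Grp C) G H" and g: "g \<in> Hom (Grp C) H K"
  note ob = group_objectD(1)[OF G] group_objectD(1)[OF H] group_objectD(1)[OF K]
    and h = Grp_homD(1)[OF f] Grp_homD(1)[OF g]
  show "g \<odot> f \<in> Hom (Grp C) G K"
  proof (rule Grp_homI[OF G K cmp_in[OF ob h]])
    fix Y x y assume a: "Y \<in> Ob C" "x \<in> Hom C Y (gcarr G)" "y \<in> Hom C Y (gcarr G)"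
    interpret fp_stage C Y by (rule fp_stage[OF a(1)])
    show "(g \<odot> f) \<odot> gtimes C G Y x y = gtimes C K Y ((g \<odot> f) \<odot> x) ((g \<odot> f) \<odot> y)"
      unfolding el_assoc[OF gtimes_el[OF G a(2,3)] h ob] el_assoc[OF a(2) h ob] el_assoc[OF a(3) h ob]
        Grp_hom_mult[OF G H f a(2,3)]
        Grp_hom_mult[OF H K g el_cmp[OF h(1) a(2) ob(1,2)] el_cmp[OF h(1) a(3) ob(1,2)]] ..
  qed
next
  fix G H f assume G: "group_object C G" and H: "group_object C H" and f: "f \<in> Hom (Grp C) G H"
  note ob = group_objectD(1)[OF G] group_objectD(1)[OF H] and h = Grp_homD(1)[OF f]
  show "f \<odot> Idn C (gcarr G) = f" by (rule cmp_idn[OF ob h])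
  show "Idn C (gcarr H) \<odot> f = f" by (rule idn_cmp[OF ob h])
next
  fix G G1 G2 G3 f g h
  assume A: "group_object C G" "group_object C G1" "group_object C G2" "group_object C G3"
    "f \<in> Hom (Grp C) G G1" "g \<in> Hom (Grp C) G1 G2" "h \<in> Hom (Grp C) G2 G3"
  show "(h \<odot> g) \<odot> f = h \<odot> g \<odot> f"
    by (rule cmp_assoc[OF A(1-4)[THEN group_objectD(1)] A(5-7)[THEN Grp_homD(1)]])
qed

lemma (in fp_category) grp_forget_functor: "is_functor (Grp C) C grp_forget"
  by (rule is_functorI)
    (simp_all add: grp_forget_def category_Grp category_axioms group_objectD(1) Grp_homD(1))

lemma (in fp_category) U_functor: "is_functor (sGrp C) (simplicial C) U_funct"
  unfolding U_funct_def by (rule levelwise_functor[OF grp_forget_functor])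

section \<open>The universal bundle of a simplicial group\<close>

lemma U_obj_sel [simp]:
  "lev (fob U_funct G) = (\<lambda>n. gcarr (lev G n))"
  "i \<le> Suc n \<Longrightarrow> face (fob U_funct G) (Suc n) i = face G (Suc n) i"
  "i \<le> n \<Longrightarrow> degen (fob U_funct G) n i = degen G n i"
  by (simp_all add: U_funct_def levelwise_def grp_forget_def)

text \<open>The product entry stands at level \<open>n - i\<close>. The last face needs no formula
  of its own in this form: for \<open>i = Suc n\<close> every level satisfies
  \<open>k + i > n\<close>.\<close>

lemma W_face_tower:
  assumes "i \<le> Suc n"
  shows "W_face C G (Suc n) i
    = tuple C (prd C (tower (lev (fob U_funct G)) (Suc n))) (tower (lev (fob U_funct G)) n)
      (tower (\<lambda>k. if k + i < n then entry C (fob U_funct G) (Suc n) k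
        else if k + i = n then gtimes C (lev G k) (prd C (tower (lev (fob U_funct G)) (Suc n)))
          (face (fob U_funct G) (Suc k) 0 \<odot>\<^bsub>C\<^esub> entry C (fob U_funct G) (Suc n) (Suc k))
          (entry C (fob U_funct G) (Suc n) k)
        else face (fob U_funct G) (Suc k) (k + i - n) \<odot>\<^bsub>C\<^esub> entry C (fob U_funct G) (Suc n) (Suc k)) n)"
    (is "_ = tuple C ?P ?t (tower ?F n)")
proof -
  let ?X = "fob U_funct G" and ?g = "entry C (fob U_funct G) (Suc n)"
  have "(if i < Suc n then
         map (\<lambda>j. face ?X (Suc n - j) (i - j) \<odot>\<^bsub>C\<^esub> ?g (Suc n - j)) [0..<i]
         @ [gtimes C (lev G (Suc n - i - 1)) ?P (face ?X (Suc n - i) 0 \<odot>\<^bsub>C\<^esub> ?g (Suc n - i)) (?g (Suc n - i - 1))]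
         @ map ?g (rev [0..<Suc n - i - 1])
       else map (\<lambda>j. face ?X (Suc n - j) (Suc n - j) \<odot>\<^bsub>C\<^esub> ?g (Suc n - j)) [0..<Suc n]) = tower ?F n"
    (is "?l = _")
  proof (rule tower_eqI)
    show "length ?l = Suc n" using assms by (simp del: upt_Suc)
    fix j assume j: "j \<le> n"
    consider "i = Suc n" | "i \<le> n" "j < i" | "i \<le> n" "j = i" | "i \<le> n" "i < j" using assms by linarith
    then show "?l ! j = ?F (n - j)"
    proof cases
      case 1
      obtain k where "n = j + k" using j le_Suc_ex by blast
      with 1 show ?thesis by (simp del: upt_Suc U_obj_sel)
    next
      case 2
      then show ?thesis using j by (auto simp: nth_append Suc_diff_le simp del: U_obj_sel)
    next
      case 3
      then show ?thesis using j by (simp add: nth_append Suc_diff_le del: U_obj_sel)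
    next
      case 4
      then obtain l where l: "j = Suc i + l" using Suc_leI le_Suc_ex by blast
      then obtain k where "n = Suc i + l + k" using j le_Suc_ex by blast
      with l show ?thesis by (simp add: nth_append rev_nth nth_Cons' del: U_obj_sel upt_Suc)
    qed
  qed
  then show ?thesis by (simp add: W_face_def Let_def del: upt_Suc U_obj_sel)
qed

text \<open>The inserted unit is in position \<open>i + 1\<close> of a tower with top level
  \<open>Suc n\<close>, hence at level \<open>n - i\<close>; above it \<open>k\<close> is positive,
  so \<open>k - 1\<close> is not truncated.\<close>

lemma W_degen_tower:
  assumes "i \<le> n"
  shows "W_degen C G n i
    = tuple C (prd C (tower (lev (fob U_funct G)) n)) (tower (lev (fob U_funct G)) (Suc n))
      (tower (\<lambda>k. if k + i < n then entry C (fob U_funct G) n k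
        else if k + i = n then gone C (lev G k) (prd C (tower (lev (fob U_funct G)) n))
        else degen (fob U_funct G) (k - 1) (k + i - Suc n) \<odot>\<^bsub>C\<^esub> entry C (fob U_funct G) n (k - 1)) (Suc n))"
    (is "_ = tuple C ?P ?t (tower ?F (Suc n))")
proof -
  let ?X = "fob U_funct G" and ?g = "entry C (fob U_funct G) n"
  have "map (\<lambda>j. degen ?X (n - j) (i - j) \<odot>\<^bsub>C\<^esub> ?g (n - j)) [0..<i + 1]
       @ [gone C (lev G (n - i)) ?P] @ map ?g (rev [0..<n - i]) = tower ?F (Suc n)" (is "?l = _")
  proof (rule tower_eqI)
    show "length ?l = Suc (Suc n)" using assms by (simp del: upt_Suc)
    fix j assume j: "j \<le> Suc n"
    consider "j \<le> i" | "j = Suc i" | "Suc i < j" by linarith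
    then show "?l ! j = ?F (Suc n - j)"
    proof cases
      case 1
      then show ?thesis using j assms by (auto simp: nth_append Suc_diff_le simp del: U_obj_sel upt_Suc)
    next
      case 2
      then show ?thesis using j assms by (simp add: nth_append del: U_obj_sel upt_Suc)
    next
      case 3
      then obtain l where l: "j = Suc (Suc i) + l" using Suc_leI le_Suc_ex by blast
      then obtain k where "n = Suc (i + l) + k" using j le_Suc_ex[of "Suc (i + l)" n] by auto
      with l show ?thesis by (simp add: nth_append rev_nth nth_Cons' del: U_obj_sel upt_Suc)
    qed
  qed
  then show ?thesis by (simp only: W_degen_def Let_def Suc_eq_plus1)
qed

text \<open>
  The isomorphism from the shift model to the universal bundle sends \<open>(h\<^sub>n, \<dots>, h\<^sub>0)\<close> to the tuple with
  \<open>g\<^sub>n = h\<^sub>n\<close> and \<open>g\<^sub>k = (d\<^sub>0 h\<^sub>k\<^sub>+\<^sub>1)\<^sup>-\<^sup>1 h\<^sub>k\<close>; its inverse is given by the recursion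
  \<open>h\<^sub>n = g\<^sub>n\<close> and \<open>h\<^sub>k = d\<^sub>0 h\<^sub>k\<^sub>+\<^sub>1 g\<^sub>k\<close>.
\<close>

definition W_iso :: "('o, 'm, 'z) fpcat_scheme \<Rightarrow> (('o, 'm) grp, 'm) sobj \<Rightarrow> nat \<Rightarrow> 'm" where
  "W_iso C G n = (let X = fob U_funct G; P = prd C (tower (lev X) n) in
    tuple C P (tower (lev X) n) (tower (\<lambda>k. if k = n then entry C X n n
      else gtimes C (lev G k) P
        (ginv (lev G k) \<odot>\<^bsub>C\<^esub> (face X (Suc k) 0 \<odot>\<^bsub>C\<^esub> entry C X n (Suc k))) (entry C X n k)) n))"

text \<open>The recursion starts at the top of the tower, so the last argument counts downwards: at
  \<open>m\<close> the value is the arrow giving h_(n-m).\<close>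

primrec W_inv_entry ::
  "('o, 'm, 'z) fpcat_scheme \<Rightarrow> (('o, 'm) grp, 'm) sobj \<Rightarrow> nat \<Rightarrow> nat \<Rightarrow> 'm" where
  "W_inv_entry C G n 0 = entry C (fob U_funct G) n n"
| "W_inv_entry C G n (Suc m) = gtimes C (lev G (n - Suc m)) (prd C (tower (lev (fob U_funct G)) n))
    (face (fob U_funct G) (n - m) 0 \<odot>\<^bsub>C\<^esub> W_inv_entry C G n m) (entry C (fob U_funct G) n (n - Suc m))"

definition W_inv :: "('o, 'm, 'z) fpcat_scheme \<Rightarrow> (('o, 'm) grp, 'm) sobj \<Rightarrow> nat \<Rightarrow> 'm" where
  "W_inv C G n = (let X = fob U_funct G in
    tuple C (prd C (tower (lev X) n)) (tower (lev X) n) (tower (\<lambda>k. W_inv_entry C G n (n - k)) n))"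

lemma (in fp_category) U_simplicial:
  "simplicial_object (Grp C) G \<Longrightarrow> simplicial_object C (fob U_funct G)"
  using is_functorD(3)[OF U_functor, of G] by simp

locale grp_stage = fp_simplicial_stage C Y "fob U_funct G" for C (structure) and Y G +
  assumes G: "simplicial_object (Grp C) G"
begin

abbreviation "X \<equiv> fob U_funct G"
abbreviation mul where "mul k \<equiv> gtimes C (lev G k) Y"
abbreviation ivs where "ivs k x \<equiv> ginv (lev G k) \<odot> x"
abbreviation one where "one k \<equiv> gone C (lev G k) Y"

lemma grp [simp]: "group_object C (lev G k)"
  using simplicial_objectD(1)[OF G] by simp

lemma mul_el [simp]: "\<lbrakk>x \<in> el (L k); y \<in> el (L k)\<rbrakk> \<Longrightarrow> mul k x y \<in> el (L k)"
  using gtimes_el[OF grp] by simp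

lemma ivs_el [simp]: "x \<in> el (L k) \<Longrightarrow> ivs k x \<in> el (L k)"
  using ginv_el[OF grp] by simp

lemma one_el [simp]: "one k \<in> el (L k)"
  using gone_el[OF grp] by simp

lemma mul_assoc:
  "\<lbrakk>x \<in> el (L k); y \<in> el (L k); w \<in> el (L k)\<rbrakk> \<Longrightarrow> mul k (mul k x y) w = mul k x (mul k y w)"
  using group_objectD(5)[OF grp Y] by simp

lemma mul_laws [simp]:
  assumes "x \<in> el (L k)"
  shows "mul k (one k) x = x" "mul k x (one k) = x"
    "mul k (ivs k x) x = one k" "mul k x (ivs k x) = one k"
  using group_objectD(6-9)[OF grp Y] assms by simp_all

lemma mul_cancel [simp]:
  assumes "x \<in> el (L k)" "y \<in> el (L k)"
  shows "mul k x (mul k (ivs k x) y) = y" "mul k (ivs k x) (mul k x y) = y"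
  \<comment> \<open>\<open>U_obj_sel\<close> is disabled, here and often below, since it would
    rewrite \<open>lev X\<close>, \<open>face X\<close> and \<open>degen X\<close> out of the form
    in which the rules for elements are stated.\<close>
  using assms mul_assoc[OF assms(1) ivs_el[OF assms(1)] assms(2)]
    mul_assoc[OF ivs_el[OF assms(1)] assms] by (simp_all del: U_obj_sel)

text \<open>With d_0 h_(k+1) for \<open>y\<close>, this is the cancellation that merges two
  neighbouring entries of the bundle into one.\<close>

lemma mul_cancel_middle:
  assumes "x \<in> el (L k)" "y \<in> el (L k)" "w \<in> el (L k)"
  shows "mul k (mul k x y) (mul k (ivs k y) w) = mul k x w"
  using assms mul_assoc[OF assms(1,2) mul_el[OF ivs_el[OF assms(2)] assms(3)]] by (simp del: U_obj_sel)

lemma face_mul: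
  assumes "i \<le> Suc k"
  shows "\<lbrakk>x \<in> el (L (Suc k)); y \<in> el (L (Suc k))\<rbrakk>
      \<Longrightarrow> face X (Suc k) i \<odot> mul (Suc k) x y = mul k (face X (Suc k) i \<odot> x) (face X (Suc k) i \<odot> y)"
    and "x \<in> el (L (Suc k)) \<Longrightarrow> face X (Suc k) i \<odot> ivs (Suc k) x = ivs k (face X (Suc k) i \<odot> x)"
  using Grp_hom_mult[OF grp grp simplicial_objectD(2)[OF G assms]]
    Grp_hom_inv[OF grp grp simplicial_objectD(2)[OF G assms]] assms by simp_all

lemma degen_mul:
  assumes "i \<le> k"
  shows "\<lbrakk>x \<in> el (L k); y \<in> el (L k)\<rbrakk>
      \<Longrightarrow> degen X k i \<odot> mul k x y = mul (Suc k) (degen X k i \<odot> x) (degen X k i \<odot> y)"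
    and "x \<in> el (L k) \<Longrightarrow> degen X k i \<odot> ivs k x = ivs (Suc k) (degen X k i \<odot> x)"
  using Grp_hom_mult[OF grp grp simplicial_objectD(3)[OF G assms]]
    Grp_hom_inv[OF grp grp simplicial_objectD(3)[OF G assms]] assms by simp_all

lemma gtimes_el_cmp:
  assumes "Z \<in> Ob C" "a \<in> Hom C Z (L k)" "b \<in> Hom C Z (L k)" "x \<in> el Z"
  shows "gtimes C (lev G k) Z a b \<odot> x = mul k (a \<odot> x) (b \<odot> x)"
  by (rule gtimes_cmp[OF grp]) (use assms in simp_all)

lemma gtimes_hom:
  assumes "Z \<in> Ob C" "a \<in> Hom C Z (L k)" "b \<in> Hom C Z (L k)"
  shows "gtimes C (lev G k) Z a b \<in> Hom C Z (L k)"
  using fp_stage.gtimes_el[OF fp_stage[OF assms(1)] grp] assms by simp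

lemma gone_hom: "Z \<in> Ob C \<Longrightarrow> gone C (lev G k) Z \<in> Hom C Z (L k)"
  using fp_stage.gone_el[OF fp_stage grp] by simp

lemma ginv_hom: "ginv (lev G k) \<in> Hom C (L k) (L k)"
  using group_objectD(4)[OF grp] by simp

lemma P_ob [simp]: "P n \<in> Ob C"
  by (rule prd_ob[OF tower_ob])

lemma face_entry_hom:
  "\<lbrakk>i \<le> Suc k; Suc k \<le> n\<rbrakk> \<Longrightarrow> face X (Suc k) i \<odot> e n (Suc k) \<in> Hom C (P n) (L k)"
  by (rule cmp_in[OF P_ob lev_ob lev_ob entry_hom face_hom])

lemma degen_entry_hom:
  "\<lbrakk>i \<le> k; k \<le> n\<rbrakk> \<Longrightarrow> degen X k i \<odot> e n k \<in> Hom C (P n) (L (Suc k))"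
  by (rule cmp_in[OF P_ob lev_ob lev_ob entry_hom degen_hom])

lemma face_entry_cmp:
  "\<lbrakk>i \<le> Suc k; Suc k \<le> n; x \<in> el (P n)\<rbrakk>
    \<Longrightarrow> (face X (Suc k) i \<odot> e n (Suc k)) \<odot> x = face X (Suc k) i \<odot> e n (Suc k) \<odot> x"
  by (rule el_assoc[OF _ entry_hom face_hom P_ob lev_ob lev_ob])

lemma degen_entry_cmp:
  "\<lbrakk>i \<le> k; k \<le> n; x \<in> el (P n)\<rbrakk>
    \<Longrightarrow> (degen X k i \<odot> e n k) \<odot> x = degen X k i \<odot> e n k \<odot> x"
  by (rule el_assoc[OF _ entry_hom degen_hom P_ob lev_ob lev_ob])

section \<open>The universal bundle and the comparison map, entry by entry\<close>

lemma W_face_entries: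
  assumes "i \<le> Suc n" "k \<le> n"
  shows "(if k + i < n then e (Suc n) k
    else if k + i = n then gtimes C (lev G k) (P (Suc n)) (face X (Suc k) 0 \<odot> e (Suc n) (Suc k)) (e (Suc n) k)
    else face X (Suc k) (k + i - n) \<odot> e (Suc n) (Suc k)) \<in> Hom C (P (Suc n)) (L k)"
  using assms by (auto simp del: U_obj_sel intro!: face_entry_hom gtimes_hom)

lemma W_degen_entries:
  assumes "i \<le> n" "k \<le> Suc n"
  shows "(if k + i < n then e n k else if k + i = n then gone C (lev G k) (P n)
    else degen X (k - 1) (k + i - Suc n) \<odot> e n (k - 1)) \<in> Hom C (P n) (L k)"
  using assms by (cases k) (auto simp del: U_obj_sel intro!: degen_entry_hom gone_hom)

lemma W_face_hom: "i \<le> Suc n \<Longrightarrow> W_face C G (Suc n) i \<in> Hom C (P (Suc n)) (P n)"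
  unfolding W_face_tower by (rule tower_tuple_hom[OF P_ob W_face_entries])

lemma W_degen_hom: "i \<le> n \<Longrightarrow> W_degen C G n i \<in> Hom C (P n) (P (Suc n))"
  unfolding W_degen_tower by (rule tower_tuple_hom[OF P_ob W_degen_entries])

lemma W_face_el [simp]: "\<lbrakk>i \<le> Suc n; x \<in> el (P (Suc n))\<rbrakk> \<Longrightarrow> W_face C G (Suc n) i \<odot> x \<in> el (P n)"
  by (rule el_cmp[OF W_face_hom _ P_ob P_ob])

lemma W_degen_el [simp]: "\<lbrakk>i \<le> n; x \<in> el (P n)\<rbrakk> \<Longrightarrow> W_degen C G n i \<odot> x \<in> el (P (Suc n))"
  by (rule el_cmp[OF W_degen_hom _ P_ob P_ob])

lemma entry_W_face:
  assumes i: "i \<le> Suc n" and k: "k \<le> n" and x: "x \<in> el (P (Suc n))"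
  shows "e n k \<odot> W_face C G (Suc n) i \<odot> x = (if k + i < n then e (Suc n) k \<odot> x
    else if k + i = n then mul k (face X (Suc k) 0 \<odot> e (Suc n) (Suc k) \<odot> x) (e (Suc n) k \<odot> x)
    else face X (Suc k) (k + i - n) \<odot> e (Suc n) (Suc k) \<odot> x)"
  unfolding W_face_tower[OF i]
  by (subst entry_tower_tuple[OF x P_ob W_face_entries[OF i] k])
    (use i k x in \<open>simp_all add: gtimes_el_cmp face_entry_hom face_entry_cmp del: U_obj_sel\<close>)

lemma entry_W_degen:
  assumes i: "i \<le> n" and k: "k \<le> Suc n" and x: "x \<in> el (P n)"
  shows "e (Suc n) k \<odot> W_degen C G n i \<odot> x = (if k + i < n then e n k \<odot> x
    else if k + i = n then one k else degen X (k - 1) (k + i - Suc n) \<odot> e n (k - 1) \<odot> x)"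
  unfolding W_degen_tower[OF i]
  by (subst entry_tower_tuple[OF x P_ob W_degen_entries[OF i] k], assumption)
    (use i k x in \<open>cases k; auto simp: gone_cmp degen_entry_cmp simp del: U_obj_sel\<close>)

lemma W_iso_entries:
  assumes "k \<le> n"
  shows "(if k = n then e n n else gtimes C (lev G k) (P n)
        (ginv (lev G k) \<odot> (face X (Suc k) 0 \<odot> e n (Suc k))) (e n k)) \<in> Hom C (P n) (L k)"
  using assms by (auto simp del: U_obj_sel
      intro!: face_entry_hom gtimes_hom cmp_in[OF P_ob lev_ob lev_ob _ ginv_hom])

lemma W_iso_hom: "W_iso C G n \<in> Hom C (P n) (P n)"
  unfolding W_iso_def Let_def by (rule tower_tuple_hom[OF P_ob W_iso_entries])

lemma W_iso_el [simp]: "x \<in> el (P n) \<Longrightarrow> W_iso C G n \<odot> x \<in> el (P n)"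
  by (rule el_cmp[OF W_iso_hom _ P_ob P_ob])

lemma entry_W_iso:
  assumes x: "x \<in> el (P n)" and k: "k \<le> n"
  shows "e n k \<odot> W_iso C G n \<odot> x = (if k = n then e n n \<odot> x
    else mul k (ivs k (face X (Suc k) 0 \<odot> e n (Suc k) \<odot> x)) (e n k \<odot> x))"
proof -
  have iv: "(ginv (lev G k) \<odot> (face X (Suc k) 0 \<odot> e n (Suc k))) \<odot> x
    = ivs k (face X (Suc k) 0 \<odot> e n (Suc k) \<odot> x)" if "k < n"
    using that el_assoc[OF x face_entry_hom ginv_hom P_ob lev_ob lev_ob, of 0 k] x
    by (simp add: face_entry_cmp del: U_obj_sel)
  show ?thesis
    unfolding W_iso_def Let_def
    by (subst entry_tower_tuple[OF x P_ob W_iso_entries k], assumption)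
      (use k x iv in \<open>auto simp: gtimes_el_cmp face_entry_hom cmp_in[OF P_ob lev_ob lev_ob face_entry_hom ginv_hom]
        simp del: U_obj_sel\<close>)
qed

lemma W_inv_entry_hom: "m \<le> n \<Longrightarrow> W_inv_entry C G n m \<in> Hom C (P n) (L (n - m))"
proof (induction m)
  case (Suc m)
  then have n: "n - m = Suc (n - Suc m)" by simp
  have "face X (n - m) 0 \<odot> W_inv_entry C G n m \<in> Hom C (P n) (L (n - Suc m))"
    using Suc cmp_in[OF P_ob lev_ob lev_ob _ face_hom, of _ n "n - Suc m" 0]
    by (simp add: n del: U_obj_sel)
  then show ?case using Suc by (simp add: gtimes_hom del: U_obj_sel)
qed (simp del: U_obj_sel)

lemma W_inv_hom: "W_inv C G n \<in> Hom C (P n) (P n)"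
proof -
  have "W_inv_entry C G n (n - k) \<in> Hom C (P n) (L k)" if "k \<le> n" for k
    using W_inv_entry_hom[of "n - k" n] that by simp
  then show ?thesis unfolding W_inv_def Let_def by (rule tower_tuple_hom[OF P_ob])
qed

lemma W_inv_el [simp]: "x \<in> el (P n) \<Longrightarrow> W_inv C G n \<odot> x \<in> el (P n)"
  by (rule el_cmp[OF W_inv_hom _ P_ob P_ob])

lemma entry_W_inv:
  assumes x: "x \<in> el (P n)" and k: "k \<le> n"
  shows "e n k \<odot> W_inv C G n \<odot> x = W_inv_entry C G n (n - k) \<odot> x"
proof -
  have "W_inv_entry C G n (n - k) \<in> Hom C (P n) (L k)" if "k \<le> n" for k
    using W_inv_entry_hom[of "n - k" n] that by simp
  then show ?thesis unfolding W_inv_def Let_def by (rule entry_tower_tuple[OF x P_ob _ k])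
qed

lemma entry_W_inv_top: "x \<in> el (P n) \<Longrightarrow> e n n \<odot> W_inv C G n \<odot> x = e n n \<odot> x"
  using entry_W_inv[of x n n] by (simp del: U_obj_sel)

lemma entry_W_inv_less:
  assumes x: "x \<in> el (P n)" and k: "k < n"
  shows "e n k \<odot> W_inv C G n \<odot> x
    = mul k (face X (Suc k) 0 \<odot> e n (Suc k) \<odot> W_inv C G n \<odot> x) (e n k \<odot> x)"
proof -
  have n: "n - k = Suc (n - Suc k)" "n - Suc (n - Suc k) = k" "n - (n - Suc k) = Suc k" using k by simp_all
  have b: "W_inv_entry C G n (n - Suc k) \<in> Hom C (P n) (L (Suc k))"
    using W_inv_entry_hom[of "n - Suc k" n] n k by (simp del: U_obj_sel)
  have fb: "face X (Suc k) 0 \<odot> W_inv_entry C G n (n - Suc k) \<in> Hom C (P n) (L k)"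
    by (rule cmp_in[OF P_ob lev_ob lev_ob b face_hom]) simp
  have "e n k \<odot> W_inv C G n \<odot> x
    = gtimes C (lev G k) (P n) (face X (Suc k) 0 \<odot> W_inv_entry C G n (n - Suc k)) (e n k) \<odot> x"
    using entry_W_inv[OF x, of k] k unfolding n(1) W_inv_entry.simps n(2,3) by simp
  also have "\<dots> = mul k ((face X (Suc k) 0 \<odot> W_inv_entry C G n (n - Suc k)) \<odot> x) (e n k \<odot> x)"
    by (rule gtimes_el_cmp[OF P_ob fb _ x]) (use k in \<open>simp del: U_obj_sel\<close>)
  also have "(face X (Suc k) 0 \<odot> W_inv_entry C G n (n - Suc k)) \<odot> x
    = face X (Suc k) 0 \<odot> e n (Suc k) \<odot> W_inv C G n \<odot> x"
    using el_assoc[OF x b face_hom P_ob lev_ob lev_ob, of 0] entry_W_inv[OF x, of "Suc k"] k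
    by (simp del: U_obj_sel)
  finally show ?thesis .
qed

text \<open>\<open>entry_W_inv_less\<close> expresses an entry through the one above it, so the
  induction descends from the top level.\<close>

lemma W_inv_iso:
  assumes x: "x \<in> el (P n)"
  shows "W_inv C G n \<odot> W_iso C G n \<odot> x = x" (is "?l = ?r")
proof (rule tower_el_eqI[of _ n])
  fix k assume "k \<le> n"
  then show "e n k \<odot> ?l = e n k \<odot> ?r"
  proof (induction rule: inc_induct)
    case base
    then show ?case using x by (simp add: entry_W_inv_top entry_W_iso del: U_obj_sel)
  next
    case (step k)
    then show ?case using x by (simp add: entry_W_inv_less entry_W_iso del: U_obj_sel)
  qed
qed (use x in \<open>simp_all del: U_obj_sel\<close>)

text \<open>No induction in this direction: level \<open>k\<close> of \<open>W_iso\<close> involves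
  only the entries \<open>k\<close> and \<open>Suc k\<close> of the inverse, and one step of the
  recursion cancels against its inverse factor.\<close>

lemma W_iso_inv:
  assumes x: "x \<in> el (P n)"
  shows "W_iso C G n \<odot> W_inv C G n \<odot> x = x" (is "?l = ?r")
proof (rule tower_el_eqI[of _ n])
  fix k assume "k \<le> n"
  with x show "e n k \<odot> ?l = e n k \<odot> ?r"
    by (cases "k = n") (simp_all add: entry_W_iso entry_W_inv_top entry_W_inv_less del: U_obj_sel)
qed (use x in \<open>simp_all del: U_obj_sel\<close>)

text \<open>Faces are homomorphisms, so they act on (d_0 h_(k+1))^-1 h_k factorwise. The cases
  compare \<open>k\<close> with \<open>n - i\<close>, the one level at which W multiplies two
  entries; the top level is separate because \<open>W_iso\<close> leaves it unchanged.\<close>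

lemma W_iso_face:
  assumes i: "i \<le> Suc n" and x: "x \<in> el (P (Suc n))"
  shows "W_iso C G n \<odot> shift_face C X (Suc n) i \<odot> x = W_face C G (Suc n) i \<odot> W_iso C G (Suc n) \<odot> x" (is "?l = ?r")
proof (rule tower_el_eqI[of _ n])
  fix k assume k: "k \<le> n"
  note [simp del] = U_obj_sel
  note [simp] = entry_W_iso entry_W_face
  consider "k = n" | "k < n" "k + i < n" | "k < n" "k + i = n" | "k < n" "k + i > n" using k by linarith
  then show "e n k \<odot> ?l = e n k \<odot> ?r"
  proof cases
    case 1
    \<comment> \<open>For \<open>i = 0\<close> the bundle forms d_0 h_(n+1) times (d_0 h_(n+1))^-1
      h_n, which is the entry h_n kept by the shift.\<close>
    then show ?thesis using i x by (cases i) simp_all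
  next
    case 2
    then show ?thesis using i x by simp
  next
    case 3
    \<comment> \<open>The shift contributes (d_0 d_1 h_(k+2))^-1 h_k. In the bundle d_0 h_(k+1)
      cancels against its inverse and leaves (d_0 d_0 h_(k+2))^-1 h_k; the two agree by d_0 d_1 =
      d_0 d_0.\<close>
    then have "Suc (k + i) - n = Suc 0" by simp
    with 3 show ?thesis using i x
      by (simp add: face_mul mul_cancel_middle face_face[of 0 0, simplified])
  next
    case 4
    then have "Suc (k + i) - n = Suc (k + i - n)" by simp
    with 4 show ?thesis using i x by (simp add: face_mul face_face)
  qed
qed (use i x in \<open>simp_all del: U_obj_sel\<close>)

text \<open>At level \<open>n - i\<close> the shift has s_0 h_k followed by h_k, and (d_0 s_0
  h_k)^-1 h_k is the unit that W inserts. At higher levels degeneracies pass through products and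
  inverses.\<close>

lemma W_iso_degen:
  assumes i: "i \<le> n" and x: "x \<in> el (P n)"
  shows "W_iso C G (Suc n) \<odot> shift_degen C X n i \<odot> x = W_degen C G n i \<odot> W_iso C G n \<odot> x" (is "?l = ?r")
proof (rule tower_el_eqI[of _ "Suc n"])
  fix k assume k: "k \<le> Suc n"
  note [simp del] = U_obj_sel
  note [simp] = entry_W_iso entry_W_degen
  consider "k = Suc n" | "k \<le> n" "k + i < n" | "k \<le> n" "k + i = n" | "k \<le> n" "k + i > n"
    using k by linarith
  then show "e (Suc n) k \<odot> ?l = e (Suc n) k \<odot> ?r"
  proof cases
    case 1
    then show ?thesis using i x by simp
  next
    case 2
    then show ?thesis using i x by (cases k) simp_all
  next
    case 3
    then show ?thesis using i x by (cases k) (simp_all add: face_degen_same)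
  next
    case 4
    then obtain m where m: "k = Suc m" using i by (cases k) simp_all
    with 4 have "Suc (m + i) - n = Suc (m + i - n)" by simp
    with 4 m show ?thesis using i x by (simp add: degen_mul face_degen_less)
  qed
qed (use i x in \<open>simp_all del: U_obj_sel\<close>)

end

section \<open>The comparison map as an isomorphism of functors\<close>

context fp_category
begin

lemma grp_stage: "\<lbrakk>Y \<in> Ob C; simplicial_object (Grp C) G\<rbrakk> \<Longrightarrow> grp_stage C Y G"
  by (simp add: grp_stage_def grp_stage_axioms_def fp_simplicial_stage U_simplicial del: U_obj_sel)

text \<open>A map of simplicial groups commutes with d_0, products and inverses, of which
  \<open>W_iso\<close> is composed. The statement is levelwise on elements, hence available before W
  is known to act on maps.\<close>

lemma W_iso_natural:
  assumes G: "simplicial_object (Grp C) G" and H: "simplicial_object (Grp C) H"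
    and f: "f \<in> Hom (sGrp C) G H"
    and Y: "Y \<in> Ob C" and x: "x \<in> Hom C Y (prd C (tower (lev (fob U_funct G)) n))"
  shows "W_iso C H n \<odot> tower_map C (fob U_funct G) (fob U_funct H) f n \<odot> x
    = tower_map C (fob U_funct G) (fob U_funct H) f n \<odot> W_iso C G n \<odot> x"
proof -
  interpret G: grp_stage C Y G by (rule grp_stage[OF Y G])
  interpret H: grp_stage C Y H by (rule grp_stage[OF Y H])
  have Uf: "f \<in> Hom (simplicial C) (fob U_funct G) (fob U_funct H)"
    using is_functorD(4)[OF U_functor, of G H f] G H f by (simp add: U_funct_def levelwise_def grp_forget_def)
  note fh = simplicial_homD(1)[OF Uf]
  note [simp del] = U_obj_sel
  note [simp] = G.entry_W_iso H.entry_W_iso G.tower_map_el[OF H.lev_ob fh] G.entry_tower_map[OF H.lev_ob fh]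
    G.simplicial_hom_el[OF Uf G.X H.X]
  have m: "f k \<odot> G.mul k a b = H.mul k (f k \<odot> a) (f k \<odot> b)"
    if "a \<in> Hom C Y (G.L k)" "b \<in> Hom C Y (G.L k)" for k a b
    using G.Grp_hom_mult[OF G.grp H.grp simplicial_homD(1)[OF f]] that by (simp add: U_obj_sel)
  have iv: "f k \<odot> G.ivs k a = H.ivs k (f k \<odot> a)" if "a \<in> Hom C Y (G.L k)" for k a
    using G.Grp_hom_inv[OF G.grp H.grp simplicial_homD(1)[OF f]] that by (simp add: U_obj_sel)
  show ?thesis
  proof (rule H.tower_el_eqI[of _ n])
    fix k assume "k \<le> n"
    then consider "k = n" | "k < n" by linarith
    then show "H.e n k \<odot> W_iso C H n \<odot> tower_map C (fob U_funct G) (fob U_funct H) f n \<odot> x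
      = H.e n k \<odot> tower_map C (fob U_funct G) (fob U_funct H) f n \<odot> W_iso C G n \<odot> x"
      by cases (use x in \<open>simp_all add: m iv\<close>)
  qed (use x in simp_all)
qed

lemma W_iso_is_iso:
  assumes G: "simplicial_object (Grp C) G"
  shows "is_iso C (lev (shift_obj C (fob U_funct G)) n) (prd C (tower (lev (fob U_funct G)) n)) (W_iso C G n)"
proof -
  interpret G: grp_stage C "lev (fob U_funct G) n" G
    by (rule grp_stage[OF simplicial_objectD(1)[OF U_simplicial[OF G]] G])
  have "W_inv C G n \<odot> W_iso C G n = Idn C (G.P n)"
    by (rule cmp_eq_idn_by_elements[OF G.P_ob G.P_ob G.W_iso_hom G.W_inv_hom])
      (rule grp_stage.W_inv_iso[OF grp_stage[OF _ G]])
  moreover have "W_iso C G n \<odot> W_inv C G n = Idn C (G.P n)"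
    by (rule cmp_eq_idn_by_elements[OF G.P_ob G.P_ob G.W_inv_hom G.W_iso_hom])
      (rule grp_stage.W_iso_inv[OF grp_stage[OF _ G]])
  ultimately show ?thesis
    using G.W_iso_hom[of n] G.W_inv_hom[of n] by (auto simp: is_iso_def simp del: U_obj_sel)
qed

lemma W_obj:
  assumes G: "simplicial_object (Grp C) G"
  shows "simplicial_object C (fob (W_funct C) G)"
    and "W_iso C G \<in> Hom (simplicial C) (shift_obj C (fob U_funct G)) (fob (W_funct C) G)"
    and "is_iso (simplicial C) (shift_obj C (fob U_funct G)) (fob (W_funct C) G) (W_iso C G)"
proof -
  note gs = grp_stage[OF _ G] and gs0 = grp_stage[OF simplicial_objectD(1)[OF U_simplicial[OF G], of 0] G]
  note t = transport_simplicial[where X = "shift_obj C (fob U_funct G)" and \<alpha> = "W_iso C G"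
      and L = "\<lambda>n. prd C (tower (lev (fob U_funct G)) n)" and d = "W_face C G" and s = "W_degen C G",
      OF simplicial_shift_obj[OF U_simplicial[OF G]] grp_stage.P_ob[OF gs0] grp_stage.W_face_hom[OF gs0]
        grp_stage.W_degen_hom[OF gs0] W_iso_is_iso[OF G]]
  have d: "W_iso C G n \<odot> face (shift_obj C (fob U_funct G)) (Suc n) i \<odot> x
      = W_face C G (Suc n) i \<odot> W_iso C G (Suc n) \<odot> x"
    if "Y \<in> Ob C" "x \<in> Hom C Y (lev (shift_obj C (fob U_funct G)) (Suc n))" "i \<le> Suc n" for Y x n i
    using grp_stage.W_iso_face[OF gs[OF that(1)] that(3)] that(2,3) by (simp del: U_obj_sel)
  have s: "W_iso C G (Suc n) \<odot> degen (shift_obj C (fob U_funct G)) n i \<odot> x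
      = W_degen C G n i \<odot> W_iso C G n \<odot> x"
    if "Y \<in> Ob C" "x \<in> Hom C Y (lev (shift_obj C (fob U_funct G)) n)" "i \<le> n" for Y x n i
    using grp_stage.W_iso_degen[OF gs[OF that(1)] that(3)] that(2,3) by (simp del: U_obj_sel)
  show "simplicial_object C (fob (W_funct C) G)"
    "W_iso C G \<in> Hom (simplicial C) (shift_obj C (fob U_funct G)) (fob (W_funct C) G)"
    "is_iso (simplicial C) (shift_obj C (fob U_funct G)) (fob (W_funct C) G) (W_iso C G)"
    unfolding W_funct_def funct.simps
    by (rule t(1)[OF _ _ d s]; assumption) (rule t(2)[OF _ _ d s] t(3)[OF _ _ d s]; assumption)+
qed

lemma W_obj_sel [simp]:
  "lev (fob (W_funct C) G) n = prd C (tower (lev (fob U_funct G)) n)"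
  "i \<le> Suc n \<Longrightarrow> face (fob (W_funct C) G) (Suc n) i = W_face C G (Suc n) i"
  "i \<le> n \<Longrightarrow> degen (fob (W_funct C) G) n i = W_degen C G n i"
  by (simp_all add: W_funct_def)

lemma fmap_shift_U: "fmap (shift_funct C \<circ>\<^sub>F U_funct) G H f = tower_map C (fob U_funct G) (fob U_funct H) f"
  by (simp add: comp_funct_def shift_funct_def U_funct_def levelwise_def grp_forget_def)

lemma shift_U_functor: "is_functor (sGrp C) (simplicial C) (shift_funct C \<circ>\<^sub>F U_funct)"
  by (rule is_functor_comp[OF U_functor shift_functor])

text \<open>Conjugating the shifted map by the comparison isomorphisms gives a composite of
  simplicial maps, and by naturality this composite is the map induced on towers.\<close>

lemma W_map_simplicial:
  assumes G: "simplicial_object (Grp C) G" and H: "simplicial_object (Grp C) H"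
    and f: "f \<in> Hom (sGrp C) G H"
  shows "tower_map C (fob U_funct G) (fob U_funct H) f
    \<in> Hom (simplicial C) (fob (W_funct C) G) (fob (W_funct C) H)"
proof -
  let ?f = "tower_map C (fob U_funct G) (fob U_funct H) f"
  note S = simplicial_shift_obj[OF U_simplicial[OF G]] simplicial_shift_obj[OF U_simplicial[OF H]]
    and W = W_obj(1)[OF G] W_obj(1)[OF H]
  have f': "?f \<in> Hom (simplicial C) (shift_obj C (fob U_funct G)) (shift_obj C (fob U_funct H))"
    using is_functorD(4)[OF shift_U_functor, of G H f] G H f unfolding fmap_shift_U by (simp add: comp_funct_def)
  obtain \<beta> where \<beta>: "\<beta> \<in> Hom (simplicial C) (fob (W_funct C) G) (shift_obj C (fob U_funct G))"
    "W_iso C G \<odot>\<^bsub>simplicial C\<^esub> \<beta> = Idn (simplicial C) (fob (W_funct C) G)"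
    using W_obj(3)[OF G] unfolding is_iso_def by blast
  note cmp = category.cmp_in[OF category_simplicial]
  have "W_iso C H \<odot>\<^bsub>simplicial C\<^esub> (?f \<odot>\<^bsub>simplicial C\<^esub> \<beta>)
      \<in> Hom (simplicial C) (fob (W_funct C) G) (fob (W_funct C) H)"
    by (rule cmp[OF _ _ _ cmp[OF _ _ _ \<beta>(1) f'] W_obj(2)[OF H]]) (simp_all add: S W del: U_obj_sel)
  moreover have "W_iso C H n \<odot> ?f n \<odot> \<beta> n = ?f n" for n
  proof -
    have "\<beta> n \<in> Hom C (lev (fob (W_funct C) G) n) (prd C (tower (lev (fob U_funct G)) n))"
      using simplicial_homD(1)[OF \<beta>(1), of n] by simp
    \<comment> \<open>Naturality is used at the element \<open>\<beta> n\<close>, which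
      \<open>W_iso\<close> sends to the identity.\<close>
    from W_iso_natural[OF G H f simplicial_objectD(1)[OF W(1)] this]
    have "W_iso C H n \<odot> ?f n \<odot> \<beta> n = ?f n \<odot> Idn C (lev (shift_obj C (fob U_funct G)) n)"
      using fun_cong[OF \<beta>(2), of n] by simp
    then show ?thesis
      by (simp only: cmp_idn[OF simplicial_objectD(1)[OF S(1)] simplicial_objectD(1)[OF S(2)] simplicial_homD(1)[OF f']])
  qed
  ultimately show ?thesis by simp
qed

text \<open>The laws for identities and composites involve the levels and the arrow part only, and
  in these \<open>W_funct\<close> coincides with the shift functor after
  \<open>U_funct\<close>.\<close>

lemma W_functor: "is_functor (sGrp C) (simplicial C) (W_funct C)"
proof (rule is_functorI)
  note F = is_functorD[OF shift_U_functor, unfolded fmap_shift_U]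
  have fm: "fmap (W_funct C) G H f = tower_map C (fob U_funct G) (fob U_funct H) f" for G H f
    by (simp add: W_funct_def)
  show "category (sGrp C)" "category (simplicial C)" by (fact F(1), fact F(2))
  show "fob (W_funct C) G \<in> Ob (simplicial C)" if "G \<in> Ob (sGrp C)" for G
    using that W_obj(1) by simp
  show "fmap (W_funct C) G H f \<in> Hom (simplicial C) (fob (W_funct C) G) (fob (W_funct C) H)"
    if "G \<in> Ob (sGrp C)" "H \<in> Ob (sGrp C)" "f \<in> Hom (sGrp C) G H" for G H f
    using that W_map_simplicial by (simp add: fm)
  show "fmap (W_funct C) G G (Idn (sGrp C) G) = Idn (simplicial C) (fob (W_funct C) G)"
    if "G \<in> Ob (sGrp C)" for G
    using F(5)[OF that] by (simp add: fm comp_funct_def)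
  show "fmap (W_funct C) G K (g \<odot>\<^bsub>sGrp C\<^esub> f)
      = fmap (W_funct C) H K g \<odot>\<^bsub>simplicial C\<^esub> fmap (W_funct C) G H f"
    if "G \<in> Ob (sGrp C)" "H \<in> Ob (sGrp C)" "K \<in> Ob (sGrp C)" "f \<in> Hom (sGrp C) G H" "g \<in> Hom (sGrp C) H K"
    for G H K f g
    using F(6)[OF that] unfolding fm .
qed

lemma shift_iso_W: "naturally_isomorphic (sGrp C) (simplicial C) (shift_funct C \<circ>\<^sub>F U_funct) (W_funct C)"
  unfolding naturally_isomorphic_def
proof (intro exI[of _ "W_iso C"] conjI ballI)
  show "nat_trans (sGrp C) (simplicial C) (shift_funct C \<circ>\<^sub>F U_funct) (W_funct C) (W_iso C)"
    unfolding nat_trans_def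
  proof (intro conjI ballI shift_U_functor W_functor)
    fix G assume "G \<in> Ob (sGrp C)"
    then show "W_iso C G \<in> Hom (simplicial C) (fob (shift_funct C \<circ>\<^sub>F U_funct) G) (fob (W_funct C) G)"
      using W_obj(2) by (simp add: comp_funct_def)
  next
    fix G H f assume "G \<in> Ob (sGrp C)" "H \<in> Ob (sGrp C)" and f: "f \<in> Hom (sGrp C) G H"
    then have G: "simplicial_object (Grp C) G" and H: "simplicial_object (Grp C) H" by simp_all
    note SX = simplicial_shift_obj[OF U_simplicial[OF G]] and SX' = simplicial_shift_obj[OF U_simplicial[OF H]]
    have S: "tower_map C (fob U_funct G) (fob U_funct H) f
        \<in> Hom (simplicial C) (shift_obj C (fob U_funct G)) (shift_obj C (fob U_funct H))"
      using is_functorD(4)[OF shift_U_functor, of G H f] G H f unfolding fmap_shift_U by (simp add: comp_funct_def)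
    have "W_iso C H \<odot>\<^bsub>simplicial C\<^esub> tower_map C (fob U_funct G) (fob U_funct H) f
      = tower_map C (fob U_funct G) (fob U_funct H) f \<odot>\<^bsub>simplicial C\<^esub> W_iso C G"
      by (rule simplicial_cmp_eqI[OF SX SX' W_obj(1)[OF G] W_obj(1)[OF H] S W_obj(2)[OF H] W_obj(2)[OF G]
            W_map_simplicial[OF G H f]]) (rule W_iso_natural[OF G H f], assumption, simp del: U_obj_sel)
    then show "W_iso C H \<odot>\<^bsub>simplicial C\<^esub> fmap (shift_funct C \<circ>\<^sub>F U_funct) G H f
      = fmap (W_funct C) G H f \<odot>\<^bsub>simplicial C\<^esub> W_iso C G"
      unfolding fmap_shift_U by (simp only: W_funct_def funct.simps)
  qed
  fix G assume "G \<in> Ob (sGrp C)"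
  then show "is_iso (simplicial C) (fob (shift_funct C \<circ>\<^sub>F U_funct) G) (fob (W_funct C) G) (W_iso C G)"
    using W_obj(3) by (simp add: comp_funct_def)
qed

end

section \<open>The underlying group of an algebra\<close>

text \<open>The lifted substitution works on chosen representatives; by \<open>geq_subst\<close> the
  class of the result does not depend on the choice.\<close>

lemma gsubst_abs: "gsubst (\<lambda>i. abs_gword (\<sigma> i)) (abs_gword t) = abs_gword (gterm_subst \<sigma> t)"
proof -
  have r: "geq (rep_gword (abs_gword s)) s" for s
    by (simp add: gword.abs_eq_iff[symmetric] Quotient_abs_rep[OF Quotient_gword])
  have "gsubst (\<lambda>i. abs_gword (\<sigma> i)) (abs_gword t)
    = abs_gword (gterm_subst (\<lambda>i. rep_gword (abs_gword (\<sigma> i))) (rep_gword (abs_gword t)))"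
    by (simp add: gsubst_def map_fun_def comp_def)
  also have "\<dots> = abs_gword (gterm_subst \<sigma> t)"
    unfolding gword.abs_eq_iff by (rule geq_subst[OF r r])
  finally show ?thesis .
qed

text \<open>In the theory the substituted words form a list, and \<open>ws ! i\<close> is only
  determined below its length, so the premise concerns the variables of \<open>t\<close> alone. At
  other indices any representative of \<open>f i\<close> will do.\<close>

lemma gsubst_cong_abs:
  assumes "\<And>i. i \<in> gvars t \<Longrightarrow> f i = abs_gword (\<sigma> i)"
  shows "gsubst f (abs_gword t) = abs_gword (gterm_subst \<sigma> t)"
proof -
  let ?\<tau> = "\<lambda>i. if i \<in> gvars t then \<sigma> i else rep_gword (f i)"
  have "f = (\<lambda>i. abs_gword (?\<tau> i))"
    using assms by (auto simp: Quotient_abs_rep[OF Quotient_gword])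
  then have "gsubst f (abs_gword t) = abs_gword (gterm_subst ?\<tau> t)" by (metis gsubst_abs)
  also have "gterm_subst ?\<tau> t = gterm_subst \<sigma> t"
  proof -
    have "gvars u \<subseteq> gvars t \<Longrightarrow> gterm_subst ?\<tau> u = gterm_subst \<sigma> u" for u by (induction u) auto
    then show ?thesis by simp
  qed
  finally show ?thesis .
qed

lemma gword_hom: "gvars t \<subseteq> {..<n} \<Longrightarrow> [abs_gword t] \<in> Hom group_theory n 1"
  by (auto simp: group_theory_def gword_in_def)

section \<open>Group words as operations of an algebra\<close>

locale group_algebras = algebras C T
  for C :: "('o, 'm, 'z) fpcat_scheme" (structure) and T :: "'t lawvere" +
  fixes \<phi> :: "(nat, gword list, nat, 't) funct"
  assumes \<phi>: "theory_morphism group_theory T \<phi>"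
begin

lemma \<phi>_functor: "is_functor group_theory T \<phi>"
  using \<phi> by (simp add: theory_morphism_def)

lemma \<phi>_ob [simp]: "fob \<phi> n = n"
  using \<phi> by (simp add: theory_morphism_def)

lemma \<phi>_var: "i < n \<Longrightarrow> fmap \<phi> n 1 [abs_gword (Var i)] = lproj T n i"
  using \<phi> by (simp add: theory_morphism_def group_theory_def)

lemma \<phi>_hom: "ws \<in> Hom group_theory n m \<Longrightarrow> fmap \<phi> n m ws \<in> Hom T n m"
  using is_functorD(4)[OF \<phi>_functor, of n m ws] by (simp add: group_theory_def)

lemma \<phi>_cmp:
  "\<lbrakk>ws \<in> Hom group_theory n m; vs \<in> Hom group_theory m k\<rbrakk>
    \<Longrightarrow> fmap \<phi> n k (map (gsubst (\<lambda>i. ws ! i)) vs) = fmap \<phi> m k vs \<odot>\<^bsub>T\<^esub> fmap \<phi> n m ws"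
  using is_functorD(6)[OF \<phi>_functor, of n m k ws vs] by (simp add: group_theory_def)

text \<open>Indexed by terms instead of classes, so that each group axiom enters as an instance of
  \<open>word_op_geq\<close> and the structure of a term remains visible.\<close>

definition word_op :: "('o, 'm, 't) talg \<Rightarrow> nat \<Rightarrow> gterm \<Rightarrow> 'm" where
  "word_op A n t = talg_op A n (fmap \<phi> n 1 [abs_gword t])"

lemma word_op_geq: "geq s t \<Longrightarrow> word_op A n s = word_op A n t"
  by (simp add: word_op_def gword.abs_eq_iff[THEN iffD2])

lemma word_op_hom:
  "\<lbrakk>t_algebra C T A; gvars t \<subseteq> {..<n}\<rbrakk>
    \<Longrightarrow> word_op A n t \<in> Hom C (pow n (tcarr A)) (tcarr A)"
  unfolding word_op_def by (rule t_algebraD(2)[OF _ \<phi>_hom[OF gword_hom]])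

end

locale group_algebras_stage = group_algebras C T \<phi> + algebras_stage C T Y
  for C :: "('o, 'm, 'z) fpcat_scheme" (structure) and T :: "'t lawvere"
    and \<phi> :: "(nat, gword list, nat, 't) funct" and Y
begin

abbreviation "U \<equiv> underlying_grp C \<phi>"

lemma word_op_el:
  "\<lbrakk>t_algebra C T A; gvars t \<subseteq> {..<n}; x \<in> el (pow n (tcarr A))\<rbrakk>
    \<Longrightarrow> word_op A n t \<odot> x \<in> el (tcarr A)"
  unfolding word_op_def by (rule op_el[OF _ \<phi>_hom[OF gword_hom]])

lemma word_op_Var: "\<lbrakk>t_algebra C T A; i < n\<rbrakk> \<Longrightarrow> word_op A n (Var i) = prj C (replicate n (tcarr A)) i"
  unfolding word_op_def by (simp only: \<phi>_var t_algebraD(4))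

text \<open>Substituting \<open>ts\<close> into the word \<open>u\<close> is composition in the theory, hence composition of operations.\<close>

lemma word_op_subst:
  assumes A: "t_algebra C T A" and x: "x \<in> el (pow n (tcarr A))"
    and u: "gvars u \<subseteq> {..<length ts}" and ts: "\<And>i. i < length ts \<Longrightarrow> gvars (ts ! i) \<subseteq> {..<n}"
  obtains w where "w \<in> el (pow (length ts) (tcarr A))"
    and "\<And>i. i < length ts \<Longrightarrow> prj C (replicate (length ts) (tcarr A)) i \<odot> w = word_op A n (ts ! i) \<odot> x"
    and "word_op A n (gterm_subst (\<lambda>i. ts ! i) u) \<odot> x = word_op A (length ts) u \<odot> w"
proof -
  let ?m = "length ts" and ?ws = "map abs_gword ts"
  have ws: "?ws \<in> Hom group_theory n ?m"
    using ts by (force simp: group_theory_def gword_in_def in_set_conv_nth)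
  let ?\<tau> = "fmap \<phi> n ?m ?ws"
  have \<tau>: "?\<tau> \<in> Hom T n ?m" by (rule \<phi>_hom[OF ws])
  \<comment> \<open>Used for \<open>u\<close> itself and, with \<open>Var i\<close> for
    \<open>v\<close>, to identify the components of \<tau> as the given terms.\<close>
  have sub: "fmap \<phi> n 1 [abs_gword (gterm_subst (\<lambda>i. ts ! i) v)] = fmap \<phi> ?m 1 [abs_gword v] \<odot>\<^bsub>T\<^esub> ?\<tau>"
    if v: "gvars v \<subseteq> {..<?m}" for v
  proof -
    have "gsubst (\<lambda>i. ?ws ! i) (abs_gword v) = abs_gword (gterm_subst (\<lambda>i. ts ! i) v)"
      by (rule gsubst_cong_abs) (use v in auto)
    then show ?thesis using \<phi>_cmp[OF ws gword_hom[OF v]] by simp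
  qed
  show thesis
  proof (rule that)
    show "op_tuple A n ?m ?\<tau> \<odot> x \<in> el (pow ?m (tcarr A))" by (rule op_tuple_el[OF A \<tau> x])
    show "word_op A n (gterm_subst (\<lambda>i. ts ! i) u) \<odot> x = word_op A ?m u \<odot> op_tuple A n ?m ?\<tau> \<odot> x"
      unfolding word_op_def sub[OF u] by (rule op_cmp[OF A \<tau> \<phi>_hom[OF gword_hom[OF u]] x])
    fix i assume i: "i < ?m"
    then have "lproj T ?m i \<odot>\<^bsub>T\<^esub> ?\<tau> = fmap \<phi> n 1 [abs_gword (ts ! i)]"
      using sub[of "Var i"] \<phi>_var[OF i] by simp
    then show "prj C (replicate ?m (tcarr A)) i \<odot> op_tuple A n ?m ?\<tau> \<odot> x = word_op A n (ts ! i) \<odot> x"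
      using prj_op_tuple[OF A \<tau> x i] by (simp add: word_op_def)
  qed
qed

text \<open>The term arises from \<open>Mul (Var 0) (Var 1)\<close> by substituting \<open>s\<close>
  and \<open>t\<close>, and the element supplied by \<open>word_op_subst\<close> is determined by
  its two coordinates.\<close>

lemma word_op_Mul:
  assumes A: "t_algebra C T A" and x: "x \<in> el (pow n (tcarr A))"
    and s: "gvars s \<subseteq> {..<n}" and t: "gvars t \<subseteq> {..<n}"
  shows "word_op A n (Mul s t) \<odot> x = gtimes C (U A) Y (word_op A n s \<odot> x) (word_op A n t \<odot> x)"
proof -
  have ts: "gvars ([s, t] ! i) \<subseteq> {..<n}" if "i < length [s, t]" for i
    using that s t by (auto simp: less_Suc_eq)
  obtain w where w: "w \<in> el (pow 2 (tcarr A))"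
    "\<And>i. i < 2 \<Longrightarrow> prj C (replicate 2 (tcarr A)) i \<odot> w = word_op A n ([s, t] ! i) \<odot> x"
    "word_op A n (Mul s t) \<odot> x = word_op A 2 (Mul (Var 0) (Var 1)) \<odot> w"
    by (rule word_op_subst[OF A x _ ts, of "Mul (Var 0) (Var 1)"]) (simp_all add: numeral_2_eq_2)
  have "w = tuple C Y [tcarr A, tcarr A] [word_op A n s \<odot> x, word_op A n t \<odot> x]"
    using w(1) w(2)[of 0] w(2)[of 1]
    by (intro pair_eqI[OF t_algebraD(1)[OF A] word_op_el[OF A s x] word_op_el[OF A t x]])
      (simp_all add: numeral_2_eq_2)
  then show ?thesis unfolding w(3) by (simp add: gtimes_def underlying_grp_def word_op_def)
qed

lemma word_op_One:
  assumes A: "t_algebra C T A" and x: "x \<in> el (pow n (tcarr A))"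
  shows "word_op A n One \<odot> x = gone C (U A) Y"
proof -
  obtain w where w: "w \<in> el (prd C [])" "word_op A n One \<odot> x = word_op A 0 One \<odot> w"
    using word_op_subst[OF A x, of One "[]"] by auto
  have "w = tuple C Y [] []"
    by (rule tuple_unique[OF Y, symmetric]) (use w(1) in simp_all)
  then show ?thesis unfolding w(2) by (simp add: gone_def underlying_grp_def word_op_def)
qed

text \<open>The arrow with component \<open>Idn C a\<close> inverts the projection of the chosen
  product of \<open>[a]\<close>, so an element of that product is recovered from its single
  coordinate. Inversion in \<open>underlying_grp\<close> is composed with this arrow.\<close>

lemma singleton_tuple:
  assumes "a \<in> Ob C" "y \<in> el a" "w \<in> el (prd C [a])" "prj C [a] 0 \<odot> w = y"
  shows "tuple C a [a] [Idn C a] \<odot> y = w"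
proof (rule prd_eqI[OF Y])
  have t: "tuple C a [a] [Idn C a] \<in> Hom C a (prd C [a])"
    by (rule tuple_hom[OF assms(1)]) (use assms(1) idn_in in simp_all)
  show "tuple C a [a] [Idn C a] \<odot> y \<in> el (prd C [a])"
    by (rule el_cmp[OF t assms(2,1) prd_ob]) (use assms(1) in simp)
  fix i assume i: "i < length [a]"
  have "prj C [a] i \<odot> tuple C a [a] [Idn C a] \<odot> y = [Idn C a] ! i \<odot> y"
    by (rule prj_tuple_el[OF assms(2,1) _ _ i]) (use assms(1) idn_in in simp_all)
  then show "prj C [a] i \<odot> tuple C a [a] [Idn C a] \<odot> y = prj C [a] i \<odot> w"
    using i assms(4) idn_cmp[OF Y assms(1,2)] by simp
qed (use assms in simp_all)

lemma singleton_tuple_hom: "a \<in> Ob C \<Longrightarrow> tuple C a [a] [Idn C a] \<in> Hom C a (prd C [a])"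
  by (rule tuple_hom) (use idn_in in simp_all)

lemma word_op_Inv:
  assumes A: "t_algebra C T A" and x: "x \<in> el (pow n (tcarr A))" and s: "gvars s \<subseteq> {..<n}"
  shows "word_op A n (Inv s) \<odot> x = ginv (U A) \<odot> word_op A n s \<odot> x"
proof -
  note ob = t_algebraD(1)[OF A]
  obtain w where w: "w \<in> el (prd C [tcarr A])" "prj C [tcarr A] 0 \<odot> w = word_op A n s \<odot> x"
    "word_op A n (Inv s) \<odot> x = word_op A 1 (Inv (Var 0)) \<odot> w"
    using word_op_subst[OF A x, of "Inv (Var 0)" "[s]"] s by auto
  have pob: "prd C [tcarr A] \<in> Ob C" using ob by simp
  have h: "word_op A 1 (Inv (Var 0)) \<in> Hom C (prd C [tcarr A]) (tcarr A)"
    using word_op_hom[OF A, of "Inv (Var 0)" 1] by simp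
  show ?thesis
    unfolding w(3) singleton_tuple[OF ob word_op_el[OF A s x] w(1,2), symmetric]
    using el_assoc[OF word_op_el[OF A s x] singleton_tuple_hom[OF ob] h ob pob ob]
    by (simp add: underlying_grp_def word_op_def)
qed

text \<open>An element prescribing the values of all variables; evaluating provably equal words
  there turns a derivation from the group axioms into an equation of elements.\<close>

lemma power_tuple:
  assumes A: "t_algebra C T A" and xs: "set xs \<subseteq> el (tcarr A)"
  obtains w where "w \<in> el (pow (length xs) (tcarr A))"
    "\<And>i. i < length xs \<Longrightarrow> word_op A (length xs) (Var i) \<odot> w = xs ! i"
proof (rule that)
  note ob = set_replicate_ob[OF t_algebraD(1)[OF A]]
  have fs: "xs ! i \<in> el (replicate (length xs) (tcarr A) ! i)" if "i < length (replicate (length xs) (tcarr A))" for i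
    using that xs by (auto simp: subset_iff)
  show "tuple C Y (replicate (length xs) (tcarr A)) xs \<in> el (pow (length xs) (tcarr A))"
    by (rule tuple_hom[OF Y ob _ fs]) simp_all
  show "word_op A (length xs) (Var i) \<odot> tuple C Y (replicate (length xs) (tcarr A)) xs = xs ! i"
    if "i < length xs" for i
    unfolding word_op_Var[OF A that] by (rule prj_tuple[OF Y ob _ fs]) (use that in simp_all)
qed

text \<open>The two bracketings are values, at the element with coordinates a, b, c, of words
  identified by \<open>geq.assoc\<close>.\<close>

lemma underlying_assoc:
  assumes A: "t_algebra C T A" and el: "a \<in> el (tcarr A)" "b \<in> el (tcarr A)" "c \<in> el (tcarr A)"
  shows "gtimes C (U A) Y (gtimes C (U A) Y a b) c = gtimes C (U A) Y a (gtimes C (U A) Y b c)"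
proof -
  obtain w where w: "w \<in> el (pow (length [a, b, c]) (tcarr A))"
    "\<And>i. i < length [a, b, c] \<Longrightarrow> word_op A (length [a, b, c]) (Var i) \<odot> w = [a, b, c] ! i"
    using power_tuple[OF A, of "[a, b, c]"] el by auto
  let ?n = "length [a, b, c]"
  have v: "word_op A ?n (Var 0) \<odot> w = a" "word_op A ?n (Var 1) \<odot> w = b" "word_op A ?n (Var 2) \<odot> w = c"
    using w(2)[of 0] w(2)[of 1] w(2)[of 2] by simp_all
  have "word_op A ?n (Mul (Mul (Var 0) (Var 1)) (Var 2)) \<odot> w = word_op A ?n (Mul (Var 0) (Mul (Var 1) (Var 2))) \<odot> w"
    using word_op_geq[OF geq.assoc] by simp
  then show ?thesis
    using word_op_Mul[OF A w(1), of "Mul (Var 0) (Var 1)" "Var 2"] word_op_Mul[OF A w(1), of "Var 0" "Var 1"]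
      word_op_Mul[OF A w(1), of "Var 0" "Mul (Var 1) (Var 2)"] word_op_Mul[OF A w(1), of "Var 1" "Var 2"] v
    by simp
qed

lemma underlying_unit_inv:
  assumes A: "t_algebra C T A" and a: "a \<in> el (tcarr A)"
  shows "gtimes C (U A) Y (gone C (U A) Y) a = a" "gtimes C (U A) Y a (gone C (U A) Y) = a"
    "gtimes C (U A) Y (ginv (U A) \<odot> a) a = gone C (U A) Y"
    "gtimes C (U A) Y a (ginv (U A) \<odot> a) = gone C (U A) Y"
proof -
  obtain w where w: "w \<in> el (pow 1 (tcarr A))" "word_op A 1 (Var 0) \<odot> w = a"
    using power_tuple[OF A, of "[a]"] a by auto
  note ev = word_op_Mul[OF A w(1)] word_op_One[OF A w(1)] word_op_Inv[OF A w(1)] w(2)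
  show "gtimes C (U A) Y (gone C (U A) Y) a = a"
    using word_op_geq[OF geq.one_left, of A 1 "Var 0"] ev(1)[of One "Var 0"] by (simp add: ev(2-4) del: One_nat_def)
  show "gtimes C (U A) Y a (gone C (U A) Y) = a"
    using word_op_geq[OF geq.one_right, of A 1 "Var 0"] ev(1)[of "Var 0" One] by (simp add: ev(2-4) del: One_nat_def)
  show "gtimes C (U A) Y (ginv (U A) \<odot> a) a = gone C (U A) Y"
    using word_op_geq[OF geq.inv_left, of A 1 "Var 0"] ev(1)[of "Inv (Var 0)" "Var 0"] by (simp add: ev(2-4) del: One_nat_def)
  show "gtimes C (U A) Y a (ginv (U A) \<odot> a) = gone C (U A) Y"
    using word_op_geq[OF geq.inv_right, of A 1 "Var 0"] ev(1)[of "Var 0" "Inv (Var 0)"] by (simp add: ev(2-4) del: One_nat_def)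
qed

end

section \<open>The forgetful functors and the two liftings\<close>

context group_algebras
begin

lemma group_algebras_stage: "Y \<in> Ob C \<Longrightarrow> group_algebras_stage C T \<phi> Y"
  by (simp add: group_algebras_stage_def group_algebras_axioms algebras_stage)

lemma underlying_grp_word_op:
  "underlying_grp C \<phi> A = \<lparr>gcarr = tcarr A, gmult = word_op A 2 (Mul (Var 0) (Var 1)),
    gunit = word_op A 0 One,
    ginv = word_op A 1 (Inv (Var 0)) \<odot> tuple C (tcarr A) [tcarr A] [Idn C (tcarr A)]\<rparr>"
  by (simp add: underlying_grp_def word_op_def)

lemma gcarr_underlying [simp]: "gcarr (underlying_grp C \<phi> A) = tcarr A"
  by (simp add: underlying_grp_def)

lemma group_object_underlying:
  assumes A: "t_algebra C T A"
  shows "group_object C (underlying_grp C \<phi> A)"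
proof -
  note ob = t_algebraD(1)[OF A]
  interpret group_algebras_stage C T \<phi> "tcarr A" by (rule group_algebras_stage[OF ob])
  have pob: "prd C [tcarr A] \<in> Ob C" using ob by simp
  have "gmult (U A) \<in> Hom C (prd C [tcarr A, tcarr A]) (tcarr A)"
    using word_op_hom[OF A, of "Mul (Var 0) (Var 1)" 2] by (simp add: underlying_grp_word_op numeral_2_eq_2)
  moreover have "gunit (U A) \<in> Hom C (prd C []) (tcarr A)"
    using word_op_hom[OF A, of One 0] by (simp add: underlying_grp_word_op)
  moreover have "ginv (U A) \<in> Hom C (tcarr A) (tcarr A)"
    using cmp_in[OF ob pob ob singleton_tuple_hom[OF ob], of "word_op A 1 (Inv (Var 0))"]
      word_op_hom[OF A, of "Inv (Var 0)" 1] by (simp add: underlying_grp_word_op)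
  ultimately show ?thesis
    unfolding group_object_def gcarr_underlying
    using ob group_algebras_stage.underlying_assoc[OF group_algebras_stage A]
      group_algebras_stage.underlying_unit_inv[OF group_algebras_stage A] by blast
qed

text \<open>Multiplication is one of the operations of the theory, and its preservation is all that
  \<open>Hom (Grp C)\<close> demands.\<close>

lemma talg_forget_functor: "is_functor (TAlg C T) (Grp C) (talg_forget C \<phi>)"
proof (rule is_functorI)
  fix A B h assume "A \<in> Ob (TAlg C T)" "B \<in> Ob (TAlg C T)" and h: "h \<in> Hom (TAlg C T) A B"
  have "fmap \<phi> 2 1 [abs_gword (Mul (Var 0) (Var 1))] \<in> Hom T 2 1"
    by (rule \<phi>_hom[OF gword_hom]) simp
  from TAlg_homD(1)[OF h] TAlg_homD(2)[OF h this]
  show "fmap (talg_forget C \<phi>) A B h \<in> Hom (Grp C) (fob (talg_forget C \<phi>) A) (fob (talg_forget C \<phi>) B)"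
    by (simp add: Grp_def talg_forget_def underlying_grp_def numeral_2_eq_2)
qed (simp_all add: talg_forget_def category_TAlg category_Grp group_object_underlying)

lemma V_functor: "is_functor (sTAlg C T) (sGrp C) (V_funct C \<phi>)"
  unfolding V_funct_def by (rule levelwise_functor[OF talg_forget_functor])

text \<open>Equality of records forces the structure arrows to coincide. For multiplication the
  components are the same terms once \<open>prod_map\<close> is unfolded; for the unit and the
  inverse they differ by arrows out of the empty and the one-fold product, which have to be
  computed.\<close>

lemma underlying_prod:
  assumes As: "set As \<subseteq> Collect (t_algebra C T)"
  shows "underlying_grp C \<phi> (prod_talg C T As) = prod_grp C (map (underlying_grp C \<phi>) As)"
proof -
  let ?Bs = "map tcarr As" and ?P = "prd C (map tcarr As)" and ?U = "underlying_grp C \<phi>"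
  note Pob = prd_ob[OF As_carr[OF As]]
  have ob0: "prd C [] \<in> Ob C" and ob1: "prd C [?P] \<in> Ob C" using Pob by simp_all
  have carr: "map gcarr (map ?U As) = ?Bs" by (simp add: comp_def)
  have \<omega>: "fmap \<phi> n 1 [abs_gword t] \<in> Hom T n 1" if "gvars t \<subseteq> {..<n}" for n t
    by (rule \<phi>_hom[OF gword_hom[OF that]])
  have op: "word_op (prod_talg C T As) n t = tuple C (pow n ?P) ?Bs
      (map (\<lambda>j. word_op (As ! j) n t \<odot> pow_prj As n j) [0..<length As])" if "gvars t \<subseteq> {..<n}" for n t
    unfolding word_op_def by (rule talg_op_prod[OF As \<omega>[OF that]])
  have mult: "word_op (prod_talg C T As) 2 (Mul (Var 0) (Var 1)) = tuple C (prd C [?P, ?P]) ?Bs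
      (map (\<lambda>j. gtimes C (map ?U As ! j) (prd C [?P, ?P])
        (prj C ?Bs j \<odot> prj C [?P, ?P] 0) (prj C ?Bs j \<odot> prj C [?P, ?P] 1)) [0..<length (map ?U As)])"
  proof -
    have "word_op (As ! j) 2 (Mul (Var 0) (Var 1)) \<odot> pow_prj As 2 j
      = gtimes C (map ?U As ! j) (prd C [?P, ?P]) (prj C ?Bs j \<odot> prj C [?P, ?P] 0) (prj C ?Bs j \<odot> prj C [?P, ?P] 1)"
      if "j < length As" for j
      using that by (simp add: gtimes_def underlying_grp_word_op prod_map_def numeral_2_eq_2)
    then have eq: "map (\<lambda>j. word_op (As ! j) 2 (Mul (Var 0) (Var 1)) \<odot> pow_prj As 2 j) [0..<length As]
      = map (\<lambda>j. gtimes C (map ?U As ! j) (prd C [?P, ?P]) (prj C ?Bs j \<odot> prj C [?P, ?P] 0)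
          (prj C ?Bs j \<odot> prj C [?P, ?P] 1)) [0..<length (map ?U As)]"
      by (intro map_cong) simp_all
    have g: "gvars (Mul (Var 0) (Var 1)) \<subseteq> {..<2}" by simp
    have r: "pow 2 ?P = prd C [?P, ?P]" by (simp add: numeral_2_eq_2)
    show ?thesis unfolding op[OF g] eq r ..
  qed
  have unit: "word_op (prod_talg C T As) 0 One = tuple C (prd C []) ?Bs (map gunit (map ?U As))"
  proof -
    have "word_op (As ! j) 0 One \<odot> pow_prj As 0 j = word_op (As ! j) 0 One" if "j < length As" for j
    proof -
      \<comment> \<open>The empty product is terminal, so its only endomorphism is the
        identity.\<close>
      have "pow_prj As 0 j = Idn C (prd C [])"
        by (rule prd_eqI[OF ob0, of "[]"]) (use pow_prj_hom[OF As that, of 0] idn_in[OF ob0] in simp_all)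
      then show ?thesis
        using cmp_idn[OF ob0 As_carr_nth[OF As that]] word_op_hom[OF As_alg[OF As that], of One 0] by simp
    qed
    then have "map (\<lambda>j. word_op (As ! j) 0 One \<odot> pow_prj As 0 j) [0..<length As]
      = map (\<lambda>j. word_op (As ! j) 0 One) [0..<length As]" by simp
    also have "\<dots> = map gunit (map ?U As)"
      by (rule nth_equalityI) (simp_all add: underlying_grp_word_op)
    finally show ?thesis by (simp add: op)
  qed
  have inv: "word_op (prod_talg C T As) 1 (Inv (Var 0)) \<odot> tuple C ?P [?P] [Idn C ?P]
    = tuple C ?P ?Bs (map (\<lambda>j. ginv (map ?U As ! j) \<odot> prj C ?Bs j) [0..<length (map ?U As)])"
    (is "?l = _")
  proof (rule tuple_unique[OF Pob As_carr[OF As], symmetric])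
    interpret group_algebras_stage C T \<phi> ?P by (rule group_algebras_stage[OF Pob])
    note t = singleton_tuple_hom[OF Pob]
    have h: "word_op (prod_talg C T As) 1 (Inv (Var 0)) \<in> Hom C (prd C [?P]) ?P"
      using word_op_hom[OF t_algebra_prod[OF As], of "Inv (Var 0)" 1] by simp
    show "?l \<in> el ?P" by (rule el_cmp[OF h t ob1 Pob])
    fix i assume "i < length ?Bs"
    then have i: "i < length As" by simp
    note Bob = As_carr_nth[OF As i] and p = As_prj[OF As i]
    have iob: "prd C [tcarr (As ! i)] \<in> Ob C" using Bob by simp
    have t': "tuple C ?P [?P] [Idn C ?P] \<in> el (pow 1 ?P)" using t by simp
    have hi: "word_op (As ! i) 1 (Inv (Var 0)) \<in> Hom C (prd C [tcarr (As ! i)]) (tcarr (As ! i))"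
      using word_op_hom[OF As_alg[OF As i], of "Inv (Var 0)" 1] by simp
    have "prj C ?Bs i \<odot> ?l = word_op (As ! i) 1 (Inv (Var 0)) \<odot> pow_prj As 1 i \<odot> tuple C ?P [?P] [Idn C ?P]"
      unfolding word_op_def by (rule prj_prod_op[OF As \<omega> t' i]) simp
    \<comment> \<open>Naturality of the comparison between an object and its chosen one-fold
      product.\<close>
    also have "pow_prj As 1 i \<odot> tuple C ?P [?P] [Idn C ?P] = tuple C (tcarr (As ! i)) [tcarr (As ! i)] [Idn C (tcarr (As ! i))] \<odot> prj C ?Bs i"
    proof (rule singleton_tuple[OF Bob p, symmetric])
      show "pow_prj As 1 i \<odot> tuple C ?P [?P] [Idn C ?P] \<in> el (prd C [tcarr (As ! i)])"
        using pow_prj_el[OF As t' i] by simp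
      have "prj C [?P] 0 \<odot> tuple C ?P [?P] [Idn C ?P] = Idn C ?P"
        using prj_tuple[OF Pob, of "[?P]" "[Idn C ?P]" 0] Pob idn_in[OF Pob] by simp
      then show "prj C [tcarr (As ! i)] 0 \<odot> pow_prj As 1 i \<odot> tuple C ?P [?P] [Idn C ?P] = prj C ?Bs i"
        using prj_pow_prj[OF As t' i, of 0] cmp_idn[OF Pob Bob p] by simp
    qed
    also have "word_op (As ! i) 1 (Inv (Var 0)) \<odot> tuple C (tcarr (As ! i)) [tcarr (As ! i)] [Idn C (tcarr (As ! i))] \<odot> prj C ?Bs i
      = ginv (?U (As ! i)) \<odot> prj C ?Bs i"
      using el_assoc[OF p singleton_tuple_hom[OF Bob] hi Bob iob Bob] by (simp add: underlying_grp_word_op)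
    finally show "prj C ?Bs i \<odot> ?l = map (\<lambda>j. ginv (map ?U As ! j) \<odot> prj C ?Bs j) [0..<length (map ?U As)] ! i"
      using i by simp
  qed simp
  show ?thesis
    unfolding underlying_grp_word_op[of "prod_talg C T As"] prod_grp_def Let_def tcarr_prod_talg carr mult unit inv ..
qed

lemma UV_obj: "fob U_funct (fob (V_funct C \<phi>) A) = talg_underlying A"
  by (simp add: U_funct_def V_funct_def levelwise_def grp_forget_def talg_forget_def talg_underlying_def
      mk_sobj_def fun_eq_iff)

lemma V_map: "fmap (V_funct C \<phi>) A B f = f"
  by (simp add: V_funct_def levelwise_def talg_forget_def)

lemma U_map: "fmap U_funct G H f = f"
  by (simp add: U_funct_def levelwise_def grp_forget_def)

lemma V_WT_eq_Wgr_V: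
  "funct_eq (sTAlg C T) (sGrp C) (V_funct C \<phi> \<circ>\<^sub>F WT_funct C T) (Wgr_funct C \<circ>\<^sub>F V_funct C \<phi>)"
proof (rule funct_eqI)
  show "is_functor (sTAlg C T) (sGrp C) (V_funct C \<phi> \<circ>\<^sub>F WT_funct C T)"
    by (rule is_functor_comp[OF WT_functor V_functor])
next
  fix A assume "A \<in> Ob (sTAlg C T)"
  then have A: "set (tower (lev A) n) \<subseteq> Collect (t_algebra C T)" for n
    using simplicial_objectD(1)[of "TAlg C T" A] by (auto simp: set_tower)
  have lev: "lev (fob (V_funct C \<phi>) A) = (\<lambda>n. underlying_grp C \<phi> (lev A n))"
    by (simp add: V_funct_def levelwise_def talg_forget_def)
  have "fob (V_funct C \<phi>) (fob (WT_funct C T) A)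
    = mk_sobj (\<lambda>n. underlying_grp C \<phi> (prod_talg C T (tower (lev A) n)))
        (shift_face C (talg_underlying A)) (shift_degen C (talg_underlying A))"
    by (simp add: V_funct_def levelwise_def talg_forget_def WT_funct_def mk_sobj_def fun_eq_iff)
  then show "fob (Wgr_funct C \<circ>\<^sub>F V_funct C \<phi>) A = fob (V_funct C \<phi> \<circ>\<^sub>F WT_funct C T) A"
    by (simp add: comp_funct_def Wgr_funct_def UV_obj lev underlying_prod[OF A] map_tower)
next
  fix A B f
  show "fmap (Wgr_funct C \<circ>\<^sub>F V_funct C \<phi>) A B f = fmap (V_funct C \<phi> \<circ>\<^sub>F WT_funct C T) A B f"
    by (simp add: comp_funct_def V_map) (simp add: Wgr_funct_def WT_funct_def UV_obj)
qed

text \<open>Forgetting all structure of W_T leaves literally the shift of the underlying simplicial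
  object, because \<open>tcarr\<close> of a product of algebras is the chosen product in
  \<open>C\<close>. The isomorphism with W, stated for the shift, can thus be moved to W_T.\<close>

lemma shift_UV_eq_UV_WT:
  "funct_eq (sTAlg C T) (simplicial C) ((shift_funct C \<circ>\<^sub>F U_funct) \<circ>\<^sub>F V_funct C \<phi>)
    (U_funct \<circ>\<^sub>F V_funct C \<phi> \<circ>\<^sub>F WT_funct C T)"
proof (rule funct_eqI)
  show "is_functor (sTAlg C T) (simplicial C) ((shift_funct C \<circ>\<^sub>F U_funct) \<circ>\<^sub>F V_funct C \<phi>)"
    by (rule is_functor_comp[OF V_functor shift_U_functor])
next
  fix A assume "A \<in> Ob (sTAlg C T)"
  have "talg_underlying (fob (WT_funct C T) A) = shift_obj C (talg_underlying A)"
    unfolding talg_underlying_def[of "fob (WT_funct C T) A"]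
    by (simp add: WT_funct_def shift_funct_def map_tower mk_sobj_def fun_eq_iff)
  then show "fob (U_funct \<circ>\<^sub>F V_funct C \<phi> \<circ>\<^sub>F WT_funct C T) A
    = fob ((shift_funct C \<circ>\<^sub>F U_funct) \<circ>\<^sub>F V_funct C \<phi>) A"
    by (simp add: comp_funct_def UV_obj)
next
  fix A B f
  show "fmap (U_funct \<circ>\<^sub>F V_funct C \<phi> \<circ>\<^sub>F WT_funct C T) A B f
    = fmap ((shift_funct C \<circ>\<^sub>F U_funct) \<circ>\<^sub>F V_funct C \<phi>) A B f"
    by (simp add: comp_funct_def V_map U_map UV_obj) (simp add: WT_funct_def shift_funct_def)
qed

end

theorem mainTheorem2:
  fixes C :: "('o, 'm) fpcat"
    and T :: "'t lawvere"
    and \<phi> :: "(nat, gword list, nat, 't) funct"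
  assumes "fp_category C"
    and "lawvere_theory T"
    and "theory_morphism group_theory T \<phi>"
  shows "is_functor (sTAlg C T) (sTAlg C T) (WT_funct C T)
    \<and> funct_eq (sTAlg C T) (sGrp C)
        (V_funct C \<phi> \<circ>\<^sub>F WT_funct C T) (Wgr_funct C \<circ>\<^sub>F V_funct C \<phi>)
    \<and> naturally_isomorphic (sTAlg C T) (simplicial C)
        (U_funct \<circ>\<^sub>F V_funct C \<phi> \<circ>\<^sub>F WT_funct C T) (W_funct C \<circ>\<^sub>F V_funct C \<phi>)
    \<and> (\<exists>\<eta> \<mu>. monad (sTAlg C T) (WT_funct C T) \<eta> \<mu>)"
proof -
  interpret group_algebras C T \<phi>
    using assms by (simp add: group_algebras_def group_algebras_axioms_def algebras_def)
  show ?thesis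
    \<comment> \<open>The natural isomorphism is \<open>shift_iso_W\<close> whiskered with
      \<open>V_funct C \<phi>\<close>, its source then replaced by an equal functor.\<close>
    using WT_functor V_WT_eq_Wgr_V WT_monad
      naturally_isomorphic_cong[OF naturally_isomorphic_precomp[OF V_functor shift_iso_W] shift_UV_eq_UV_WT]
    by blast
qed

end
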